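(* Let $\mathcal{A}$ be a homological category. Any torsion theory $(\mathcal{T},\mathcal{F})$ in $\mathcal{A}$ satisfying condition (N) induces a torsion theory $(\mathcal{T}_1,\mathcal{F}_1)$ in the arrow category $\mathrm{Arr}(\mathcal{A})$ which again satisfies condition (N). Here $\mathcal{F}_1$ is the full subcategory of $\mathrm{Arr}(\mathcal{A})$ consisting of all morphisms $f$ with $K[f]\in\mathcal{F}$, and $\mathcal{T}_1$ is the full subcategory of $\mathrm{Arr}(\mathcal{A})$ of all morphisms $T\to 0$ with $T\in\mathcal{T}$. If $(\mathcal{T},\mathcal{F})$ satisfies, besides condition (N), also condition (P), then $(\mathcal{T}_1,\mathcal{F}_1)$ satisfies (P) as well.
   Context: A category is pointed if it has a zero object $0$; $\ker(f)\colon K[f]\to A$ is the kernel of $f\colon A\to B$. Normal monomorphisms are kernels of some morphism. A short exact sequence is a composable pair $(k,f)$ with $k=\ker(f)$ and $f=\mathrm{coker}(k)$; a split short exact sequence is a triple $(k,f,s)$ with $k=\ker(f)$, $f\circ s=1$. A pointed category with pullbacks along split epimorphisms is protomodular if the split short five lemma holds. A homological category is a pointed protomodular regular category; if $\mathcal{A}$ is homological then so is the category $\mathrm{Arr}(\mathcal{A})$ of morphisms in $\mathcal{A}$ (with commutative squares as morphisms). A functor between pointed protomodular categories is protoadditive if it preserves split short exact sequences. A torsion theory in a pointed category $\mathcal{A}$ is a pair $(\mathcal{T},\mathcal{F})$ of full replete subcategories such that $\mathrm{Hom}_{\mathcal{A}}(T,F)=\{0\}$ for all $T\in\mathcal{T}$,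 $F\in\mathcal{F}$, and every object $A$ admits a short exact sequence $0\to T(A)\xrightarrow{t_A}A\xrightarrow{\eta_A}F(A)\to 0$ with $T(A)\in\mathcal{T}$, $F(A)\in\mathcal{F}$; this defines a reflector $F\colon\mathcal{A}\to\mathcal{F}$ and a coreflector $T\colon\mathcal{A}\to\mathcal{T}$. For a torsion theory $(\mathcal{T},\mathcal{F})$ in a homological category $\mathcal{A}$: (P) means that the reflector $F\colon\mathcal{A}\to\mathcal{F}$ is protoadditive; (N) means that for any morphism $f\colon A\to B$ in $\mathcal{A}$, $\ker(f)\circ t_{K[f]}\colon T(K[f])\to A$ is a normal monomorphism. (These conditions are applied to $(\mathcal{T}_1,\mathcal{F}_1)$ with $\mathrm{Arr}(\mathcal{A})$ in place of $\mathcal{A}$.) *)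

theory Defs
  imports Main
begin

section \<open>Categories\<close>

record ('o, 'm) cat =
  Obj :: "'o set"
  Mor :: "'m set"
  Dom :: "'m \<Rightarrow> 'o"
  Cod :: "'m \<Rightarrow> 'o"
  Idn :: "'o \<Rightarrow> 'm"
  Cmp :: "'m \<Rightarrow> 'm \<Rightarrow> 'm"  (infixr "\<odot>\<index>" 70)

text \<open>Composition is written in applicative order: \<open>g \<odot>\<^bsub>C\<^esub> f\<close> is \<open>g\<close> after \<open>f\<close>.
  Its value on non-composable pairs is irrelevant.\<close>

definition Hom :: "('o, 'm) cat \<Rightarrow> 'o \<Rightarrow> 'o \<Rightarrow> 'm set" where
  "Hom C X Y = {f \<in> Mor C. Dom C f = X \<and> Cod C f = Y}"

locale category =
  fixes C :: "('o, 'm) cat" (structure)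
  assumes Dom_in [intro]: "f \<in> Mor C \<Longrightarrow> Dom C f \<in> Obj C"
    and Cod_in [intro]: "f \<in> Mor C \<Longrightarrow> Cod C f \<in> Obj C"
    and Idn_in [intro]: "X \<in> Obj C \<Longrightarrow> Idn C X \<in> Hom C X X"
    and Cmp_in [intro]: "\<lbrakk>f \<in> Hom C X Y; g \<in> Hom C Y Z\<rbrakk> \<Longrightarrow> g \<odot> f \<in> Hom C X Z"
    and Cmp_Idn: "f \<in> Hom C X Y \<Longrightarrow> f \<odot> Idn C X = f"
    and Idn_Cmp: "f \<in> Hom C X Y \<Longrightarrow> Idn C Y \<odot> f = f"
    and Cmp_assoc: "\<lbrakk>f \<in> Hom C X Y; g \<in> Hom C Y Z; h \<in> Hom C Z W\<rbrakk>
        \<Longrightarrow> (h \<odot> g) \<odot> f = h \<odot> (g \<odot> f)"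

definition iso :: "('o, 'm) cat \<Rightarrow> 'm \<Rightarrow> bool" where
  "iso C f \<longleftrightarrow> f \<in> Mor C \<and>
     (\<exists>g \<in> Hom C (Cod C f) (Dom C f).
        g \<odot>\<^bsub>C\<^esub> f = Idn C (Dom C f) \<and> f \<odot>\<^bsub>C\<^esub> g = Idn C (Cod C f))"

definition section_of :: "('o, 'm) cat \<Rightarrow> 'm \<Rightarrow> 'm \<Rightarrow> bool" where
  "section_of C s f \<longleftrightarrow> f \<in> Mor C \<and> s \<in> Hom C (Cod C f) (Dom C f) \<and>
     f \<odot>\<^bsub>C\<^esub> s = Idn C (Cod C f)"

definition split_epi :: "('o, 'm) cat \<Rightarrow> 'm \<Rightarrow> bool" where
  "split_epi C f \<longleftrightarrow> (\<exists>s. section_of C s f)"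

definition full_subcat :: "('o, 'm) cat \<Rightarrow> 'o set \<Rightarrow> ('o, 'm) cat" where
  "full_subcat C S = C\<lparr>Obj := Obj C \<inter> S, Mor := {f \<in> Mor C. Dom C f \<in> S \<and> Cod C f \<in> S}\<rparr>"

text \<open>A full replete subcategory is represented by its set of objects.\<close>

definition replete :: "('o, 'm) cat \<Rightarrow> 'o set \<Rightarrow> bool" where
  "replete C S \<longleftrightarrow> S \<subseteq> Obj C \<and> (\<forall>f. iso C f \<and> Dom C f \<in> S \<longrightarrow> Cod C f \<in> S)"

text \<open>A morphism of the arrow category is a quadruple \<open>(f, g, u, v)\<close> standing for the
  commutative square \<open>v \<odot> f = g \<odot> u\<close>, regarded as a morphism from \<open>f\<close> to \<open>g\<close>.\<close>

definition arrow_cat :: "('o, 'm) cat \<Rightarrow> ('m, 'm \<times> 'm \<times> 'm \<times> 'm) cat" where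
  "arrow_cat C = \<lparr>
     Obj = Mor C,
     Mor = {(f, g, u, v). f \<in> Mor C \<and> g \<in> Mor C \<and>
              u \<in> Hom C (Dom C f) (Dom C g) \<and> v \<in> Hom C (Cod C f) (Cod C g) \<and>
              v \<odot>\<^bsub>C\<^esub> f = g \<odot>\<^bsub>C\<^esub> u},
     Dom = (\<lambda>(f, g, u, v). f),
     Cod = (\<lambda>(f, g, u, v). g),
     Idn = (\<lambda>f. (f, f, Idn C (Dom C f), Idn C (Cod C f))),
     Cmp = (\<lambda>(g', h, u', v') (f, g, u, v). (f, h, u' \<odot>\<^bsub>C\<^esub> u, v' \<odot>\<^bsub>C\<^esub> v))\<rparr>"


section \<open>Limits and colimits\<close>

definition terminal :: "('o, 'm) cat \<Rightarrow> 'o \<Rightarrow> bool" where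
  "terminal C Z \<longleftrightarrow> Z \<in> Obj C \<and> (\<forall>X \<in> Obj C. \<exists>!f. f \<in> Hom C X Z)"

definition initial :: "('o, 'm) cat \<Rightarrow> 'o \<Rightarrow> bool" where
  "initial C Z \<longleftrightarrow> Z \<in> Obj C \<and> (\<forall>X \<in> Obj C. \<exists>!f. f \<in> Hom C Z X)"

definition zero_object :: "('o, 'm) cat \<Rightarrow> 'o \<Rightarrow> bool" where
  "zero_object C Z \<longleftrightarrow> initial C Z \<and> terminal C Z"

definition zero_morphism :: "('o, 'm) cat \<Rightarrow> 'm \<Rightarrow> bool" where
  "zero_morphism C f \<longleftrightarrow> f \<in> Mor C \<and>
     (\<exists>Z. zero_object C Z \<and> (\<exists>u \<in> Hom C (Dom C f) Z. \<exists>v \<in> Hom C Z (Cod C f). f = v \<odot>\<^bsub>C\<^esub> u))"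

text \<open>The square \<open>f \<odot> p = g \<odot> q\<close> is a pullback.\<close>

definition is_pullback :: "('o, 'm) cat \<Rightarrow> 'm \<Rightarrow> 'm \<Rightarrow> 'm \<Rightarrow> 'm \<Rightarrow> bool" where
  "is_pullback C p q f g \<longleftrightarrow>
     f \<in> Mor C \<and> g \<in> Mor C \<and> p \<in> Mor C \<and> q \<in> Mor C \<and>
     Cod C f = Cod C g \<and> Dom C p = Dom C q \<and> Cod C p = Dom C f \<and> Cod C q = Dom C g \<and>
     f \<odot>\<^bsub>C\<^esub> p = g \<odot>\<^bsub>C\<^esub> q \<and>
     (\<forall>X \<in> Obj C. \<forall>a \<in> Hom C X (Dom C f). \<forall>b \<in> Hom C X (Dom C g). f \<odot>\<^bsub>C\<^esub> a = g \<odot>\<^bsub>C\<^esub> b \<longrightarrow>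
        (\<exists>!h. h \<in> Hom C X (Dom C p) \<and> p \<odot>\<^bsub>C\<^esub> h = a \<and> q \<odot>\<^bsub>C\<^esub> h = b))"

definition is_coequalizer :: "('o, 'm) cat \<Rightarrow> 'm \<Rightarrow> 'm \<Rightarrow> 'm \<Rightarrow> bool" where
  "is_coequalizer C q a b \<longleftrightarrow>
     a \<in> Mor C \<and> b \<in> Mor C \<and> q \<in> Mor C \<and>
     Dom C a = Dom C b \<and> Cod C a = Cod C b \<and> Dom C q = Cod C a \<and>
     q \<odot>\<^bsub>C\<^esub> a = q \<odot>\<^bsub>C\<^esub> b \<and>
     (\<forall>Y \<in> Obj C. \<forall>h \<in> Hom C (Cod C a) Y. h \<odot>\<^bsub>C\<^esub> a = h \<odot>\<^bsub>C\<^esub> b \<longrightarrow>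
        (\<exists>!u. u \<in> Hom C (Cod C q) Y \<and> u \<odot>\<^bsub>C\<^esub> q = h))"

definition regular_epi :: "('o, 'm) cat \<Rightarrow> 'm \<Rightarrow> bool" where
  "regular_epi C q \<longleftrightarrow> (\<exists>a b. is_coequalizer C q a b)"

definition is_kernel :: "('o, 'm) cat \<Rightarrow> 'm \<Rightarrow> 'm \<Rightarrow> bool" where
  "is_kernel C k f \<longleftrightarrow>
     f \<in> Mor C \<and> k \<in> Mor C \<and> Cod C k = Dom C f \<and> zero_morphism C (f \<odot>\<^bsub>C\<^esub> k) \<and>
     (\<forall>X \<in> Obj C. \<forall>h \<in> Hom C X (Dom C f). zero_morphism C (f \<odot>\<^bsub>C\<^esub> h) \<longrightarrow>
        (\<exists>!u. u \<in> Hom C X (Dom C k) \<and> k \<odot>\<^bsub>C\<^esub> u = h))"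

definition is_cokernel :: "('o, 'm) cat \<Rightarrow> 'm \<Rightarrow> 'm \<Rightarrow> bool" where
  "is_cokernel C q k \<longleftrightarrow>
     k \<in> Mor C \<and> q \<in> Mor C \<and> Dom C q = Cod C k \<and> zero_morphism C (q \<odot>\<^bsub>C\<^esub> k) \<and>
     (\<forall>Y \<in> Obj C. \<forall>h \<in> Hom C (Cod C k) Y. zero_morphism C (h \<odot>\<^bsub>C\<^esub> k) \<longrightarrow>
        (\<exists>!u. u \<in> Hom C (Cod C q) Y \<and> u \<odot>\<^bsub>C\<^esub> q = h))"

text \<open>A chosen kernel \<open>ker(f) : K[f] \<rightarrow> A\<close> of \<open>f : A \<rightarrow> B\<close>, meaningful when \<open>f\<close> has a kernel.\<close>

definition ker :: "('o, 'm) cat \<Rightarrow> 'm \<Rightarrow> 'm" where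
  "ker C f = (SOME k. is_kernel C k f)"

definition ker_obj :: "('o, 'm) cat \<Rightarrow> 'm \<Rightarrow> 'o" where
  "ker_obj C f = Dom C (ker C f)"

definition normal_mono :: "('o, 'm) cat \<Rightarrow> 'm \<Rightarrow> bool" where
  "normal_mono C k \<longleftrightarrow> (\<exists>f. is_kernel C k f)"

definition short_exact :: "('o, 'm) cat \<Rightarrow> 'm \<Rightarrow> 'm \<Rightarrow> bool" where
  "short_exact C k f \<longleftrightarrow> is_kernel C k f \<and> is_cokernel C f k"

definition split_short_exact :: "('o, 'm) cat \<Rightarrow> 'm \<Rightarrow> 'm \<Rightarrow> 'm \<Rightarrow> bool" where
  "split_short_exact C k f s \<longleftrightarrow> is_kernel C k f \<and> section_of C s f"


section \<open>Homological categories\<close>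

definition pointed :: "('o, 'm) cat \<Rightarrow> bool" where
  "pointed C \<longleftrightarrow> category C \<and> (\<exists>Z. zero_object C Z)"

definition split_short_five_lemma :: "('o, 'm) cat \<Rightarrow> bool" where
  "split_short_five_lemma C \<longleftrightarrow>
     (\<forall>k f s k' f' s' u v w.
        split_short_exact C k f s \<and> split_short_exact C k' f' s' \<and>
        u \<in> Hom C (Dom C k) (Dom C k') \<and>
        v \<in> Hom C (Dom C f) (Dom C f') \<and>
        w \<in> Hom C (Cod C f) (Cod C f') \<and>
        v \<odot>\<^bsub>C\<^esub> k = k' \<odot>\<^bsub>C\<^esub> u \<and> f' \<odot>\<^bsub>C\<^esub> v = w \<odot>\<^bsub>C\<^esub> f \<and> v \<odot>\<^bsub>C\<^esub> s = s' \<odot>\<^bsub>C\<^esub> w \<and>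
        iso C u \<and> iso C w \<longrightarrow> iso C v)"

definition pointed_protomodular :: "('o, 'm) cat \<Rightarrow> bool" where
  "pointed_protomodular C \<longleftrightarrow> pointed C \<and>
     (\<forall>f g. split_epi C f \<and> g \<in> Mor C \<and> Cod C g = Cod C f \<longrightarrow> (\<exists>p q. is_pullback C p q f g)) \<and>
     split_short_five_lemma C"

text \<open>Finite completeness is expressed by a terminal object and pullbacks; a kernel pair of
  \<open>f\<close> is a pullback of \<open>f\<close> along itself.\<close>

definition regular_category :: "('o, 'm) cat \<Rightarrow> bool" where
  "regular_category C \<longleftrightarrow> category C \<and>
     (\<exists>Z. terminal C Z) \<and>
     (\<forall>f g. f \<in> Mor C \<and> g \<in> Mor C \<and> Cod C f = Cod C g \<longrightarrow> (\<exists>p q. is_pullback C p q f g)) \<and>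
     (\<forall>f a b. is_pullback C a b f f \<longrightarrow> (\<exists>q. is_coequalizer C q a b)) \<and>
     (\<forall>p q f g. is_pullback C p q f g \<and> regular_epi C f \<longrightarrow> regular_epi C q)"

definition homological :: "('o, 'm) cat \<Rightarrow> bool" where
  "homological C \<longleftrightarrow> pointed_protomodular C \<and> regular_category C"


section \<open>Protoadditive functors\<close>

record ('o, 'm, 'p, 'n) ftr =
  on_obj :: "'o \<Rightarrow> 'p"
  on_mor :: "'m \<Rightarrow> 'n"

definition is_functor :: "('o, 'm) cat \<Rightarrow> ('p, 'n) cat \<Rightarrow> ('o, 'm, 'p, 'n) ftr \<Rightarrow> bool" where
  "is_functor C D H \<longleftrightarrow> category C \<and> category D \<and>
     (\<forall>X \<in> Obj C. on_obj H X \<in> Obj D \<and> on_mor H (Idn C X) = Idn D (on_obj H X)) \<and>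
     (\<forall>f \<in> Mor C. on_mor H f \<in> Hom D (on_obj H (Dom C f)) (on_obj H (Cod C f))) \<and>
     (\<forall>f \<in> Mor C. \<forall>g \<in> Mor C. Dom C g = Cod C f \<longrightarrow>
        on_mor H (g \<odot>\<^bsub>C\<^esub> f) = on_mor H g \<odot>\<^bsub>D\<^esub> on_mor H f)"

text \<open>The notion is used only for functors between pointed protomodular categories.\<close>

definition protoadditive :: "('o, 'm) cat \<Rightarrow> ('p, 'n) cat \<Rightarrow> ('o, 'm, 'p, 'n) ftr \<Rightarrow> bool" where
  "protoadditive C D H \<longleftrightarrow> is_functor C D H \<and>
     (\<forall>k f s. split_short_exact C k f s \<longrightarrow>
        split_short_exact D (on_mor H k) (on_mor H f) (on_mor H s))"


section \<open>Torsion theories\<close>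

text \<open>\<open>0 \<rightarrow> T(A) \<rightarrow> A \<rightarrow> F(A) \<rightarrow> 0\<close>, with \<open>t : T(A) \<rightarrow> A\<close> and \<open>e : A \<rightarrow> F(A)\<close>.\<close>

definition torsion_sequence ::
  "('o, 'm) cat \<Rightarrow> 'o set \<Rightarrow> 'o set \<Rightarrow> 'o \<Rightarrow> 'm \<Rightarrow> 'm \<Rightarrow> bool" where
  "torsion_sequence C \<T> \<F> A t e \<longleftrightarrow>
     short_exact C t e \<and> Cod C t = A \<and> Dom C t \<in> \<T> \<and> Cod C e \<in> \<F>"

definition torsion_theory :: "('o, 'm) cat \<Rightarrow> 'o set \<Rightarrow> 'o set \<Rightarrow> bool" where
  "torsion_theory C \<T> \<F> \<longleftrightarrow> pointed C \<and> replete C \<T> \<and> replete C \<F> \<and>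
     (\<forall>X \<in> \<T>. \<forall>Y \<in> \<F>. \<forall>f \<in> Hom C X Y. zero_morphism C f) \<and>
     (\<forall>A \<in> Obj C. \<exists>t e. torsion_sequence C \<T> \<F> A t e)"

text \<open>A chosen such sequence for each object; \<open>tors_incl\<close> is \<open>t\<^sub>A\<close> and \<open>tors_unit\<close> is
  \<open>\<eta>\<^sub>A\<close>. The choice matters only up to isomorphism.\<close>

definition tors_choice :: "('o, 'm) cat \<Rightarrow> 'o set \<Rightarrow> 'o set \<Rightarrow> 'o \<Rightarrow> 'm \<times> 'm" where
  "tors_choice C \<T> \<F> A = (SOME (t, e). torsion_sequence C \<T> \<F> A t e)"

definition tors_incl :: "('o, 'm) cat \<Rightarrow> 'o set \<Rightarrow> 'o set \<Rightarrow> 'o \<Rightarrow> 'm" where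
  "tors_incl C \<T> \<F> A = fst (tors_choice C \<T> \<F> A)"

definition tors_unit :: "('o, 'm) cat \<Rightarrow> 'o set \<Rightarrow> 'o set \<Rightarrow> 'o \<Rightarrow> 'm" where
  "tors_unit C \<T> \<F> A = snd (tors_choice C \<T> \<F> A)"

text \<open>The reflector \<open>F\<close>: on a morphism \<open>f : A \<rightarrow> B\<close> it is the unique \<open>g : F(A) \<rightarrow> F(B)\<close> with
  \<open>g \<odot> \<eta>\<^sub>A = \<eta>\<^sub>B \<odot> f\<close>.\<close>

definition reflector :: "('o, 'm) cat \<Rightarrow> 'o set \<Rightarrow> 'o set \<Rightarrow> ('o, 'm, 'o, 'm) ftr" where
  "reflector C \<T> \<F> = \<lparr>
     on_obj = (\<lambda>A. Cod C (tors_unit C \<T> \<F> A)),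
     on_mor = (\<lambda>f. THE g.
        g \<in> Hom C (Cod C (tors_unit C \<T> \<F> (Dom C f))) (Cod C (tors_unit C \<T> \<F> (Cod C f))) \<and>
        g \<odot>\<^bsub>C\<^esub> tors_unit C \<T> \<F> (Dom C f) = tors_unit C \<T> \<F> (Cod C f) \<odot>\<^bsub>C\<^esub> f)\<rparr>"

definition condition_P :: "('o, 'm) cat \<Rightarrow> 'o set \<Rightarrow> 'o set \<Rightarrow> bool" where
  "condition_P C \<T> \<F> \<longleftrightarrow> protoadditive C (full_subcat C \<F>) (reflector C \<T> \<F>)"

definition condition_N :: "('o, 'm) cat \<Rightarrow> 'o set \<Rightarrow> 'o set \<Rightarrow> bool" where
  "condition_N C \<T> \<F> \<longleftrightarrow>
     (\<forall>f \<in> Mor C. normal_mono C (ker C f \<odot>\<^bsub>C\<^esub> tors_incl C \<T> \<F> (ker_obj C f)))"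

text \<open>The codomain is allowed to be any zero object, so that the subcategory is replete.\<close>

definition arrow_torsion :: "('o, 'm) cat \<Rightarrow> 'o set \<Rightarrow> 'm set" where
  "arrow_torsion C \<T> = {f \<in> Mor C. Dom C f \<in> \<T> \<and> zero_object C (Cod C f)}"

definition arrow_torsion_free :: "('o, 'm) cat \<Rightarrow> 'o set \<Rightarrow> 'm set" where
  "arrow_torsion_free C \<F> = {f \<in> Mor C. ker_obj C f \<in> \<F>}"

end

theory Submission imports Defs begin

text \<open>Let \<open>f : A \<rightarrow> B\<close> have kernel \<open>k\<close>. By (N) the composite \<open>T(K[f]) \<rightarrow> K[f] \<rightarrow> A\<close> is a kernel, and in a
  homological category it then has a cokernel \<open>q : A \<rightarrow> Q\<close> whose kernel it is. The sequence of \<open>f\<close>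
  is \<open>(T(K[f]) \<rightarrow> 0) \<rightarrow> f \<rightarrow> (Q \<rightarrow> B)\<close>, and the kernel of \<open>Q \<rightarrow> B\<close> is \<open>F(K[f])\<close>.

  For (P), a split short exact sequence \<open>a \<rightarrow> b \<rightarrow> c\<close> of arrows gives \<open>Q\<^sub>a \<rightarrow> Q\<^sub>b \<rightarrow> Q\<^sub>c\<close>, and the first map
  has to be the kernel \<open>N\<close> of the second. The morphism \<open>K \<rightarrow> N\<close> from the kernel of \<open>Dom b \<rightarrow> Dom c\<close> is a
  regular epimorphism, as in every morphism of split epimorphisms whose components are regular
  epimorphisms. Protoadditivity of \<open>F\<close> identifies its kernel with \<open>T(K[a])\<close>, whence \<open>N = Q\<^sub>a\<close>.\<close>

section \<open>Monomorphisms, epimorphisms and pullbacks\<close>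

text \<open>T(K[f]) is normal in K[f] and K[f] is normal in A, but normality is not transitive, and
  a homological category need not have cokernels of arbitrary monomorphisms. Condition (N) supplies
  exactly the missing normality. A kernel j of h is then also the kernel of the regular epimorphism
  e in the image factorization h = m e, and e is the cokernel of j; the latter rests on the split
  short five lemma, through the fact that a zero kernel forces a monomorphism. For (P),
  protoadditivity of F speaks about the kernels K[a], K[b], K[c], while the quotients are taken of
  the domains. A regular epimorphism between morphisms need not restrict to a regular epimorphism
  between their kernels; the sections provide the missing preimages. For (N), the kernel of a square
  (u, v) from f to g is the induced map K[u] -> K[v]. Its torsion part is T of the kernel of that
  map, and the question becomes whether this is normal in the domain of f, which is again a matter
  of the base category.\<close>

lemma in_Hom [simp]: "f \<in> Hom C X Y \<longleftrightarrow> f \<in> Mor C \<and> Dom C f = X \<and> Cod C f = Y"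
  by (auto simp: Hom_def)

definition monic :: "('o, 'm) cat \<Rightarrow> 'm \<Rightarrow> bool" where
  "monic C m \<longleftrightarrow> m \<in> Mor C \<and>
     (\<forall>X. \<forall>u \<in> Hom C X (Dom C m). \<forall>v \<in> Hom C X (Dom C m). m \<odot>\<^bsub>C\<^esub> u = m \<odot>\<^bsub>C\<^esub> v \<longrightarrow> u = v)"

definition epic :: "('o, 'm) cat \<Rightarrow> 'm \<Rightarrow> bool" where
  "epic C e \<longleftrightarrow> e \<in> Mor C \<and>
     (\<forall>Y. \<forall>u \<in> Hom C (Cod C e) Y. \<forall>v \<in> Hom C (Cod C e) Y. u \<odot>\<^bsub>C\<^esub> e = v \<odot>\<^bsub>C\<^esub> e \<longrightarrow> u = v)"

lemma monic_Mor [simp]: "monic C m \<Longrightarrow> m \<in> Mor C"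
  and epic_Mor [simp]: "epic C m \<Longrightarrow> m \<in> Mor C"
  unfolding monic_def epic_def by blast+

lemma monicD:
  "\<lbrakk>monic C m; m \<odot>\<^bsub>C\<^esub> u = m \<odot>\<^bsub>C\<^esub> v; u \<in> Hom C X (Dom C m); v \<in> Hom C X (Dom C m)\<rbrakk> \<Longrightarrow> u = v"
  unfolding monic_def by blast

lemma epicD:
  "\<lbrakk>epic C e; u \<odot>\<^bsub>C\<^esub> e = v \<odot>\<^bsub>C\<^esub> e; u \<in> Hom C (Cod C e) Y; v \<in> Hom C (Cod C e) Y\<rbrakk> \<Longrightarrow> u = v"
  unfolding epic_def by blast

context category
begin

text \<open>As introduction rules these make the classical reasoner diverge.\<close>

declare Dom_in [simp, rule del] Cod_in [simp, rule del] Idn_in [rule del] Cmp_in [rule del]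

lemma Idn_simps [simp]:
  "X \<in> Obj C \<Longrightarrow> Idn C X \<in> Mor C"
  "X \<in> Obj C \<Longrightarrow> Dom C (Idn C X) = X"
  "X \<in> Obj C \<Longrightarrow> Cod C (Idn C X) = X"
  "\<lbrakk>f \<in> Mor C; Dom C f = X\<rbrakk> \<Longrightarrow> f \<odot> Idn C X = f"
  "\<lbrakk>f \<in> Mor C; Cod C f = Y\<rbrakk> \<Longrightarrow> Idn C Y \<odot> f = f"
  using Idn_in[of X] Cmp_Idn[of f X "Cod C f"] Idn_Cmp[of f "Dom C f" Y] by auto

lemma Cmp_simps [simp]:
  assumes "f \<in> Mor C" "g \<in> Mor C" "Dom C g = Cod C f"
  shows "g \<odot> f \<in> Mor C" "Dom C (g \<odot> f) = Dom C f" "Cod C (g \<odot> f) = Cod C g"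
  using Cmp_in[of f "Dom C f" "Cod C f" g "Cod C g"] assms by auto

lemma assoc [simp]:
  "\<lbrakk>f \<in> Mor C; g \<in> Mor C; h \<in> Mor C; Dom C g = Cod C f; Dom C h = Cod C g\<rbrakk>
    \<Longrightarrow> (h \<odot> g) \<odot> f = h \<odot> (g \<odot> f)"
  using Cmp_assoc[of f "Dom C f" "Cod C f" g "Cod C g" h "Cod C h"] by auto

text \<open>As a simp rule \<open>assoc\<close> brackets composites to the right, which hides
  \<open>g \<odot> f\<close> inside \<open>g \<odot> (f \<odot> x)\<close>. In this form a known
  equation still applies there.\<close>

lemma assoc_eq:
  "\<lbrakk>g \<odot> f = h; x \<in> Mor C; f \<in> Mor C; g \<in> Mor C; Dom C f = Cod C x; Dom C g = Cod C f\<rbrakk>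
    \<Longrightarrow> g \<odot> (f \<odot> x) = h \<odot> x"
  using assoc[of x f g] by simp

lemma isoE:
  assumes "iso C f"
  obtains g where "f \<in> Mor C" "g \<in> Mor C" "Dom C g = Cod C f" "Cod C g = Dom C f"
    "g \<odot> f = Idn C (Dom C f)" "f \<odot> g = Idn C (Cod C f)"
  using assms unfolding iso_def by auto

lemma isoI:
  assumes "f \<in> Hom C X Y" "g \<in> Hom C Y X" "g \<odot> f = Idn C X" "f \<odot> g = Idn C Y"
  shows "iso C f"
  using assms unfolding iso_def by auto

lemma iso_Idn: "X \<in> Obj C \<Longrightarrow> iso C (Idn C X)"
  by (rule isoI[of _ X X "Idn C X"]) auto

lemma iso_monic: "iso C f \<Longrightarrow> monic C f"
  unfolding monic_def
proof (intro conjI allI ballI impI)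
  assume i: "iso C f"
  then obtain g where f: "f \<in> Mor C" "g \<in> Mor C" "Dom C g = Cod C f" "Cod C g = Dom C f"
    "g \<odot> f = Idn C (Dom C f)" "f \<odot> g = Idn C (Cod C f)" by (rule isoE)
  show "f \<in> Mor C" by fact
  fix X u v assume uv: "u \<in> Hom C X (Dom C f)" "v \<in> Hom C X (Dom C f)" "f \<odot> u = f \<odot> v"
  then have "g \<odot> (f \<odot> u) = g \<odot> (f \<odot> v)" by simp
  with f uv(1,2) show "u = v" by (simp add: assoc_eq[OF f(5)])
qed

lemma monic_comp:
  assumes "monic C f" "monic C g" "Dom C g = Cod C f"
  shows "monic C (g \<odot> f)"
  unfolding monic_def
proof (intro conjI allI ballI impI)
  have m: "f \<in> Mor C" "g \<in> Mor C" using assms by auto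
  then show "g \<odot> f \<in> Mor C" using assms by simp
  fix X u v assume uv: "u \<in> Hom C X (Dom C (g \<odot> f))" "v \<in> Hom C X (Dom C (g \<odot> f))"
    "(g \<odot> f) \<odot> u = (g \<odot> f) \<odot> v"
  then have "g \<odot> (f \<odot> u) = g \<odot> (f \<odot> v)" using m assms by simp
  then have "f \<odot> u = f \<odot> v"
    by (rule monicD[OF assms(2), where X = X]) (use uv m assms in auto)
  then show "u = v" by (rule monicD[OF assms(1), where X = X]) (use uv m assms in auto)
qed

lemma monic_cancel:
  assumes "monic C (g \<odot> f)" "f \<in> Mor C" "g \<in> Mor C" "Dom C g = Cod C f"
  shows "monic C f"
  unfolding monic_def
proof (intro conjI allI ballI impI)
  fix X u v assume uv: "u \<in> Hom C X (Dom C f)" "v \<in> Hom C X (Dom C f)" "f \<odot> u = f \<odot> v"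
  show "u = v"
    by (rule monicD[OF assms(1), where X = X]) (use uv assms in auto)
qed fact

section \<open>Coequalizers and regular epimorphisms\<close>

lemma coequalizerD:
  assumes "is_coequalizer C q a b"
  shows "a \<in> Mor C" "b \<in> Mor C" "q \<in> Mor C" "Dom C b = Dom C a" "Cod C b = Cod C a"
    "Dom C q = Cod C a" "q \<odot> a = q \<odot> b"
  using assms unfolding is_coequalizer_def by auto

lemma coequalizer_epic:
  assumes "is_coequalizer C q a b" shows "epic C q"
  unfolding epic_def
proof (intro conjI allI ballI impI)
  note q = assms[unfolded is_coequalizer_def]
  show "q \<in> Mor C" using q by simp
  fix Y u v assume uv: "u \<in> Hom C (Cod C q) Y" "v \<in> Hom C (Cod C q) Y" "u \<odot> q = v \<odot> q"
  have "Y \<in> Obj C" "u \<odot> q \<in> Hom C (Cod C a) Y" "(u \<odot> q) \<odot> a = (u \<odot> q) \<odot> b"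
    using uv q by auto
  then show "u = v" using uv q by metis
qed

lemma regular_epi_epic: "regular_epi C q \<Longrightarrow> epic C q"
  unfolding regular_epi_def using coequalizer_epic by blast

lemma coequalizer_lift:
  assumes "is_coequalizer C q a b" "h \<in> Hom C (Cod C a) Y" "h \<odot> a = h \<odot> b"
  obtains u where "u \<in> Hom C (Cod C q) Y" "u \<odot> q = h"
proof -
  have "Y \<in> Obj C" using assms(2) by auto
  with assms that show ?thesis unfolding is_coequalizer_def by blast
qed

text \<open>The pair \<open>a\<close>, \<open>b\<close> with coequalizer \<open>m \<odot> x\<close>
  is already identified by \<open>x\<close>, because \<open>m\<close> is monic. Hence
  \<open>x\<close> factors through \<open>m \<odot> x\<close>, and the factor \<open>y\<close> is
  inverse to \<open>m\<close>.\<close>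

lemma monic_regular_factor_iso:
  assumes "regular_epi C (m \<odot> x)" "monic C m" "x \<in> Mor C" "Dom C m = Cod C x"
  shows "iso C m"
proof -
  obtain a b where q: "is_coequalizer C (m \<odot> x) a b" using assms(1) by (auto simp: regular_epi_def)
  have m: "m \<in> Mor C" using assms by simp
  note q' = coequalizerD[OF q]
  have ab: "Cod C a = Dom C x" "Cod C b = Dom C x" using q' m assms(3,4) by auto
  have "x \<odot> a = x \<odot> b"
    by (rule monicD[OF assms(2), where X = "Dom C a"]) (use q' ab assms(3,4) m in auto)
  then obtain y where y: "y \<in> Hom C (Cod C m) (Dom C m)" "y \<odot> (m \<odot> x) = x"
    using coequalizer_lift[OF q, of x "Dom C m"] assms(3,4) m ab by auto
  have 1: "m \<odot> y = Idn C (Cod C m)"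
  proof (rule epicD[OF coequalizer_epic[OF q], where Y = "Cod C m"])
    show "(m \<odot> y) \<odot> (m \<odot> x) = Idn C (Cod C m) \<odot> (m \<odot> x)"
      using y m assms(3,4) by simp
  qed (use y m assms(3,4) in auto)
  have "y \<odot> m = Idn C (Dom C m)"
    by (rule monicD[OF assms(2), where X = "Dom C m"]) (use y m in \<open>auto simp: assoc_eq[OF 1]\<close>)
  with 1 show ?thesis using y m by (intro isoI[of m _ _ y]) auto
qed

lemma iso_regular_epi:
  assumes "regular_epi C e" "iso C m" "Dom C m = Cod C e"
  shows "regular_epi C (m \<odot> e)"
proof -
  obtain a b where q: "is_coequalizer C e a b" using assms(1) by (auto simp: regular_epi_def)
  note q' = coequalizerD[OF q]
  from assms(2) obtain g where m: "m \<in> Mor C" "g \<in> Mor C" "Dom C g = Cod C m" "Cod C g = Dom C m"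
    "g \<odot> m = Idn C (Dom C m)" "m \<odot> g = Idn C (Cod C m)" by (rule isoE)
  have "is_coequalizer C (m \<odot> e) a b"
    unfolding is_coequalizer_def
  proof (intro conjI ballI impI)
    fix Y h assume h: "Y \<in> Obj C" "h \<in> Hom C (Cod C a) Y" "h \<odot> a = h \<odot> b"
    obtain u where u: "u \<in> Hom C (Cod C e) Y" "u \<odot> e = h"
      using coequalizer_lift[OF q h(2,3)] .
    show "\<exists>!w. w \<in> Hom C (Cod C (m \<odot> e)) Y \<and> w \<odot> (m \<odot> e) = h"
    proof (rule ex1I[of _ "u \<odot> g"])
      show "u \<odot> g \<in> Hom C (Cod C (m \<odot> e)) Y \<and> (u \<odot> g) \<odot> (m \<odot> e) = h"
        using u m q' assms(3) by (simp add: assoc_eq[OF m(5)])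
      fix w assume w: "w \<in> Hom C (Cod C (m \<odot> e)) Y \<and> w \<odot> (m \<odot> e) = h"
      have "w \<odot> m = u"
        by (rule epicD[OF coequalizer_epic[OF q], where Y = Y])
          (use w u m q' assms(3) in auto)
      then have "(w \<odot> m) \<odot> g = u \<odot> g" by simp
      then show "w = u \<odot> g" using w m q' assms(3) by simp
    qed
  qed (use q' m assms(3) in auto)
  then show ?thesis by (auto simp: regular_epi_def)
qed

section \<open>Pullbacks\<close>

lemma pullbackD:
  assumes "is_pullback C p q f g"
  shows "f \<in> Mor C" "g \<in> Mor C" "p \<in> Mor C" "q \<in> Mor C" "Cod C f = Cod C g"
    "Dom C q = Dom C p" "Cod C p = Dom C f" "Cod C q = Dom C g" "f \<odot> p = g \<odot> q"
  using assms unfolding is_pullback_def by auto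

lemma pullback_lift:
  assumes "is_pullback C p q f g" "a \<in> Hom C X (Dom C f)" "b \<in> Hom C X (Dom C g)" "f \<odot> a = g \<odot> b"
  obtains h where "h \<in> Hom C X (Dom C p)" "p \<odot> h = a" "q \<odot> h = b"
proof -
  have "X \<in> Obj C" using assms(2) by auto
  with assms that show ?thesis unfolding is_pullback_def by blast
qed

lemma pullback_unique:
  assumes "is_pullback C p q f g" "h \<in> Hom C X (Dom C p)" "h' \<in> Hom C X (Dom C p)"
    "p \<odot> h = p \<odot> h'" "q \<odot> h = q \<odot> h'"
  shows "h = h'"
proof -
  note q = assms(1)[unfolded is_pullback_def]
  have "X \<in> Obj C" "p \<odot> h \<in> Hom C X (Dom C f)" "q \<odot> h \<in> Hom C X (Dom C g)"
    using assms(2) pullbackD[OF assms(1)] by auto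
  moreover have "f \<odot> (p \<odot> h) = g \<odot> (q \<odot> h)"
    using pullbackD[OF assms(1)] assms(2) by (simp add: assoc_eq[of f p "g \<odot> q" h])
  ultimately show ?thesis using q assms by metis
qed

end

section \<open>Zero morphisms, kernels and cokernels\<close>

text \<open>Turns the predicate \<open>zero_morphism\<close> into equations that the simplifier can
  use. In a pointed category the choice is harmless, as there is exactly one zero morphism between
  two given objects.\<close>

definition zero_mor :: "('o, 'm) cat \<Rightarrow> 'o \<Rightarrow> 'o \<Rightarrow> 'm" where
  "zero_mor C X Y = (SOME f. f \<in> Hom C X Y \<and> zero_morphism C f)"

locale pointed_category = category C for C :: "('o, 'm) cat" (structure) +
  assumes ex_zero_object: "\<exists>Z. zero_object C Z"

lemma pointed_iff: "pointed C \<longleftrightarrow> pointed_category C"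
  by (auto simp: pointed_def pointed_category_def pointed_category_axioms_def)

lemma (in category) zero_objectD:
  assumes "zero_object C Z"
  shows "Z \<in> Obj C"
    "X \<in> Obj C \<Longrightarrow> \<exists>f. f \<in> Hom C X Z"
    "X \<in> Obj C \<Longrightarrow> \<exists>f. f \<in> Hom C Z X"
    "\<lbrakk>f \<in> Hom C X Z; g \<in> Hom C X Z\<rbrakk> \<Longrightarrow> f = g"
    "\<lbrakk>f \<in> Hom C Z X; g \<in> Hom C Z X\<rbrakk> \<Longrightarrow> f = g"
proof -
  note z = assms[unfolded zero_object_def initial_def terminal_def]
  show "Z \<in> Obj C" "X \<in> Obj C \<Longrightarrow> \<exists>f. f \<in> Hom C X Z" "X \<in> Obj C \<Longrightarrow> \<exists>f. f \<in> Hom C Z X"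
    using z by blast+
  have 1: "X \<in> Obj C" if "h \<in> Hom C X Z" for h using that by auto
  have 2: "X \<in> Obj C" if "h \<in> Hom C Z X" for h using that by auto
  show "\<lbrakk>f \<in> Hom C X Z; g \<in> Hom C X Z\<rbrakk> \<Longrightarrow> f = g" "\<lbrakk>f \<in> Hom C Z X; g \<in> Hom C Z X\<rbrakk> \<Longrightarrow> f = g"
    using z 1 2 by blast+
qed

text \<open>Serves the repleteness of \<open>arrow_torsion\<close>, whose members may end in any
  zero object.\<close>

lemma (in category) iso_zero_object:
  assumes "zero_object C Z" "iso C f" "Dom C f = Z"
  shows "zero_object C (Cod C f)"
proof -
  from assms(2) obtain g where f: "f \<in> Mor C" "g \<in> Mor C" "Dom C g = Cod C f" "Cod C g = Dom C f"
    "g \<odot> f = Idn C (Dom C f)" "f \<odot> g = Idn C (Cod C f)" by (rule isoE)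
  note z = zero_objectD[OF assms(1)]
  have "\<exists>!h. h \<in> Hom C (Cod C f) X" if X: "X \<in> Obj C" for X
  proof -
    obtain u where u: "u \<in> Hom C Z X" using z(3)[OF X] by blast
    show ?thesis
    proof (rule ex1I[of _ "u \<odot> g"])
      show "u \<odot> g \<in> Hom C (Cod C f) X" using u f assms(3) by simp
      fix h assume h: "h \<in> Hom C (Cod C f) X"
      have "h \<odot> f = u" by (rule z(5)) (use h f u assms(3) in auto)
      then have "(h \<odot> f) \<odot> g = u \<odot> g" by simp
      then show "h = u \<odot> g" using f h by simp
    qed
  qed
  moreover have "\<exists>!h. h \<in> Hom C X (Cod C f)" if X: "X \<in> Obj C" for X
  proof -
    obtain u where u: "u \<in> Hom C X Z" using z(2)[OF X] by blast
    show ?thesis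
    proof (rule ex1I[of _ "f \<odot> u"])
      show "f \<odot> u \<in> Hom C X (Cod C f)" using u f assms(3) by simp
      fix h assume h: "h \<in> Hom C X (Cod C f)"
      have "g \<odot> h = u" by (rule z(4)) (use h f u assms(3) in auto)
      then have "f \<odot> (g \<odot> h) = f \<odot> u" by simp
      then show "h = f \<odot> u" using f h by (simp add: assoc_eq[OF f(6)])
    qed
  qed
  moreover have "Cod C f \<in> Obj C" using f by simp
  ultimately show ?thesis unfolding zero_object_def initial_def terminal_def by blast
qed

lemma (in category) zero_morphismI:
  assumes "zero_object C Z" "u \<in> Hom C X Z" "v \<in> Hom C Z Y"
  shows "zero_morphism C (v \<odot> u)"
proof -
  have "v \<odot> u \<in> Mor C" "u \<in> Hom C (Dom C (v \<odot> u)) Z" "v \<in> Hom C Z (Cod C (v \<odot> u))"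
    using assms(2,3) by auto
  then show ?thesis using assms(1) unfolding zero_morphism_def by blast
qed

context pointed_category
begin

text \<open>\<open>zero_morphism\<close> provides only some zero object. The comparison maps
  \<open>i\<close> and \<open>j\<close> between two zero objects reroute the factorization through a
  prescribed one.\<close>

lemma zero_morphism_through:
  assumes "zero_morphism C f" "zero_object C Z"
  obtains u v where "u \<in> Hom C (Dom C f) Z" "v \<in> Hom C Z (Cod C f)" "f = v \<odot> u"
proof -
  from assms(1) obtain Z' u v where f: "zero_object C Z'" "u \<in> Hom C (Dom C f) Z'"
    "v \<in> Hom C Z' (Cod C f)" "f = v \<odot> u" unfolding zero_morphism_def by blast
  obtain i where i: "i \<in> Hom C Z' Z"
    using zero_objectD(2)[OF assms(2) zero_objectD(1)[OF f(1)]] by blast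
  obtain j where j: "j \<in> Hom C Z Z'"
    using zero_objectD(2)[OF f(1) zero_objectD(1)[OF assms(2)]] by blast
  have ji: "j \<odot> i = Idn C Z'"
    by (rule zero_objectD(4)[OF f(1)]) (use i j zero_objectD(1)[OF f(1)] in auto)
  have "(v \<odot> j) \<odot> (i \<odot> u) = v \<odot> u" using i j f(2,3) by (simp add: assoc_eq[OF ji])
  with f(4) have "f = (v \<odot> j) \<odot> (i \<odot> u)" by (simp only:)
  then show ?thesis by (rule that[of "i \<odot> u" "v \<odot> j", rotated 2]) (use i j f(2,3) in simp_all)
qed

lemma zero_morphism_unique:
  assumes "zero_morphism C f" "zero_morphism C g" "Dom C f = Dom C g" "Cod C f = Cod C g"
  shows "f = g"
proof -
  obtain Z where Z: "zero_object C Z" using ex_zero_object by blast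
  obtain u v where 1: "u \<in> Hom C (Dom C f) Z" "v \<in> Hom C Z (Cod C f)" "f = v \<odot> u"
    using zero_morphism_through[OF assms(1) Z] .
  obtain u' v' where 2: "u' \<in> Hom C (Dom C g) Z" "v' \<in> Hom C Z (Cod C g)" "g = v' \<odot> u'"
    using zero_morphism_through[OF assms(2) Z] .
  have "u = u'" using zero_objectD(4)[OF Z 1(1)[unfolded assms(3)] 2(1)] .
  moreover have "v = v'" using zero_objectD(5)[OF Z 1(2)[unfolded assms(4)] 2(2)] .
  ultimately show ?thesis using 1(3) 2(3) by simp
qed

lemma zero_mor_props:
  assumes "X \<in> Obj C" "Y \<in> Obj C"
  shows "zero_mor C X Y \<in> Hom C X Y \<and> zero_morphism C (zero_mor C X Y)"
proof -
  obtain Z where Z: "zero_object C Z" using ex_zero_object by blast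
  obtain u where u: "u \<in> Hom C X Z" using zero_objectD(2)[OF Z assms(1)] by blast
  obtain v where v: "v \<in> Hom C Z Y" using zero_objectD(3)[OF Z assms(2)] by blast
  have "v \<odot> u \<in> Hom C X Y \<and> zero_morphism C (v \<odot> u)"
    using zero_morphismI[OF Z u v] u v by simp
  then show ?thesis unfolding zero_mor_def by (rule someI)
qed

lemma zero_mor_simps [simp]:
  assumes "X \<in> Obj C" "Y \<in> Obj C"
  shows "zero_mor C X Y \<in> Mor C" "Dom C (zero_mor C X Y) = X" "Cod C (zero_mor C X Y) = Y"
    "zero_morphism C (zero_mor C X Y)"
  using zero_mor_props[OF assms] by auto

lemma zero_morphism_iff: "zero_morphism C f \<longleftrightarrow> f \<in> Mor C \<and> f = zero_mor C (Dom C f) (Cod C f)"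
proof
  assume z: "zero_morphism C f"
  then have "f \<in> Mor C" by (simp add: zero_morphism_def)
  with z show "f \<in> Mor C \<and> f = zero_mor C (Dom C f) (Cod C f)"
    using zero_morphism_unique[OF z, of "zero_mor C (Dom C f) (Cod C f)"] by auto
next
  assume f: "f \<in> Mor C \<and> f = zero_mor C (Dom C f) (Cod C f)"
  have "zero_morphism C (zero_mor C (Dom C f) (Cod C f))" using f by (intro zero_mor_simps) auto
  with f show "zero_morphism C f" by simp
qed

lemma zero_through_zero_object:
  assumes "zero_object C Z" "u \<in> Hom C X Z" "v \<in> Hom C Z Y"
  shows "v \<odot> u = zero_mor C X Y"
proof -
  have "zero_morphism C (v \<odot> u)" using assms by (rule zero_morphismI)
  then show ?thesis using assms(2,3) by (simp add: zero_morphism_iff)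
qed

lemma zero_mor_through:
  assumes "zero_object C Z" "X \<in> Obj C" "Y \<in> Obj C"
  obtains u v where "u \<in> Hom C X Z" "v \<in> Hom C Z Y" "v \<odot> u = zero_mor C X Y"
proof -
  obtain u where u: "u \<in> Hom C X Z" using zero_objectD(2)[OF assms(1,2)] by blast
  obtain v where v: "v \<in> Hom C Z Y" using zero_objectD(3)[OF assms(1,3)] by blast
  show ?thesis using that[OF u v zero_through_zero_object[OF assms(1) u v]] .
qed

lemma Cmp_zero_mor [simp]:
  assumes "g \<in> Mor C" "Dom C g = Y" "X \<in> Obj C"
  shows "g \<odot> zero_mor C X Y = zero_mor C X (Cod C g)"
proof -
  obtain Z where Z: "zero_object C Z" using ex_zero_object by blast
  have Y: "Y \<in> Obj C" using assms by auto
  obtain u v where uv: "u \<in> Hom C X Z" "v \<in> Hom C Z Y" "v \<odot> u = zero_mor C X Y"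
    using zero_mor_through[OF Z assms(3) Y] .
  show ?thesis
    using zero_through_zero_object[OF Z, of u X "g \<odot> v" "Cod C g"] uv(1,2) assms
    by (simp add: uv(3))
qed

lemma zero_mor_Cmp [simp]:
  assumes "f \<in> Mor C" "Cod C f = X" "Y \<in> Obj C"
  shows "zero_mor C X Y \<odot> f = zero_mor C (Dom C f) Y"
proof -
  obtain Z where Z: "zero_object C Z" using ex_zero_object by blast
  have X: "X \<in> Obj C" using assms by auto
  obtain u v where uv: "u \<in> Hom C X Z" "v \<in> Hom C Z Y" "v \<odot> u = zero_mor C X Y"
    using zero_mor_through[OF Z X assms(3)] .
  show ?thesis
    using zero_through_zero_object[OF Z, of "u \<odot> f" "Dom C f" v Y] uv(1,2) assms X
    by (simp add: assoc_eq[OF uv(3)])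
qed

lemma to_zero_object:
  "\<lbrakk>zero_object C Z; f \<in> Hom C X Z\<rbrakk> \<Longrightarrow> f = zero_mor C X Z"
  using zero_objectD(4)[of Z f X "zero_mor C X Z"] by fastforce

lemma from_zero_object:
  "\<lbrakk>zero_object C Z; f \<in> Hom C Z X\<rbrakk> \<Longrightarrow> f = zero_mor C Z X"
  using zero_objectD(5)[of Z f X "zero_mor C Z X"] by fastforce

lemma monic_zero_cancel:
  assumes "monic C m" "u \<in> Hom C X (Dom C m)" "m \<odot> u = zero_mor C X (Cod C m)"
  shows "u = zero_mor C X (Dom C m)"
proof -
  have "m \<in> Mor C" "X \<in> Obj C" using assms(1,2) by auto
  with assms(3) have "m \<odot> u = m \<odot> zero_mor C X (Dom C m)" "zero_mor C X (Dom C m) \<in> Hom C X (Dom C m)"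
    by simp_all
  then show ?thesis using monicD[OF assms(1) _ assms(2)] by blast
qed

lemma epic_zero_cancel:
  assumes "epic C e" "u \<in> Hom C (Cod C e) Y" "u \<odot> e = zero_mor C (Dom C e) Y"
  shows "u = zero_mor C (Cod C e) Y"
proof -
  have "e \<in> Mor C" "Y \<in> Obj C" using assms(1,2) by auto
  with assms(3) have "u \<odot> e = zero_mor C (Cod C e) Y \<odot> e" "zero_mor C (Cod C e) Y \<in> Hom C (Cod C e) Y"
    by simp_all
  then show ?thesis using epicD[OF assms(1) _ assms(2)] by blast
qed

section \<open>Kernels\<close>

lemma kernelD:
  assumes "is_kernel C k f"
  shows "k \<in> Mor C" "f \<in> Mor C" "Cod C k = Dom C f" "f \<odot> k = zero_mor C (Dom C k) (Cod C f)"
  using assms unfolding is_kernel_def zero_morphism_iff by auto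

lemma kernel_lift:
  assumes "is_kernel C k f" "h \<in> Hom C X (Dom C f)" "f \<odot> h = zero_mor C X (Cod C f)"
  obtains u where "u \<in> Hom C X (Dom C k)" "k \<odot> u = h"
proof -
  have "X \<in> Obj C" "zero_morphism C (f \<odot> h)"
    using assms(2,3) kernelD[OF assms(1)] by (auto simp: zero_morphism_iff)
  then show ?thesis using assms that unfolding is_kernel_def by blast
qed

lemma kernel_monic:
  assumes "is_kernel C k f" shows "monic C k"
  unfolding monic_def
proof (intro conjI allI ballI impI)
  note k = kernelD[OF assms]
  show "k \<in> Mor C" by fact
  fix X u v assume uv: "u \<in> Hom C X (Dom C k)" "v \<in> Hom C X (Dom C k)" "k \<odot> u = k \<odot> v"
  have "X \<in> Obj C" using uv by auto
  moreover have "k \<odot> v \<in> Hom C X (Dom C f)" using uv k by simp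
  moreover have "zero_morphism C (f \<odot> (k \<odot> v))"
  proof -
    have "f \<odot> (k \<odot> v) = zero_mor C X (Cod C f)" using uv k by (simp add: assoc_eq[OF k(4)])
    then show ?thesis using uv k by auto
  qed
  ultimately show "u = v" using uv assms unfolding is_kernel_def by blast
qed

lemma kernelI:
  assumes "monic C k" "f \<in> Mor C" "Cod C k = Dom C f" "f \<odot> k = zero_mor C (Dom C k) (Cod C f)"
    and lift: "\<And>X h. \<lbrakk>X \<in> Obj C; h \<in> Hom C X (Dom C f); f \<odot> h = zero_mor C X (Cod C f)\<rbrakk>
      \<Longrightarrow> \<exists>u \<in> Hom C X (Dom C k). k \<odot> u = h"
  shows "is_kernel C k f"
  unfolding is_kernel_def
proof (intro conjI ballI impI)
  show k: "k \<in> Mor C" using assms(1) by simp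
  show "zero_morphism C (f \<odot> k)" using k assms(2-4) by simp
  fix X h assume h: "X \<in> Obj C" "h \<in> Hom C X (Dom C f)" "zero_morphism C (f \<odot> h)"
  then obtain u where "u \<in> Hom C X (Dom C k)" "k \<odot> u = h"
    using lift[of X h] assms(2) by (auto simp: zero_morphism_iff)
  then show "\<exists>!u. u \<in> Hom C X (Dom C k) \<and> k \<odot> u = h"
    using monicD[OF assms(1)] by metis
qed fact+

lemma mutual_factor_iso:
  assumes "monic C m" "monic C m'" "w \<in> Hom C (Dom C m) (Dom C m')" "m' \<odot> w = m"
    "w' \<in> Hom C (Dom C m') (Dom C m)" "m \<odot> w' = m'"
  shows "iso C w"
proof (rule isoI[of w "Dom C m" "Dom C m'" w'])
  have m: "m \<in> Mor C" "m' \<in> Mor C" using assms(1,2) by auto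
  have 0: "m \<odot> (w' \<odot> w) = m" "m' \<odot> (w \<odot> w') = m'"
    using m assms(3,5) by (simp_all add: assoc_eq[OF assms(4)] assoc_eq[OF assms(6)] assms(4,6))
  show "w' \<odot> w = Idn C (Dom C m)"
    by (rule monicD[OF assms(1), where X = "Dom C m"]) (use 0 m assms(3,5) in auto)
  show "w \<odot> w' = Idn C (Dom C m')"
    by (rule monicD[OF assms(2), where X = "Dom C m'"]) (use 0 m assms(3,5) in auto)
qed fact+

lemma kernel_unique:
  assumes "is_kernel C k f" "is_kernel C k' f"
  obtains u where "iso C u" "u \<in> Hom C (Dom C k') (Dom C k)" "k \<odot> u = k'"
proof -
  note k = kernelD[OF assms(1)] and k' = kernelD[OF assms(2)]
  obtain u where u: "u \<in> Hom C (Dom C k') (Dom C k)" "k \<odot> u = k'"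
    using kernel_lift[OF assms(1), of k' "Dom C k'"] k' by auto
  obtain v where v: "v \<in> Hom C (Dom C k) (Dom C k')" "k' \<odot> v = k"
    using kernel_lift[OF assms(2), of k "Dom C k"] k by auto
  show ?thesis
    using that[OF mutual_factor_iso[OF kernel_monic[OF assms(2)] kernel_monic[OF assms(1)] u v] u] .
qed

lemma kernel_iso:
  assumes "is_kernel C k f" "iso C u" "Cod C u = Dom C k"
  shows "is_kernel C (k \<odot> u) f"
proof (rule kernelI)
  note k = kernelD[OF assms(1)]
  from assms(2) obtain g where u: "u \<in> Mor C" "g \<in> Mor C" "Dom C g = Cod C u" "Cod C g = Dom C u"
    "g \<odot> u = Idn C (Dom C u)" "u \<odot> g = Idn C (Cod C u)" by (rule isoE)
  show "monic C (k \<odot> u)" using kernel_monic[OF assms(1)] iso_monic[OF assms(2)] assms(3)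
    by (intro monic_comp) auto
  show "f \<in> Mor C" "Cod C (k \<odot> u) = Dom C f" using k u assms(3) by auto
  show "f \<odot> (k \<odot> u) = zero_mor C (Dom C (k \<odot> u)) (Cod C f)"
    using k u assms(3) by (simp add: assoc_eq[OF k(4)])
  fix X h assume h: "h \<in> Hom C X (Dom C f)" "f \<odot> h = zero_mor C X (Cod C f)"
  obtain v where v: "v \<in> Hom C X (Dom C k)" "k \<odot> v = h" using kernel_lift[OF assms(1) h] .
  then show "\<exists>w \<in> Hom C X (Dom C (k \<odot> u)). (k \<odot> u) \<odot> w = h"
    using u k assms(3) by (intro bexI[of _ "g \<odot> v"]) (auto simp: assoc_eq[OF u(6)])
qed

text \<open>Here \<open>k'\<close> is \<open>b \<odot> k\<close> up to the isomorphism
  \<open>a\<close>. This invariance moves kernels from hand-made sequences to the values of the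
  reflector, and along isomorphisms of arrows.\<close>

lemma kernel_iso_transfer:
  assumes "is_kernel C k f" "iso C a" "iso C b" "iso C c"
    "Dom C a = Dom C k" "Dom C b = Dom C f" "Dom C c = Cod C f"
    "k' \<in> Hom C (Cod C a) (Cod C b)" "f' \<in> Hom C (Cod C b) (Cod C c)"
    "k' \<odot> a = b \<odot> k" "f' \<odot> b = c \<odot> f"
  shows "is_kernel C k' f'"
proof -
  note k = kernelD[OF assms(1)]
  from assms(2) obtain a' where a: "a \<in> Mor C" "a' \<in> Mor C" "Dom C a' = Cod C a" "Cod C a' = Dom C a"
    "a' \<odot> a = Idn C (Dom C a)" "a \<odot> a' = Idn C (Cod C a)" by (rule isoE)
  from assms(3) obtain b' where b: "b \<in> Mor C" "b' \<in> Mor C" "Dom C b' = Cod C b" "Cod C b' = Dom C b"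
    "b' \<odot> b = Idn C (Dom C b)" "b \<odot> b' = Idn C (Cod C b)" by (rule isoE)
  have c: "c \<in> Mor C" "monic C c" using iso_monic[OF assms(4)] by simp_all
  have a'm: "iso C a'" by (rule isoI[of a' "Cod C a" "Dom C a" a]) (use a in simp_all)
  have k': "k' = (b \<odot> k) \<odot> a'" using assoc[of a' a k'] assms(8,10) a by simp
  show ?thesis
  proof (rule kernelI)
    show "monic C k'" unfolding k'
      by (intro monic_comp iso_monic a'm kernel_monic[OF assms(1)] assms(3))
        (use a b k assms(5-7) in simp_all)
    show "f' \<odot> k' = zero_mor C (Dom C k') (Cod C f')"
      unfolding k' using a b c k assms(5-9) by (simp add: assoc_eq[OF assms(11)] assoc_eq[OF k(4)])
    fix X h assume h: "X \<in> Obj C" "h \<in> Hom C X (Dom C f')" "f' \<odot> h = zero_mor C X (Cod C f')"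
    have h': "b' \<odot> h \<in> Hom C X (Dom C f)" using h(2) b assms(6,9) by simp
    have "c \<odot> (f \<odot> (b' \<odot> h)) = c \<odot> zero_mor C X (Cod C f)"
      using assoc[of "b' \<odot> h" f c] assoc[of "b' \<odot> h" b f'] h b c k assms(6,7,9,11)
      by (simp add: assoc_eq[OF b(6)])
    then have "f \<odot> (b' \<odot> h) = zero_mor C X (Cod C f)"
      by (rule monicD[OF c(2), where X = X]) (use h h' k assms(7) in simp_all)
    then obtain u where u: "u \<in> Hom C X (Dom C k)" "k \<odot> u = b' \<odot> h"
      using kernel_lift[OF assms(1) h'] by blast
    have "k' \<odot> (a \<odot> u) = b \<odot> (k \<odot> u)"
      using assoc[of u a k'] assoc[of u k b] u(1) a k b assms(5-8,10) by simp
    also have "\<dots> = h" using h(2) b assms(6,9) by (simp add: u(2) assoc_eq[OF b(6)])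
    finally show "\<exists>u \<in> Hom C X (Dom C k'). k' \<odot> u = h"
      using u(1) a assms(5,8) by (intro bexI[of _ "a \<odot> u"]) simp_all
  qed (use assms(8,9) in simp_all)
qed

lemma normal_mono_iso:
  "\<lbrakk>normal_mono C k; iso C u; Cod C u = Dom C k\<rbrakk> \<Longrightarrow> normal_mono C (k \<odot> u)"
  unfolding normal_mono_def using kernel_iso by blast

lemma ker_is_kernel: "is_kernel C k f \<Longrightarrow> is_kernel C (ker C f) f"
  unfolding ker_def by (rule someI)

section \<open>Cokernels\<close>

lemma cokernelD:
  assumes "is_cokernel C q k"
  shows "k \<in> Mor C" "q \<in> Mor C" "Dom C q = Cod C k" "q \<odot> k = zero_mor C (Dom C k) (Cod C q)"
  using assms unfolding is_cokernel_def zero_morphism_iff by auto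

lemma cokernel_lift:
  assumes "is_cokernel C q k" "h \<in> Hom C (Cod C k) Y" "h \<odot> k = zero_mor C (Dom C k) Y"
  obtains u where "u \<in> Hom C (Cod C q) Y" "u \<odot> q = h"
proof -
  have "Y \<in> Obj C" "zero_morphism C (h \<odot> k)"
    using assms(2,3) cokernelD[OF assms(1)] by (auto simp: zero_morphism_iff)
  then show ?thesis using assms that unfolding is_cokernel_def by blast
qed

lemma cokernel_epic:
  assumes "is_cokernel C q k" shows "epic C q"
  unfolding epic_def
proof (intro conjI allI ballI impI)
  note q = cokernelD[OF assms]
  show "q \<in> Mor C" by fact
  fix Y u v assume uv: "u \<in> Hom C (Cod C q) Y" "v \<in> Hom C (Cod C q) Y" "u \<odot> q = v \<odot> q"
  have "Y \<in> Obj C" using uv by auto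
  moreover have "v \<odot> q \<in> Hom C (Cod C k) Y" using uv q by simp
  moreover have "zero_morphism C ((v \<odot> q) \<odot> k)"
    using uv q by auto
  ultimately show "u = v" using uv assms unfolding is_cokernel_def by blast
qed

lemma cokernelI:
  assumes "epic C q" "k \<in> Mor C" "Dom C q = Cod C k" "q \<odot> k = zero_mor C (Dom C k) (Cod C q)"
    and lift: "\<And>Y h. \<lbrakk>Y \<in> Obj C; h \<in> Hom C (Cod C k) Y; h \<odot> k = zero_mor C (Dom C k) Y\<rbrakk>
      \<Longrightarrow> \<exists>u \<in> Hom C (Cod C q) Y. u \<odot> q = h"
  shows "is_cokernel C q k"
  unfolding is_cokernel_def
proof (intro conjI ballI impI)
  show q: "q \<in> Mor C" using assms(1) by simp
  show "zero_morphism C (q \<odot> k)" using q assms(2-4) by simp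
  fix Y h assume h: "Y \<in> Obj C" "h \<in> Hom C (Cod C k) Y" "zero_morphism C (h \<odot> k)"
  then obtain u where "u \<in> Hom C (Cod C q) Y" "u \<odot> q = h"
    using lift[of Y h] assms(2) by (auto simp: zero_morphism_iff)
  then show "\<exists>!u. u \<in> Hom C (Cod C q) Y \<and> u \<odot> q = h"
    using epicD[OF assms(1)] by metis
qed fact+

lemma cokernel_unique:
  assumes "is_cokernel C q k" "is_cokernel C q' k"
  obtains u where "iso C u" "u \<in> Hom C (Cod C q) (Cod C q')" "u \<odot> q = q'"
proof -
  note q = cokernelD[OF assms(1)] and q' = cokernelD[OF assms(2)]
  obtain u where u: "u \<in> Hom C (Cod C q) (Cod C q')" "u \<odot> q = q'"
    using cokernel_lift[OF assms(1), of q' "Cod C q'"] q' by auto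
  obtain v where v: "v \<in> Hom C (Cod C q') (Cod C q)" "v \<odot> q' = q"
    using cokernel_lift[OF assms(2), of q "Cod C q"] q by auto
  have 1: "v \<odot> u = Idn C (Cod C q)"
    by (rule epicD[OF cokernel_epic[OF assms(1)], where Y = "Cod C q"]) (use u v q q' in auto)
  have 2: "u \<odot> v = Idn C (Cod C q')"
    by (rule epicD[OF cokernel_epic[OF assms(2)], where Y = "Cod C q'"]) (use u v q q' in auto)
  show ?thesis using that[OF isoI[OF u(1) v(1) 1 2]] u by simp
qed

text \<open>The sequence of \<open>Z\<close>, \<open>X\<close> and \<open>X\<close> again, with
  \<open>Z\<close> a zero object, is the codomain component of every torsion sequence of arrows. The
  present half also gives the trivial split sequence to which the five lemma is applied
  below.\<close>

lemma kernel_of_identity: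
  assumes "zero_object C Z" "X \<in> Obj C"
  shows "is_kernel C (zero_mor C Z X) (Idn C X)"
proof (rule kernelI)
  have o: "Z \<in> Obj C" using zero_objectD(1)[OF assms(1)] .
  show "monic C (zero_mor C Z X)"
    unfolding monic_def using zero_objectD(4)[OF assms(1)] assms(2) o by simp
  fix W h assume h: "W \<in> Obj C" "h \<in> Hom C W (Dom C (Idn C X))"
    "Idn C X \<odot> h = zero_mor C W (Cod C (Idn C X))"
  show "\<exists>u \<in> Hom C W (Dom C (zero_mor C Z X)). zero_mor C Z X \<odot> u = h"
    using h o assms(2) by (intro bexI[of _ "zero_mor C W Z"]) simp_all
qed (use assms zero_objectD(1)[OF assms(1)] in simp_all)

lemma cokernel_from_zero:
  assumes "zero_object C Z" "X \<in> Obj C"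
  shows "is_cokernel C (Idn C X) (zero_mor C Z X)"
proof (rule cokernelI)
  have o: "Z \<in> Obj C" using zero_objectD(1)[OF assms(1)] .
  show "epic C (Idn C X)" unfolding epic_def using assms(2) by simp
  fix Y h assume "h \<in> Hom C (Cod C (zero_mor C Z X)) Y"
  then show "\<exists>u \<in> Hom C (Cod C (Idn C X)) Y. u \<odot> Idn C X = h"
    using o assms(2) by (intro bexI[of _ h]) simp_all
qed (use assms zero_objectD(1)[OF assms(1)] in simp_all)

end

section \<open>Torsion theories\<close>

locale torsion_category = pointed_category C for C :: "('o, 'm) cat" (structure) +
  fixes \<T> \<F> :: "'o set"
  assumes torsion_theory: "torsion_theory C \<T> \<F>"

lemma torsion_categoryI: "torsion_theory C \<T> \<F> \<Longrightarrow> torsion_category C \<T> \<F>"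
  by (simp add: torsion_category_def torsion_category_axioms_def torsion_theory_def pointed_iff)

context torsion_category
begin

lemma Hom_zero:
  assumes "X \<in> \<T>" "Y \<in> \<F>" "f \<in> Hom C X Y"
  shows "f = zero_mor C X Y"
proof -
  have "zero_morphism C f" using torsion_theory assms unfolding torsion_theory_def by blast
  then show ?thesis using assms(3) by (auto simp: zero_morphism_iff)
qed

lemma torsion_free_Obj [simp]: "X \<in> \<F> \<Longrightarrow> X \<in> Obj C"
  using torsion_theory by (auto simp: torsion_theory_def replete_def)

lemma torsion_free_iso: "\<lbrakk>iso C f; Dom C f \<in> \<F>\<rbrakk> \<Longrightarrow> Cod C f \<in> \<F>"
  and torsion_iso: "\<lbrakk>iso C f; Dom C f \<in> \<T>\<rbrakk> \<Longrightarrow> Cod C f \<in> \<T>"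
  using torsion_theory unfolding torsion_theory_def replete_def by blast+

lemma torsion_sequenceD:
  assumes "torsion_sequence C \<T> \<F> A t e"
  shows "is_kernel C t e" "is_cokernel C e t" "t \<in> Mor C" "e \<in> Mor C" "Cod C t = A" "Dom C e = A"
    "A \<in> Obj C" "Dom C t \<in> \<T>" "Cod C e \<in> \<F>" "monic C t" "epic C e"
    "e \<odot> t = zero_mor C (Dom C t) (Cod C e)"
proof -
  show 1: "is_kernel C t e" "is_cokernel C e t" "Cod C t = A" "Dom C t \<in> \<T>" "Cod C e \<in> \<F>"
    using assms by (auto simp: torsion_sequence_def short_exact_def)
  show "monic C t" "epic C e" using 1 kernel_monic cokernel_epic by auto
  show "t \<in> Mor C" "e \<in> Mor C" "Dom C e = A" "e \<odot> t = zero_mor C (Dom C t) (Cod C e)"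
    using kernelD[OF 1(1)] 1(3) by auto
  then show "A \<in> Obj C" using 1 by auto
qed

lemma ex_torsion_sequence: "A \<in> Obj C \<Longrightarrow> \<exists>t e. torsion_sequence C \<T> \<F> A t e"
  using torsion_theory unfolding torsion_theory_def by blast

lemma chosen_torsion_sequence:
  assumes "A \<in> Obj C"
  shows "torsion_sequence C \<T> \<F> A (tors_incl C \<T> \<F> A) (tors_unit C \<T> \<F> A)"
proof -
  have "\<exists>p. case p of (t, e) \<Rightarrow> torsion_sequence C \<T> \<F> A t e"
    using ex_torsion_sequence[OF assms] by auto
  then have "case tors_choice C \<T> \<F> A of (t, e) \<Rightarrow> torsion_sequence C \<T> \<F> A t e"
    unfolding tors_choice_def by (rule someI_ex)
  then show ?thesis by (simp add: tors_incl_def tors_unit_def case_prod_unfold)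
qed

lemma torsion_lift:
  assumes "torsion_sequence C \<T> \<F> A t e" "X \<in> \<T>" "h \<in> Hom C X A"
  obtains u where "u \<in> Hom C X (Dom C t)" "t \<odot> u = h"
proof -
  note t = torsion_sequenceD[OF assms(1)]
  have "e \<odot> h = zero_mor C X (Cod C e)" by (rule Hom_zero[OF assms(2) t(9)]) (use assms(3) t in simp)
  moreover have "h \<in> Hom C X (Dom C e)" using assms(3) t(6) by simp
  ultimately show ?thesis using kernel_lift[OF t(1)] that by blast
qed

lemma torsion_free_extend:
  assumes "torsion_sequence C \<T> \<F> A t e" "Y \<in> \<F>" "h \<in> Hom C A Y"
  obtains u where "u \<in> Hom C (Cod C e) Y" "u \<odot> e = h"
proof -
  note t = torsion_sequenceD[OF assms(1)]
  have "h \<odot> t = zero_mor C (Dom C t) Y" by (rule Hom_zero[OF t(8) assms(2)]) (use assms(3) t in simp)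
  moreover have "h \<in> Hom C (Cod C t) Y" using assms(3) t(5) by simp
  ultimately show ?thesis using cokernel_lift[OF t(2)] that by blast
qed

lemma torsion_unit_iso:
  assumes "torsion_sequence C \<T> \<F> A t e" "torsion_sequence C \<T> \<F> A t' e'"
  obtains u where "iso C u" "u \<in> Hom C (Cod C e) (Cod C e')" "u \<odot> e = e'"
proof -
  note t = torsion_sequenceD[OF assms(1)] and t' = torsion_sequenceD[OF assms(2)]
  have e: "e \<in> Hom C A (Cod C e)" "e' \<in> Hom C A (Cod C e')" using t t' by simp_all
  obtain u where u: "u \<in> Hom C (Cod C e) (Cod C e')" "u \<odot> e = e'"
    using torsion_free_extend[OF assms(1) t'(9) e(2)] .
  obtain v where v: "v \<in> Hom C (Cod C e') (Cod C e)" "v \<odot> e' = e"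
    using torsion_free_extend[OF assms(2) t(9) e(1)] .
  have 1: "v \<odot> u = Idn C (Cod C e)"
    by (rule epicD[OF t(11), where Y = "Cod C e"])
      (use u(1) v(1) t(4,6) t'(4,6) in \<open>simp_all add: u(2) v(2)\<close>)
  have 2: "u \<odot> v = Idn C (Cod C e')"
    by (rule epicD[OF t'(11), where Y = "Cod C e'"])
      (use u(1) v(1) t(4,6) t'(4,6) in \<open>simp_all add: u(2) v(2)\<close>)
  show ?thesis using that[OF isoI[OF u(1) v(1) 1 2] u] .
qed

text \<open>The torsion inclusion \<open>t\<close> into a zero object is zero, so the identity
  extends along its cokernel \<open>e\<close>. Thus \<open>e\<close> is invertible, and repleteness
  applies.\<close>

lemma zero_object_torsion_free:
  assumes "zero_object C Z" shows "Z \<in> \<F>"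
proof -
  have Z: "Z \<in> Obj C" using zero_objectD(1)[OF assms] .
  obtain t e where te: "torsion_sequence C \<T> \<F> Z t e" using ex_torsion_sequence[OF Z] by blast
  note t = torsion_sequenceD[OF te]
  have tz: "t = zero_mor C (Dom C t) Z" using to_zero_object[OF assms] t(3,5) by simp
  have "Idn C Z \<odot> t = zero_mor C (Dom C t) Z" using t(3,5) tz by simp
  moreover have "Idn C Z \<in> Hom C (Cod C t) Z" using Z t(5) by simp
  ultimately obtain u where u: "u \<in> Hom C (Cod C e) Z" "u \<odot> e = Idn C Z"
    using cokernel_lift[OF t(2)] by blast
  have 2: "e \<odot> u = Idn C (Cod C e)"
    by (rule epicD[OF t(11), where Y = "Cod C e"]) (use u(1) t(4,6) Z in \<open>simp_all add: u(2)\<close>)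
  have "iso C u" by (rule isoI[of u "Cod C e" Z e]) (use u 2 t(4,6) in simp_all)
  then show ?thesis using torsion_free_iso[of u] u(1) t(9) by simp
qed

text \<open>Conditions (N) and (P) are stated for chosen kernels and chosen torsion sequences; the
  following lemmas make them independent of the choices.\<close>

lemma torsion_of_kernel_unique:
  assumes "is_kernel C k f" "is_kernel C k' f"
    "torsion_sequence C \<T> \<F> (Dom C k) t e" "torsion_sequence C \<T> \<F> (Dom C k') t' e'"
  obtains w where "iso C w" "w \<in> Hom C (Dom C t') (Dom C t)" "(k \<odot> t) \<odot> w = k' \<odot> t'"
proof -
  \<comment> \<open>Stated for arbitrary data because it is used in both directions: the two monic
    composites then factor through each other.\<close>
  have *: "\<exists>w. w \<in> Hom C (Dom C t') (Dom C t) \<and> (k \<odot> t) \<odot> w = k' \<odot> t'"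
    if k: "is_kernel C k f" and k': "is_kernel C k' f" and t: "torsion_sequence C \<T> \<F> (Dom C k) t e"
      and t': "torsion_sequence C \<T> \<F> (Dom C k') t' e'" for k k' t t' e e'
  proof -
    note kD = kernelD[OF k] and kD' = kernelD[OF k']
    note tD = torsion_sequenceD[OF t] and tD' = torsion_sequenceD[OF t']
    obtain v where v: "v \<in> Hom C (Dom C k') (Dom C k)" "k \<odot> v = k'"
      using kernel_unique[OF k k'] by blast
    have "v \<odot> t' \<in> Hom C (Dom C t') (Dom C k)" using v(1) tD' by simp
    then obtain w where w: "w \<in> Hom C (Dom C t') (Dom C t)" "t \<odot> w = v \<odot> t'"
      using torsion_lift[OF t tD'(8)] by blast
    have "(k \<odot> t) \<odot> w = k' \<odot> t'"
      using w v(1) tD(3,5) tD'(3,5) kD(1) kD'(1) by (simp add: assoc_eq[OF v(2)])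
    with w(1) show ?thesis by blast
  qed
  note kD = kernelD[OF assms(1)] and kD' = kernelD[OF assms(2)]
  note tD = torsion_sequenceD[OF assms(3)] and tD' = torsion_sequenceD[OF assms(4)]
  have m: "monic C (k \<odot> t)" "monic C (k' \<odot> t')"
    using monic_comp kernel_monic assms(1,2) tD(5,10) tD'(5,10) by metis+
  have d: "Dom C (k \<odot> t) = Dom C t" "Dom C (k' \<odot> t') = Dom C t'" using kD kD' tD tD' by simp_all
  obtain w where w: "w \<in> Hom C (Dom C t') (Dom C t)" "(k \<odot> t) \<odot> w = k' \<odot> t'"
    using *[OF assms] by blast
  obtain v where v: "v \<in> Hom C (Dom C t) (Dom C t')" "(k' \<odot> t') \<odot> v = k \<odot> t"
    using *[OF assms(2,1,4,3)] by blast
  have "iso C w" by (rule mutual_factor_iso[OF m(2,1), of w v, unfolded d, OF w v])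
  then show ?thesis using that w by blast
qed

lemma condition_NI:
  assumes "\<And>f. f \<in> Mor C \<Longrightarrow>
    \<exists>k t e. is_kernel C k f \<and> torsion_sequence C \<T> \<F> (Dom C k) t e \<and> normal_mono C (k \<odot> t)"
  shows "condition_N C \<T> \<F>"
  unfolding condition_N_def
proof
  fix f assume "f \<in> Mor C"
  then obtain k t e where k: "is_kernel C k f" "torsion_sequence C \<T> \<F> (Dom C k) t e"
    "normal_mono C (k \<odot> t)" using assms by blast
  note k' = ker_is_kernel[OF k(1)]
  have "ker_obj C f \<in> Obj C" using kernelD(1)[OF k'] by (simp add: ker_obj_def)
  note t' = chosen_torsion_sequence[OF this, unfolded ker_obj_def]
  obtain w where w: "iso C w" "w \<in> Hom C (Dom C (tors_incl C \<T> \<F> (Dom C (ker C f)))) (Dom C t)"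
    "(k \<odot> t) \<odot> w = ker C f \<odot> tors_incl C \<T> \<F> (Dom C (ker C f))"
    using torsion_of_kernel_unique[OF k(1) k' k(2) t'] .
  have "Cod C w = Dom C (k \<odot> t)"
    using w(2) kernelD(1)[OF k(1)] torsion_sequenceD(3,5)[OF k(2)] by simp
  then show "normal_mono C (ker C f \<odot> tors_incl C \<T> \<F> (ker_obj C f))"
    using normal_mono_iso[OF k(3) w(1)] w(3) by (simp add: ker_obj_def)
qed

lemma condition_ND:
  assumes "condition_N C \<T> \<F>" "is_kernel C k f" "torsion_sequence C \<T> \<F> (Dom C k) t e"
  shows "normal_mono C (k \<odot> t)"
proof -
  note k' = ker_is_kernel[OF assms(2)]
  have o: "Dom C (ker C f) \<in> Obj C" using kernelD(1)[OF k'] by simp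
  note t' = chosen_torsion_sequence[OF o]
  have n: "normal_mono C (ker C f \<odot> tors_incl C \<T> \<F> (Dom C (ker C f)))"
    using assms(1) kernelD(2)[OF assms(2)] by (simp add: condition_N_def ker_obj_def)
  obtain w where w: "iso C w" "w \<in> Hom C (Dom C t) (Dom C (tors_incl C \<T> \<F> (Dom C (ker C f))))"
    "(ker C f \<odot> tors_incl C \<T> \<F> (Dom C (ker C f))) \<odot> w = k \<odot> t"
    using torsion_of_kernel_unique[OF k' assms(2) t' assms(3)] .
  have "Cod C w = Dom C (ker C f \<odot> tors_incl C \<T> \<F> (Dom C (ker C f)))"
    using w(2) kernelD(1)[OF k'] torsion_sequenceD(3,5)[OF t'] by simp
  then show ?thesis using normal_mono_iso[OF n w(1)] w(3) by simp
qed

subsection \<open>The reflector\<close>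

abbreviation "\<eta> A \<equiv> tors_unit C \<T> \<F> A"
abbreviation "RO A \<equiv> Cod C (\<eta> A)"
abbreviation "RM f \<equiv> on_mor (reflector C \<T> \<F>) f"
abbreviation "FC \<equiv> full_subcat C \<F>"

lemma on_obj_reflector: "on_obj (reflector C \<T> \<F>) A = RO A"
  by (simp add: reflector_def)

lemma unit_simps [simp]:
  assumes "A \<in> Obj C"
  shows "\<eta> A \<in> Mor C" "Dom C (\<eta> A) = A" "RO A \<in> \<F>" "epic C (\<eta> A)"
  using torsion_sequenceD[OF chosen_torsion_sequence[OF assms]] by simp_all

lemma reflector_eqI:
  assumes "f \<in> Hom C A B" "g \<in> Hom C (RO A) (RO B)" "g \<odot> \<eta> A = \<eta> B \<odot> f"
  shows "RM f = g"
proof -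
  have A: "A \<in> Obj C" "Dom C f = A" "Cod C f = B" using assms(1) by auto
  have "(THE g. g \<in> Hom C (RO A) (RO B) \<and> g \<odot> \<eta> A = \<eta> B \<odot> f) = g"
    using assms(2,3) epicD[OF unit_simps(4)[OF A(1)]] by (intro the_equality) metis+
  then show ?thesis by (simp add: reflector_def A)
qed

lemma reflector_mor:
  assumes "f \<in> Hom C A B"
  shows "RM f \<in> Hom C (RO A) (RO B)" "RM f \<odot> \<eta> A = \<eta> B \<odot> f"
proof -
  have o: "A \<in> Obj C" "B \<in> Obj C" using assms by auto
  have "\<eta> B \<odot> f \<in> Hom C A (RO B)" using assms o by simp
  then obtain g where g: "g \<in> Hom C (RO A) (RO B)" "g \<odot> \<eta> A = \<eta> B \<odot> f"
    using torsion_free_extend[OF chosen_torsion_sequence[OF o(1)] unit_simps(3)[OF o(2)]] by blast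
  have "RM f = g" using reflector_eqI[OF assms g] .
  with g show "RM f \<in> Hom C (RO A) (RO B)" "RM f \<odot> \<eta> A = \<eta> B \<odot> f" by simp_all
qed

end

section \<open>The full subcategory of torsion-free objects\<close>

lemma full_subcat_simps [simp]:
  "Obj (full_subcat C S) = Obj C \<inter> S"
  "Mor (full_subcat C S) = {f \<in> Mor C. Dom C f \<in> S \<and> Cod C f \<in> S}"
  "Dom (full_subcat C S) = Dom C" "Cod (full_subcat C S) = Cod C"
  "Idn (full_subcat C S) = Idn C" "Cmp (full_subcat C S) = Cmp C"
  by (simp_all add: full_subcat_def)

lemma Hom_full_subcat: "\<lbrakk>X \<in> S; Y \<in> S\<rbrakk> \<Longrightarrow> Hom (full_subcat C S) X Y = Hom C X Y"
  by (auto simp: Hom_def)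

context torsion_category
begin

lemma category_full_subcat: "category FC"
  by unfold_locales auto

lemma zero_object_full_subcat:
  assumes "zero_object C Z" shows "zero_object FC Z"
proof -
  have Z: "Z \<in> \<F>" using zero_object_torsion_free[OF assms] .
  show ?thesis using assms Z
    by (simp add: zero_object_def initial_def terminal_def Hom_full_subcat del: in_Hom)
qed

lemma pointed_full_subcat: "pointed_category FC"
  unfolding pointed_category_def pointed_category_axioms_def
  using category_full_subcat zero_object_full_subcat ex_zero_object by blast

interpretation FC: pointed_category FC by (rule pointed_full_subcat)

text \<open>The two sides are independent choices. They agree because a zero object of
  \<open>C\<close> is torsion-free and remains a zero object in the subcategory, so both morphisms
  pass through it.\<close>

lemma zero_mor_full_subcat:
  assumes "X \<in> \<F>" "Y \<in> \<F>"
  shows "zero_mor FC X Y = zero_mor C X Y"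
proof -
  obtain Z where Z: "zero_object C Z" using ex_zero_object by blast
  have o: "X \<in> Obj FC" "Y \<in> Obj FC" using assms by simp_all
  obtain u v where uv: "u \<in> Hom FC X Z" "v \<in> Hom FC Z Y" "v \<odot>\<^bsub>FC\<^esub> u = zero_mor FC X Y"
    using FC.zero_mor_through[OF zero_object_full_subcat[OF Z] o] .
  have "v \<odot> u = zero_mor C X Y"
    by (rule zero_through_zero_object[OF Z]) (use uv(1,2) in simp_all)
  then show ?thesis using uv(3) by simp
qed

lemma kernel_full_subcatI:
  assumes "is_kernel C k f" "Dom C k \<in> \<F>" "Dom C f \<in> \<F>" "Cod C f \<in> \<F>"
  shows "is_kernel FC k f"
proof (rule FC.kernelI)
  note k = kernelD[OF assms(1)]
  show "monic FC k" unfolding monic_def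
  proof (intro conjI allI ballI impI)
    fix X u v assume "u \<in> Hom FC X (Dom FC k)" "v \<in> Hom FC X (Dom FC k)" "k \<odot>\<^bsub>FC\<^esub> u = k \<odot>\<^bsub>FC\<^esub> v"
    then show "u = v" by (intro monicD[OF kernel_monic[OF assms(1)], of u v X]) simp_all
  qed (use k assms in simp)
  show "f \<odot>\<^bsub>FC\<^esub> k = zero_mor FC (Dom FC k) (Cod FC f)"
    using k(4) assms by (simp add: zero_mor_full_subcat)
  fix X h assume h: "X \<in> Obj FC" "h \<in> Hom FC X (Dom FC f)" "f \<odot>\<^bsub>FC\<^esub> h = zero_mor FC X (Cod FC f)"
  then have "h \<in> Hom C X (Dom C f)" "f \<odot> h = zero_mor C X (Cod C f)"
    using assms by (simp_all add: zero_mor_full_subcat)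
  then obtain u where "u \<in> Hom C X (Dom C k)" "k \<odot> u = h" using kernel_lift[OF assms(1)] by blast
  then show "\<exists>u \<in> Hom FC X (Dom FC k). k \<odot>\<^bsub>FC\<^esub> u = h"
    using assms(2) h(1) by (intro bexI[of _ u]) simp_all
qed (use kernelD[OF assms(1)] assms in simp_all)

text \<open>A reflective inclusion preserves monomorphisms: two maps from an arbitrary
  \<open>X\<close> into a torsion-free object extend along the epic unit to \<open>RO X\<close>,
  where they can be compared inside the subcategory. This brings what (P) says about
  \<open>FC\<close> back to \<open>C\<close>.\<close>

lemma monic_full_subcatD:
  assumes "monic FC k" shows "monic C k"
proof -
  have k: "k \<in> Mor C" "Dom C k \<in> \<F>" "Cod C k \<in> \<F>" using monic_Mor[OF assms] by auto
  show ?thesis unfolding monic_def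
  proof (intro conjI allI ballI impI)
    fix X u v assume uv: "u \<in> Hom C X (Dom C k)" "v \<in> Hom C X (Dom C k)" "k \<odot> u = k \<odot> v"
    have X: "X \<in> Obj C" using uv(1) by auto
    note s = chosen_torsion_sequence[OF X]
    obtain u' where u': "u' \<in> Hom C (RO X) (Dom C k)" "u' \<odot> \<eta> X = u"
      using torsion_free_extend[OF s k(2) uv(1)] .
    obtain v' where v': "v' \<in> Hom C (RO X) (Dom C k)" "v' \<odot> \<eta> X = v"
      using torsion_free_extend[OF s k(2) uv(2)] .
    have "(k \<odot> u') \<odot> \<eta> X = (k \<odot> v') \<odot> \<eta> X"
      using u'(1) v'(1) k X uv(3) by (simp add: u'(2) v'(2))
    then have "k \<odot> u' = k \<odot> v'"
      by (rule epicD[OF unit_simps(4)[OF X], where Y = "Cod C k"]) (use u'(1) v'(1) k in simp_all)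
    then have "u' = v'"
      using u'(1) v'(1) k X by (intro monicD[OF assms, of u' v' "RO X"]) simp_all
    then show "u = v" using u'(2) v'(2) by simp
  qed (rule k)
qed

lemma reflector_functor: "is_functor C FC (reflector C \<T> \<F>)"
  unfolding is_functor_def on_obj_reflector
proof (intro conjI ballI impI)
  show "category C" ..
  show "category FC" ..
  fix X assume X: "X \<in> Obj C"
  show "RO X \<in> Obj FC" using X by simp
  show "RM (Idn C X) = Idn FC (RO X)"
    using X reflector_eqI[of "Idn C X" X X "Idn C (RO X)"] by simp
next
  fix f assume f: "f \<in> Mor C"
  then show "RM f \<in> Hom FC (RO (Dom C f)) (RO (Cod C f))"
    using reflector_mor(1)[of f "Dom C f" "Cod C f"] by simp
  fix g assume g: "g \<in> Mor C" "Dom C g = Cod C f"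
  note rf = reflector_mor[of f "Dom C f" "Cod C f"] and rg = reflector_mor[of g "Cod C f" "Cod C g"]
  have "(RM g \<odot> RM f) \<odot> \<eta> (Dom C f) = \<eta> (Cod C g) \<odot> (g \<odot> f)"
    using rf rg(1) f g by (simp add: assoc_eq[OF rg(2)])
  then show "RM (g \<odot> f) = RM g \<odot>\<^bsub>FC\<^esub> RM f"
    using rf(1) rg(1) f g reflector_eqI[of "g \<odot> f" "Dom C f" "Cod C g" "RM g \<odot> RM f"] by simp
qed

text \<open>Functors preserve sections, so the content of protoadditivity lies in the
  kernels.\<close>

lemma reflector_split:
  assumes "section_of C s f"
  shows "section_of FC (RM s) (RM f)"
proof -
  have f: "f \<in> Hom C (Dom C f) (Cod C f)" "s \<in> Hom C (Cod C f) (Dom C f)" "f \<odot> s = Idn C (Cod C f)"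
    using assms by (simp_all add: section_of_def)
  note fct = reflector_functor[unfolded is_functor_def on_obj_reflector]
  have "RM f \<odot> RM s = RM (f \<odot> s)" using fct f(1,2) by simp
  also have "\<dots> = Idn C (RO (Cod C f))" using fct f(1) unfolding f(3) by simp
  finally show ?thesis
    using reflector_mor(1)[OF f(1)] reflector_mor(1)[OF f(2)] f by (simp add: section_of_def)
qed

text \<open>The kernel is verified in \<open>C\<close>, with torsion sequences chosen at will. The
  isomorphisms between units carry it to \<open>RM k\<close> and \<open>RM f\<close>, and a kernel
  in \<open>C\<close> between torsion-free objects is a kernel in \<open>FC\<close>.\<close>

lemma condition_PI:
  assumes "\<And>k f s. split_short_exact C k f s \<Longrightarrow>
    \<exists>t\<^sub>1 e\<^sub>1 t\<^sub>2 e\<^sub>2 t\<^sub>3 e\<^sub>3 k' f'. torsion_sequence C \<T> \<F> (Dom C k) t\<^sub>1 e\<^sub>1 \<and>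
      torsion_sequence C \<T> \<F> (Dom C f) t\<^sub>2 e\<^sub>2 \<and> torsion_sequence C \<T> \<F> (Cod C f) t\<^sub>3 e\<^sub>3 \<and>
      is_kernel C k' f' \<and> k' \<in> Hom C (Cod C e\<^sub>1) (Cod C e\<^sub>2) \<and> f' \<in> Hom C (Cod C e\<^sub>2) (Cod C e\<^sub>3) \<and>
      k' \<odot> e\<^sub>1 = e\<^sub>2 \<odot> k \<and> f' \<odot> e\<^sub>2 = e\<^sub>3 \<odot> f"
  shows "condition_P C \<T> \<F>"
  unfolding condition_P_def protoadditive_def
proof (intro conjI allI impI reflector_functor)
  fix k f s assume kfs: "split_short_exact C k f s"
  then have k: "is_kernel C k f" and s: "section_of C s f" by (simp_all add: split_short_exact_def)
  note kD = kernelD[OF k]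
  obtain t\<^sub>1 e\<^sub>1 t\<^sub>2 e\<^sub>2 t\<^sub>3 e\<^sub>3 k' f' where t: "torsion_sequence C \<T> \<F> (Dom C k) t\<^sub>1 e\<^sub>1"
    "torsion_sequence C \<T> \<F> (Dom C f) t\<^sub>2 e\<^sub>2" "torsion_sequence C \<T> \<F> (Cod C f) t\<^sub>3 e\<^sub>3"
    and k': "is_kernel C k' f'" "k' \<in> Hom C (Cod C e\<^sub>1) (Cod C e\<^sub>2)" "f' \<in> Hom C (Cod C e\<^sub>2) (Cod C e\<^sub>3)"
      "k' \<odot> e\<^sub>1 = e\<^sub>2 \<odot> k" "f' \<odot> e\<^sub>2 = e\<^sub>3 \<odot> f"
    using assms[OF kfs] by blast
  have o: "Dom C k \<in> Obj C" "Dom C f \<in> Obj C" "Cod C f \<in> Obj C" using kD by simp_all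
  have kh: "k \<in> Hom C (Dom C k) (Dom C f)" "f \<in> Hom C (Dom C f) (Cod C f)" using kD by simp_all
  note rk = reflector_mor[OF kh(1)] and rf = reflector_mor[OF kh(2)]
  note t1 = torsion_sequenceD[OF t(1)] and t2 = torsion_sequenceD[OF t(2)]
    and t3 = torsion_sequenceD[OF t(3)]
  obtain a where a: "iso C a" "a \<in> Hom C (Cod C e\<^sub>1) (RO (Dom C k))" "a \<odot> e\<^sub>1 = \<eta> (Dom C k)"
    using torsion_unit_iso[OF t(1) chosen_torsion_sequence[OF o(1)]] .
  obtain b where b: "iso C b" "b \<in> Hom C (Cod C e\<^sub>2) (RO (Dom C f))" "b \<odot> e\<^sub>2 = \<eta> (Dom C f)"
    using torsion_unit_iso[OF t(2) chosen_torsion_sequence[OF o(2)]] .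
  obtain c where c: "iso C c" "c \<in> Hom C (Cod C e\<^sub>3) (RO (Cod C f))" "c \<odot> e\<^sub>3 = \<eta> (Cod C f)"
    using torsion_unit_iso[OF t(3) chosen_torsion_sequence[OF o(3)]] .
  have 1: "RM k \<odot> a = b \<odot> k'"
  proof (rule epicD[OF t1(11), where Y = "RO (Dom C f)"])
    show "(RM k \<odot> a) \<odot> e\<^sub>1 = (b \<odot> k') \<odot> e\<^sub>1"
      using rk a b k'(2,4) t1(4,6) t2(4,6) kD by (simp add: assoc_eq[OF b(3)])
  qed (use rk(1) a(2) b(2) k'(2) in simp_all)
  have 2: "RM f \<odot> b = c \<odot> f'"
  proof (rule epicD[OF t2(11), where Y = "RO (Cod C f)"])
    show "(RM f \<odot> b) \<odot> e\<^sub>2 = (c \<odot> f') \<odot> e\<^sub>2"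
      using rf b c k'(3,5) t2(4,6) t3(4,6) kD by (simp add: assoc_eq[OF c(3)])
  qed (use rf(1) b(2) c(2) k'(3) in simp_all)
  have "is_kernel C (RM k) (RM f)"
    by (rule kernel_iso_transfer[OF k'(1) a(1) b(1) c(1) _ _ _ _ _ 1 2])
      (use a(2) b(2) c(2) k'(2,3) rk(1) rf(1) in simp_all)
  then have "is_kernel FC (RM k) (RM f)"
    by (rule kernel_full_subcatI) (use rk(1) rf(1) o in simp_all)
  then show "split_short_exact FC (RM k) (RM f) (RM s)"
    using reflector_split[OF s] by (simp add: split_short_exact_def)
qed

text \<open>The form in which (P) is applied. \<open>RM k\<close> is a kernel in \<open>FC\<close>,
  hence monic there and therefore monic in \<open>C\<close>; the isomorphisms between units pass
  this on to the map \<open>k'\<close> between arbitrary torsion-free quotients.\<close>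

lemma condition_P_monic:
  assumes "condition_P C \<T> \<F>" "split_short_exact C k f s"
    "torsion_sequence C \<T> \<F> (Dom C k) t\<^sub>1 e\<^sub>1" "torsion_sequence C \<T> \<F> (Dom C f) t\<^sub>2 e\<^sub>2"
    "k' \<in> Hom C (Cod C e\<^sub>1) (Cod C e\<^sub>2)" "k' \<odot> e\<^sub>1 = e\<^sub>2 \<odot> k"
  shows "monic C k'"
proof -
  have k: "is_kernel C k f" using assms(2) by (simp add: split_short_exact_def)
  note kD = kernelD[OF k]
  have o: "Dom C k \<in> Obj C" "Dom C f \<in> Obj C" using kD by simp_all
  have kh: "k \<in> Hom C (Dom C k) (Dom C f)" using kD by simp
  note rk = reflector_mor[OF kh]
  note t1 = torsion_sequenceD[OF assms(3)] and t2 = torsion_sequenceD[OF assms(4)]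
  have "is_kernel FC (RM k) (RM f)"
    using assms(1,2) unfolding condition_P_def protoadditive_def split_short_exact_def by blast
  then have m: "monic C (RM k)" using FC.kernel_monic monic_full_subcatD by blast
  obtain a where a: "iso C a" "a \<in> Hom C (Cod C e\<^sub>1) (RO (Dom C k))" "a \<odot> e\<^sub>1 = \<eta> (Dom C k)"
    using torsion_unit_iso[OF assms(3) chosen_torsion_sequence[OF o(1)]] .
  obtain b where b: "iso C b" "b \<in> Hom C (Cod C e\<^sub>2) (RO (Dom C f))" "b \<odot> e\<^sub>2 = \<eta> (Dom C f)"
    using torsion_unit_iso[OF assms(4) chosen_torsion_sequence[OF o(2)]] .
  have 1: "b \<odot> k' = RM k \<odot> a"
  proof (rule epicD[OF t1(11), where Y = "RO (Dom C f)"])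
    show "(b \<odot> k') \<odot> e\<^sub>1 = (RM k \<odot> a) \<odot> e\<^sub>1"
      using rk a b assms(5,6) t1(4,6) t2(4,6) kD by (simp add: assoc_eq[OF b(3)])
  qed (use rk(1) a(2) b(2) assms(5) in simp_all)
  have "monic C (RM k \<odot> a)" using m iso_monic[OF a(1)] rk(1) a(2) by (intro monic_comp) simp_all
  then show ?thesis using monic_cancel[of b k'] assms(5) b(2) unfolding 1[symmetric] by simp
qed

end

section \<open>Homological categories\<close>

locale homological_category = pointed_category C for C :: "('o, 'm) cat" (structure) +
  assumes homological: "homological C"

lemma homological_categoryI: "homological C \<Longrightarrow> homological_category C"
  by (simp add: homological_category_def homological_category_axioms_def homological_def
      pointed_protomodular_def pointed_iff)

context homological_category
begin

lemma ex_pullback: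
  "\<lbrakk>f \<in> Mor C; g \<in> Mor C; Cod C f = Cod C g\<rbrakk> \<Longrightarrow> \<exists>p q. is_pullback C p q f g"
  using homological unfolding homological_def regular_category_def by blast

lemma ex_coequalizer_of_kernel_pair: "is_pullback C a b f f \<Longrightarrow> \<exists>q. is_coequalizer C q a b"
  using homological unfolding homological_def regular_category_def by blast

lemma regular_epi_pullback: "\<lbrakk>is_pullback C p q f g; regular_epi C f\<rbrakk> \<Longrightarrow> regular_epi C q"
  using homological unfolding homological_def regular_category_def by blast

lemma split_short_five:
  assumes "is_kernel C k f" "section_of C s f" "is_kernel C k' f'" "section_of C s' f'"
    "u \<in> Hom C (Dom C k) (Dom C k')" "v \<in> Hom C (Dom C f) (Dom C f')"
    "w \<in> Hom C (Cod C f) (Cod C f')" "v \<odot> k = k' \<odot> u" "f' \<odot> v = w \<odot> f" "v \<odot> s = s' \<odot> w"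
    "iso C u" "iso C w"
  shows "iso C v"
proof -
  have "split_short_exact C k f s" "split_short_exact C k' f' s'"
    using assms by (simp_all add: split_short_exact_def)
  moreover have "split_short_five_lemma C"
    using homological by (simp add: homological_def pointed_protomodular_def)
  ultimately show ?thesis using assms(5-12) unfolding split_short_five_lemma_def by blast
qed

section \<open>Pullbacks, kernels and products in a homological category\<close>

lemma pullbackI_monic:
  assumes "f \<in> Mor C" "g \<in> Mor C" "monic C p" "q \<in> Mor C" "Cod C f = Cod C g" "Dom C q = Dom C p"
    "Cod C p = Dom C f" "Cod C q = Dom C g" "f \<odot> p = g \<odot> q"
    and lift: "\<And>X a b. \<lbrakk>X \<in> Obj C; a \<in> Hom C X (Dom C f); b \<in> Hom C X (Dom C g); f \<odot> a = g \<odot> b\<rbrakk>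
      \<Longrightarrow> \<exists>h \<in> Hom C X (Dom C p). p \<odot> h = a \<and> q \<odot> h = b"
  shows "is_pullback C p q f g"
  unfolding is_pullback_def
proof (intro conjI ballI impI)
  show "p \<in> Mor C" using assms(3) by simp
  show "Dom C p = Dom C q" using assms(6) by simp
  fix X a b assume "X \<in> Obj C" "a \<in> Hom C X (Dom C f)" "b \<in> Hom C X (Dom C g)" "f \<odot> a = g \<odot> b"
  then obtain h where h: "h \<in> Hom C X (Dom C p)" "p \<odot> h = a" "q \<odot> h = b" using lift by blast
  then show "\<exists>!h. h \<in> Hom C X (Dom C p) \<and> p \<odot> h = a \<and> q \<odot> h = b"
    using monicD[OF assms(3)] by metis
qed fact+

text \<open>Since \<open>p\<close> is the pullback of \<open>g\<close> along \<open>f\<close>, it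
  has the same kernel object as \<open>g\<close>: the wanted \<open>k\<close> is the map with
  components \<open>0\<close> and \<open>l\<close>.\<close>

lemma pullback_kernel:
  assumes "is_pullback C p q f g" "is_kernel C l g"
  obtains k where "is_kernel C k p" "k \<in> Hom C (Dom C l) (Dom C p)" "q \<odot> k = l"
proof -
  note P = pullbackD[OF assms(1)] and l = kernelD[OF assms(2)]
  have z: "zero_mor C (Dom C l) (Dom C f) \<in> Hom C (Dom C l) (Dom C f)" "l \<in> Hom C (Dom C l) (Dom C g)"
    using P l by simp_all
  have "f \<odot> zero_mor C (Dom C l) (Dom C f) = g \<odot> l" using P l by simp
  then obtain k where k: "k \<in> Hom C (Dom C l) (Dom C p)" "p \<odot> k = zero_mor C (Dom C l) (Dom C f)" "q \<odot> k = l"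
    using pullback_lift[OF assms(1) z] by blast
  have "is_kernel C k p"
  proof (rule kernelI)
    have "monic C (q \<odot> k)" using k(3) kernel_monic[OF assms(2)] by simp
    then show "monic C k" by (rule monic_cancel) (use k(1) P in simp_all)
    show "p \<odot> k = zero_mor C (Dom C k) (Cod C p)" using k P by simp
    fix X h assume h: "X \<in> Obj C" "h \<in> Hom C X (Dom C p)" "p \<odot> h = zero_mor C X (Cod C p)"
    have qh: "q \<odot> h \<in> Hom C X (Dom C g)" using h(2) P by simp
    have "f \<odot> (p \<odot> h) = g \<odot> (q \<odot> h)" using h(2) P by (simp add: assoc_eq[OF P(9)])
    then have "g \<odot> (q \<odot> h) = zero_mor C X (Cod C g)" using h P by simp
    then obtain u where u: "u \<in> Hom C X (Dom C l)" "l \<odot> u = q \<odot> h"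
      using kernel_lift[OF assms(2) qh] by blast
    have "k \<odot> u = h"
      by (rule pullback_unique[OF assms(1), where X = X])
        (use u k(1) h P in \<open>simp_all add: assoc_eq[OF k(2)] assoc_eq[OF k(3)]\<close>)
    then show "\<exists>u \<in> Hom C X (Dom C k). k \<odot> u = h" using u(1) k(1) by (intro bexI[of _ u]) simp_all
  qed (use k(1) P in simp_all)
  then show ?thesis using that k(1,3) by blast
qed

text \<open>A kernel is a pullback of the morphism from a zero object to the codomain.\<close>

lemma ex_kernel:
  assumes "f \<in> Mor C" obtains k where "is_kernel C k f"
proof -
  obtain Z where Z: "zero_object C Z" using ex_zero_object by blast
  have o: "Z \<in> Obj C" using zero_objectD(1)[OF Z] .
  let ?z = "zero_mor C Z (Cod C f)"
  obtain p q where P: "is_pullback C p q f ?z" using ex_pullback[of f ?z] assms o by auto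
  note PD = pullbackD[OF P]
  have to_Z: "u = v" if "u \<in> Hom C X Z" "v \<in> Hom C X Z" for u v X
    using zero_objectD(4)[OF Z that] .
  have qZ: "q \<in> Hom C (Dom C p) Z" using PD assms o by simp
  have "is_kernel C p f"
  proof (rule kernelI)
    show "monic C p" unfolding monic_def
    proof (intro conjI allI ballI impI)
      fix X u v assume uv: "u \<in> Hom C X (Dom C p)" "v \<in> Hom C X (Dom C p)" "p \<odot> u = p \<odot> v"
      have "q \<odot> u = q \<odot> v" by (rule to_Z[of _ X]) (use uv(1,2) qZ in simp_all)
      then show "u = v" using pullback_unique[OF P uv] by blast
    qed (rule PD)
    show "f \<odot> p = zero_mor C (Dom C p) (Cod C f)" using PD(9) qZ assms o by simp
    fix X h assume h: "X \<in> Obj C" "h \<in> Hom C X (Dom C f)" "f \<odot> h = zero_mor C X (Cod C f)"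
    have "zero_mor C X Z \<in> Hom C X (Dom C ?z)" "f \<odot> h = ?z \<odot> zero_mor C X Z"
      using h o assms by simp_all
    then show "\<exists>u \<in> Hom C X (Dom C p). p \<odot> u = h" using pullback_lift[OF P h(2)] by blast
  qed (use PD in simp_all)
  then show ?thesis by (rule that)
qed

text \<open>\<open>p\<close> and \<open>q\<close> are the projections of a product of
  \<open>X\<close> and \<open>Y\<close>, built as a pullback over a zero object. The last clause is
  their joint monicity, which replaces the uniqueness part of the universal property.\<close>

lemma ex_pairing:
  assumes "f \<in> Hom C A X" "g \<in> Hom C A Y"
  obtains p q h where "p \<in> Mor C" "q \<in> Mor C" "Cod C p = X" "Cod C q = Y" "Dom C q = Dom C p"
    "h \<in> Hom C A (Dom C p)" "p \<odot> h = f" "q \<odot> h = g"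
    "\<And>W u v. \<lbrakk>u \<in> Hom C W (Dom C p); v \<in> Hom C W (Dom C p); p \<odot> u = p \<odot> v; q \<odot> u = q \<odot> v\<rbrakk> \<Longrightarrow> u = v"
proof -
  obtain Z where Z: "zero_object C Z" using ex_zero_object by blast
  have o: "X \<in> Obj C" "Y \<in> Obj C" "Z \<in> Obj C" "A \<in> Obj C" using zero_objectD(1)[OF Z] assms by auto
  obtain p q where P: "is_pullback C p q (zero_mor C X Z) (zero_mor C Y Z)"
    using ex_pullback[of "zero_mor C X Z" "zero_mor C Y Z"] o by auto
  note PD = pullbackD[OF P]
  have *: "f \<in> Hom C A (Dom C (zero_mor C X Z))" "g \<in> Hom C A (Dom C (zero_mor C Y Z))"
    "zero_mor C X Z \<odot> f = zero_mor C Y Z \<odot> g"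
    using assms o by simp_all
  obtain h where h: "h \<in> Hom C A (Dom C p)" "p \<odot> h = f" "q \<odot> h = g"
    using pullback_lift[OF P *] .
  show ?thesis
    by (rule that[OF _ _ _ _ _ h pullback_unique[OF P]]) (use PD o in simp_all)
qed

text \<open>Let \<open>c\<close>, \<open>d\<close> be the kernel pair of \<open>m\<close> and
  \<open>\<delta>\<close> its diagonal. If \<open>c \<odot> h\<close> is zero, then so is
  \<open>m \<odot> (d \<odot> h)\<close>, hence \<open>d \<odot> h\<close> and finally
  \<open>h\<close>; thus \<open>c\<close> has zero kernel. Comparing the identity of
  \<open>Dom C m\<close> with \<open>c\<close>, split by \<open>\<delta>\<close>, the split short
  five lemma makes \<open>\<delta>\<close> invertible, which forces \<open>c = d\<close>.\<close>

lemma monic_if_zero_kernel: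
  assumes m: "m \<in> Mor C"
    and z: "\<And>X h. \<lbrakk>h \<in> Hom C X (Dom C m); m \<odot> h = zero_mor C X (Cod C m)\<rbrakk> \<Longrightarrow> h = zero_mor C X (Dom C m)"
  shows "monic C m"
proof -
  let ?I = "Dom C m"
  obtain Z where Z: "zero_object C Z" using ex_zero_object by blast
  have o: "Z \<in> Obj C" "?I \<in> Obj C" using zero_objectD(1)[OF Z] m by auto
  have zero_monic: "monic C (zero_mor C Z X)" if "X \<in> Obj C" for X
    unfolding monic_def using zero_objectD(4)[OF Z] that o by simp
  obtain c d where P: "is_pullback C c d m m" using ex_pullback[OF m m] by blast
  note PD = pullbackD[OF P]
  let ?R = "Dom C c"
  have oR: "?R \<in> Obj C" using PD by simp
  have "Idn C ?I \<in> Hom C ?I ?I" using o by simp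
  then obtain \<delta> where \<delta>: "\<delta> \<in> Hom C ?I ?R" "c \<odot> \<delta> = Idn C ?I" "d \<odot> \<delta> = Idn C ?I"
    using pullback_lift[OF P] by blast
  have "iso C \<delta>"
  proof (rule split_short_five)
    show "is_kernel C (zero_mor C Z ?I) (Idn C ?I)" using kernel_of_identity[OF Z o(2)] .
    show "is_kernel C (zero_mor C Z ?R) c"
    proof (rule kernelI)
      fix X h assume h: "X \<in> Obj C" "h \<in> Hom C X (Dom C c)" "c \<odot> h = zero_mor C X (Cod C c)"
      have dh: "d \<odot> h \<in> Hom C X ?I" using h(2) PD by simp
      have "m \<odot> (c \<odot> h) = m \<odot> (d \<odot> h)" using h(2) PD by (simp add: assoc_eq[OF PD(9)])
      then have "m \<odot> (d \<odot> h) = zero_mor C X (Cod C m)" using h PD by simp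
      then have dh0: "d \<odot> h = zero_mor C X ?I" using z dh by blast
      have "zero_mor C X ?R = h"
        by (rule pullback_unique[OF P, where X = X]) (use h PD oR dh0 in simp_all)
      then show "\<exists>u \<in> Hom C X (Dom C (zero_mor C Z ?R)). zero_mor C Z ?R \<odot> u = h"
        using h(1) o oR by (intro bexI[of _ "zero_mor C X Z"]) simp_all
    qed (use zero_monic oR o PD in simp_all)
    show "section_of C (Idn C ?I) (Idn C ?I)" "section_of C \<delta> c"
      using o \<delta> PD by (simp_all add: section_of_def)
    show "iso C (Idn C Z)" "iso C (Idn C ?I)" using o iso_Idn by simp_all
  qed (use o \<delta> PD oR in simp_all)
  then obtain \<epsilon> where \<epsilon>: "\<epsilon> \<in> Mor C" "Dom C \<epsilon> = Cod C \<delta>" "Cod C \<epsilon> = Dom C \<delta>" "\<delta> \<odot> \<epsilon> = Idn C (Cod C \<delta>)"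
    by (rule isoE)
  have "(c \<odot> \<delta>) \<odot> \<epsilon> = c" "(d \<odot> \<delta>) \<odot> \<epsilon> = d"
    using assoc[of \<epsilon> \<delta> c] assoc[of \<epsilon> \<delta> d] \<epsilon> \<delta>(1) PD by simp_all
  then have cd: "c = d" using \<delta>(2,3) by simp
  show ?thesis unfolding monic_def
  proof (intro conjI allI ballI impI m)
    fix X u v assume uv: "u \<in> Hom C X ?I" "v \<in> Hom C X ?I" "m \<odot> u = m \<odot> v"
    obtain h where "c \<odot> h = u" "d \<odot> h = v" using pullback_lift[OF P uv] by blast
    then show "u = v" using cd by simp
  qed
qed

section \<open>Regular epimorphisms, images and quotients by normal subobjects\<close>

lemma regular_epi_Mor [simp]: "regular_epi C e \<Longrightarrow> e \<in> Mor C"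
  using regular_epi_epic by simp

text \<open>The kernel of \<open>g \<odot> e\<close> is the inverse image under \<open>e\<close> of
  the kernel of \<open>g\<close>. So \<open>r\<close> is a pullback of \<open>e\<close>, and regular
  epimorphisms are stable under pullback.\<close>

lemma kernel_restriction_regular:
  assumes "regular_epi C e" "g \<in> Mor C" "Dom C g = Cod C e"
    "is_kernel C k (g \<odot> e)" "is_kernel C l g"
  obtains r where "regular_epi C r" "r \<in> Hom C (Dom C k) (Dom C l)" "l \<odot> r = e \<odot> k"
proof -
  have e: "e \<in> Mor C" using assms(1) by simp
  note k = kernelD[OF assms(4)] and l = kernelD[OF assms(5)]
  have ge: "Dom C (g \<odot> e) = Dom C e" "Cod C (g \<odot> e) = Cod C g" using e assms(2,3) by simp_all
  have "g \<odot> (e \<odot> k) = zero_mor C (Dom C k) (Cod C g)" "e \<odot> k \<in> Hom C (Dom C k) (Dom C g)"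
    using k e assms(2,3) ge by simp_all
  then obtain r where r: "r \<in> Hom C (Dom C k) (Dom C l)" "l \<odot> r = e \<odot> k"
    using kernel_lift[OF assms(5)] by blast
  have "is_pullback C k r e l"
  proof (rule pullbackI_monic)
    fix X a b assume a: "a \<in> Hom C X (Dom C e)" "b \<in> Hom C X (Dom C l)" "e \<odot> a = l \<odot> b"
    have o: "X \<in> Obj C" using a(1) by auto
    have "(g \<odot> e) \<odot> a = zero_mor C X (Cod C (g \<odot> e))" "a \<in> Hom C X (Dom C (g \<odot> e))"
      using a e l(1,3) ge assms(2,3) by (simp_all add: assoc_eq[OF l(4)])
    then obtain u where u: "u \<in> Hom C X (Dom C k)" "k \<odot> u = a"
      using kernel_lift[OF assms(4)] by blast
    have "l \<odot> (r \<odot> u) = l \<odot> b"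
      using u(1) r(1) l k e ge by (simp add: assoc_eq[OF r(2)] u(2) a(3))
    then have "r \<odot> u = b"
      by (rule monicD[OF kernel_monic[OF assms(5)], where X = X]) (use u r a l in simp_all)
    then show "\<exists>h \<in> Hom C X (Dom C k). k \<odot> h = a \<and> r \<odot> h = b" using u by blast
  qed (use e l k r ge assms kernel_monic[OF assms(4)] in simp_all)
  then show ?thesis using that[OF regular_epi_pullback[OF _ assms(1)] r] by blast
qed

text \<open>The kernel of \<open>g \<odot> e\<close> covers the kernel \<open>l\<close> of
  \<open>g\<close> by a regular epimorphism \<open>r\<close>. As \<open>e\<close> kills the former,
  \<open>l \<odot> r\<close> is zero, so \<open>l\<close> is zero and \<open>g\<close> has trivial
  kernel.\<close>

lemma monic_if_kernel_collapsed:
  assumes "regular_epi C e" "g \<in> Mor C" "Dom C g = Cod C e"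
    "is_kernel C k (g \<odot> e)" "e \<odot> k = zero_mor C (Dom C k) (Cod C e)"
  shows "monic C g"
proof (rule monic_if_zero_kernel[OF assms(2)])
  obtain l where l: "is_kernel C l g" using ex_kernel[OF assms(2)] .
  note lD = kernelD[OF l]
  obtain r where r: "regular_epi C r" "r \<in> Hom C (Dom C k) (Dom C l)" "l \<odot> r = e \<odot> k"
    using kernel_restriction_regular[OF assms(1-4) l] .
  have "l = zero_mor C (Cod C r) (Dom C g)"
    by (rule epic_zero_cancel[OF regular_epi_epic[OF r(1)]]) (use r(2,3) lD assms(3,5) in simp_all)
  then have lz: "l = zero_mor C (Dom C l) (Dom C g)" using r(2) by simp
  fix X h assume h: "h \<in> Hom C X (Dom C g)" "g \<odot> h = zero_mor C X (Cod C g)"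
  obtain u where u: "u \<in> Hom C X (Dom C l)" "l \<odot> u = h" using kernel_lift[OF l h] .
  have "zero_mor C (Dom C l) (Dom C g) \<odot> u = zero_mor C X (Dom C g)"
    using u(1) assms(2) by simp
  then show "h = zero_mor C X (Dom C g)" using u(2) lz by metis
qed

text \<open>\<open>e\<close> is the coequalizer of the kernel pair of \<open>f\<close>. For
  \<open>m\<close> to be monic it suffices that \<open>e\<close> kills the kernel \<open>k\<close>
  of \<open>f\<close>, and it does, because the map with components \<open>k\<close> and
  \<open>0\<close> goes into the kernel pair.\<close>

lemma image_factorization:
  assumes "f \<in> Hom C A B"
  obtains e m where "regular_epi C e" "monic C m" "e \<in> Hom C A (Dom C m)" "Cod C m = B" "m \<odot> e = f"
proof -
  have f: "f \<in> Mor C" "A = Dom C f" "B = Cod C f" using assms by auto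
  obtain a b where P: "is_pullback C a b f f" using ex_pullback[OF f(1) f(1)] by blast
  note PD = pullbackD[OF P]
  obtain e where q: "is_coequalizer C e a b" using ex_coequalizer_of_kernel_pair[OF P] by blast
  note qD = coequalizerD[OF q]
  have re: "regular_epi C e" using q by (auto simp: regular_epi_def)
  have "f \<in> Hom C (Cod C a) (Cod C f)" using f(1) PD by simp
  then obtain m where m: "m \<in> Hom C (Cod C e) (Cod C f)" "m \<odot> e = f"
    using coequalizer_lift[OF q] PD(9) by blast
  obtain k where k: "is_kernel C k f" using ex_kernel[OF f(1)] .
  note kD = kernelD[OF k]
  have "k \<in> Hom C (Dom C k) (Dom C f)" "zero_mor C (Dom C k) (Dom C f) \<in> Hom C (Dom C k) (Dom C f)"
    "f \<odot> k = f \<odot> zero_mor C (Dom C k) (Dom C f)" using kD by simp_all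
  then obtain h where h: "h \<in> Hom C (Dom C k) (Dom C a)" "a \<odot> h = k" "b \<odot> h = zero_mor C (Dom C k) (Dom C f)"
    using pullback_lift[OF P] by blast
  have "e \<odot> (a \<odot> h) = e \<odot> (b \<odot> h)" using h(1) qD(1-6) PD(6) by (simp add: assoc_eq[OF qD(7)])
  then have ek: "e \<odot> k = zero_mor C (Dom C k) (Cod C e)" using h(2,3) kD qD(3,6) PD(7) by simp
  have "monic C m"
    by (rule monic_if_kernel_collapsed[OF re _ _ _ ek]) (use m k in simp_all)
  then show ?thesis using that[OF re] m qD(3,6) PD(7) f by simp
qed

text \<open>Given \<open>h\<close> with \<open>h \<odot> j\<close> zero, the map \<open>u\<close>
  with \<open>u \<odot> e = h\<close> is found through its graph: the image of the pairing
  \<open>n\<close> of \<open>e\<close> and \<open>h\<close> in the product of \<open>Cod C e\<close>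
  and \<open>Y\<close>. The projection \<open>p \<odot> m\<close> of the image to
  \<open>Cod C e\<close> is monic, because \<open>x\<close> kills the kernel \<open>j\<close> of
  \<open>e\<close>, and it is invertible, because the regular epimorphism \<open>e\<close> factors
  through it.\<close>

lemma regular_epi_cokernel:
  assumes "regular_epi C e" "is_kernel C j e"
  shows "is_cokernel C e j"
proof (rule cokernelI)
  note j = kernelD[OF assms(2)]
  show "epic C e" using regular_epi_epic[OF assms(1)] .
  fix Y h assume h: "Y \<in> Obj C" "h \<in> Hom C (Cod C j) Y" "h \<odot> j = zero_mor C (Dom C j) Y"
  have eh: "e \<in> Hom C (Dom C e) (Cod C e)" "h \<in> Hom C (Dom C e) Y" using j h by simp_all
  obtain p q n where n: "p \<in> Mor C" "q \<in> Mor C" "Cod C p = Cod C e" "Cod C q = Y" "Dom C q = Dom C p"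
    "n \<in> Hom C (Dom C e) (Dom C p)" "p \<odot> n = e" "q \<odot> n = h"
    and joint: "\<And>W u v. \<lbrakk>u \<in> Hom C W (Dom C p); v \<in> Hom C W (Dom C p); p \<odot> u = p \<odot> v; q \<odot> u = q \<odot> v\<rbrakk> \<Longrightarrow> u = v"
    using ex_pairing[OF eh] by metis
  obtain x m where x: "regular_epi C x" "monic C m" "x \<in> Hom C (Dom C e) (Dom C m)" "Cod C m = Dom C p" "m \<odot> x = n"
    using image_factorization[OF n(6)] .
  have m: "m \<in> Mor C" using x(2) by simp
  have gx: "(p \<odot> m) \<odot> x = e" using x(3,4) m n(1,7) by (simp add: x(5))
  have "n \<odot> j = zero_mor C (Dom C j) (Dom C p)"
    by (rule joint[of _ "Dom C j"])
      (use n(1-6) j h(1,3) in \<open>simp_all add: assoc_eq[OF n(7)] assoc_eq[OF n(8)]\<close>)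
  then have "m \<odot> (x \<odot> j) = zero_mor C (Dom C j) (Cod C m)"
    using x(3,4) m j by (simp add: assoc_eq[OF x(5)])
  then have "x \<odot> j = zero_mor C (Dom C j) (Dom C m)"
    by (intro monic_zero_cancel[OF x(2)]) (use x(3) j in simp_all)
  then have "monic C (p \<odot> m)"
    by (intro monic_if_kernel_collapsed[OF x(1), where k = j]) (use x(3,4) m n(1) assms(2) gx in simp_all)
  then have "iso C (p \<odot> m)"
    by (rule monic_regular_factor_iso[rotated, where x = x]) (use x(3,4) m n(1) assms(1) gx in simp_all)
  then obtain i where i: "i \<in> Mor C" "Dom C i = Cod C (p \<odot> m)" "Cod C i = Dom C (p \<odot> m)"
    "i \<odot> (p \<odot> m) = Idn C (Dom C (p \<odot> m))" by (rule isoE)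
  \<comment> \<open>The inverse \<open>i\<close> of the projection, followed by the inclusion
    \<open>m\<close> and the second projection \<open>q\<close>, is the map whose graph was
    taken.\<close>
  have "i \<odot> e = i \<odot> ((p \<odot> m) \<odot> x)" using gx by simp
  also have "\<dots> = (i \<odot> (p \<odot> m)) \<odot> x" using i(1-3) x(3,4) m n(1) by simp
  also have "\<dots> = x" unfolding i(4) using x(3,4) m n(1) by simp
  finally have ie: "i \<odot> e = x" .
  have "((q \<odot> m) \<odot> i) \<odot> e = q \<odot> (m \<odot> (i \<odot> e))" using i(1-3) x(3,4) m n(1-5) j by simp
  also have "\<dots> = h" by (simp add: ie x(5) n(8))
  finally show "\<exists>u \<in> Hom C (Cod C e) Y. u \<odot> e = h"
    using i(1-3) x(4) m n(1-5) by (intro bexI[of _ "(q \<odot> m) \<odot> i"]) simp_all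
qed (use kernelD[OF assms(2)] in simp_all)

text \<open>Replace \<open>f\<close> by the regular epimorphism \<open>e\<close> of its image
  factorization: the remaining factor is monic, so the kernel is unchanged.\<close>

lemma normal_mono_cokernel:
  assumes "normal_mono C j"
  obtains e where "regular_epi C e" "is_kernel C j e" "is_cokernel C e j"
proof -
  obtain f where j: "is_kernel C j f" using assms by (auto simp: normal_mono_def)
  note jD = kernelD[OF j]
  have "f \<in> Hom C (Dom C f) (Cod C f)" using jD by simp
  then obtain e m where e: "regular_epi C e" "monic C m" "e \<in> Hom C (Dom C f) (Dom C m)" "Cod C m = Cod C f"
    "m \<odot> e = f" by (rule image_factorization)
  have m: "m \<in> Mor C" using e(2) by simp
  have *: "e \<odot> h = zero_mor C X (Cod C e)" if "h \<in> Hom C X (Dom C f)" "f \<odot> h = zero_mor C X (Cod C f)" for h X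
  proof -
    have "m \<odot> (e \<odot> h) = zero_mor C X (Cod C m)" using that e(3,4) m by (simp add: assoc_eq[OF e(5)])
    then have "e \<odot> h = zero_mor C X (Dom C m)"
      by (intro monic_zero_cancel[OF e(2)]) (use that(1) e(3) in simp_all)
    then show ?thesis using e(3) by simp
  qed
  have "is_kernel C j e"
  proof (rule kernelI)
    fix X h assume h: "X \<in> Obj C" "h \<in> Hom C X (Dom C e)" "e \<odot> h = zero_mor C X (Cod C e)"
    have "m \<odot> (e \<odot> h) = f \<odot> h" using h(2) e(3) m by (simp add: assoc_eq[OF e(5)])
    then have "f \<odot> h = zero_mor C X (Cod C f)" "h \<in> Hom C X (Dom C f)" using h e(3,4) m by simp_all
    then show "\<exists>u \<in> Hom C X (Dom C j). j \<odot> u = h" using kernel_lift[OF j] by blast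
  qed (use jD e(3) * kernel_monic[OF j] in simp_all)
  then show ?thesis using that e(1) regular_epi_cokernel by blast
qed

text \<open>Non-split short five lemma for a monomorphism over a regular epimorphism: pulling back along
  the regular epimorphism splits both sides.\<close>

lemma monic_containing_kernel_iso:
  assumes "monic C m" "p \<in> Mor C" "Dom C p = Cod C m" "x \<in> Mor C" "Cod C x = Dom C m"
    "regular_epi C (p \<odot> (m \<odot> x))" "is_kernel C l p" "l' \<in> Hom C (Dom C l) (Dom C m)" "m \<odot> l' = l"
  shows "iso C m"
proof -
  let ?q = "p \<odot> (m \<odot> x)" and ?A = "Dom C x" and ?L = "Dom C l"
  have m: "m \<in> Mor C" using assms(1) by simp
  note l = kernelD[OF assms(7)]
  have q: "?q \<in> Mor C" "Dom C ?q = ?A" "Cod C ?q = Cod C p" using m assms(2-5) by simp_all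
  \<comment> \<open>As \<open>m\<close> contains the kernel of \<open>p\<close>, the morphisms
    \<open>p\<close> and \<open>p \<odot> m\<close> share their kernel object.\<close>
  have l': "is_kernel C l' (p \<odot> m)"
  proof (rule kernelI)
    have "monic C (m \<odot> l')" using kernel_monic[OF assms(7)] assms(9) by simp
    then show "monic C l'" by (rule monic_cancel) (use assms(8) m in simp_all)
    show "(p \<odot> m) \<odot> l' = zero_mor C (Dom C l') (Cod C (p \<odot> m))"
      using assms(2,3,8) m l by (simp add: assms(9))
    fix X h assume h: "X \<in> Obj C" "h \<in> Hom C X (Dom C (p \<odot> m))" "(p \<odot> m) \<odot> h = zero_mor C X (Cod C (p \<odot> m))"
    then have "p \<odot> (m \<odot> h) = zero_mor C X (Cod C p)" "m \<odot> h \<in> Hom C X (Dom C p)"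
      using m assms(2,3) by simp_all
    then obtain u where u: "u \<in> Hom C X ?L" "l \<odot> u = m \<odot> h" using kernel_lift[OF assms(7)] by blast
    have "l' \<odot> u = h"
      by (rule monicD[OF assms(1), where X = X])
        (use u h(2) m assms(2,3,8) in \<open>simp_all add: assoc_eq[OF assms(9)]\<close>)
    then show "\<exists>u \<in> Hom C X (Dom C l'). l' \<odot> u = h"
      using u(1) assms(8) by (intro bexI[of _ u]) simp_all
  qed (use m assms(2,3,8) in simp_all)
  \<comment> \<open>The pullbacks of \<open>p\<close> and of \<open>p \<odot> m\<close> along the
    regular epimorphism are split over the domain of \<open>x\<close>, by the maps with components
    \<open>1\<close>, \<open>m \<odot> x\<close> and \<open>1\<close>, \<open>x\<close>. The
    comparison \<open>v\<close> will be the identity on kernels and on the base.\<close>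
  obtain b a where X: "is_pullback C b a ?q p" using ex_pullback[of ?q p] q assms(2) by auto
  obtain b' a' where Y: "is_pullback C b' a' ?q (p \<odot> m)"
    using ex_pullback[of ?q "p \<odot> m"] q m assms(2,3) by auto
  note XD = pullbackD[OF X] and YD = pullbackD[OF Y]
  have a: "b \<in> Hom C (Dom C b) ?A" "a \<in> Hom C (Dom C b) (Cod C m)"
    "b' \<in> Hom C (Dom C b') ?A" "a' \<in> Hom C (Dom C b') (Dom C m)"
    using XD YD q(2) assms(2,3) m by simp_all
  have "b' \<in> Hom C (Dom C b') (Dom C ?q)" "m \<odot> a' \<in> Hom C (Dom C b') (Dom C p)"
    "?q \<odot> b' = p \<odot> (m \<odot> a')" using YD(9) a q(2) assms(2,3) m by simp_all
  then obtain v where v: "v \<in> Hom C (Dom C b') (Dom C b)" "b \<odot> v = b'" "a \<odot> v = m \<odot> a'"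
    using pullback_lift[OF X] by blast
  have oA: "?A \<in> Obj C" using assms(4) by simp
  have "Idn C ?A \<in> Hom C ?A (Dom C ?q)" "m \<odot> x \<in> Hom C ?A (Dom C p)" "x \<in> Hom C ?A (Dom C (p \<odot> m))"
    "?q \<odot> Idn C ?A = p \<odot> (m \<odot> x)" "?q \<odot> Idn C ?A = (p \<odot> m) \<odot> x"
    using q assms(2-5) m oA by simp_all
  then obtain s s' where s: "s \<in> Hom C ?A (Dom C b)" "b \<odot> s = Idn C ?A" "a \<odot> s = m \<odot> x"
    and s': "s' \<in> Hom C ?A (Dom C b')" "b' \<odot> s' = Idn C ?A" "a' \<odot> s' = x"
    using pullback_lift[OF X] pullback_lift[OF Y] by metis
  obtain k where k: "is_kernel C k b" "k \<in> Hom C ?L (Dom C b)" "a \<odot> k = l"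
    using pullback_kernel[OF X assms(7)] .
  obtain k' where k': "is_kernel C k' b'" "k' \<in> Hom C (Dom C l') (Dom C b')" "a' \<odot> k' = l'"
    using pullback_kernel[OF Y l'] .
  have dl': "Dom C l' = ?L" using assms(8) by simp
  have oL: "?L \<in> Obj C" using l by simp
  have bk: "b \<odot> k = zero_mor C ?L ?A" "b' \<odot> k' = zero_mor C ?L ?A"
    using kernelD(4)[OF k(1)] kernelD(4)[OF k'(1)] k(2) k'(2) a dl' by simp_all
  have vk: "v \<odot> k' = k"
    by (rule pullback_unique[OF X, where X = ?L])
      (use v(1) k(2) k'(2) bk a dl' m assms(9) k(3) k'(3) in
        \<open>simp_all add: assoc_eq[OF v(2)] assoc_eq[OF v(3)]\<close>)
  have vs: "v \<odot> s' = s"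
    by (rule pullback_unique[OF X, where X = ?A])
      (use v(1) s s' a m in \<open>simp_all add: assoc_eq[OF v(2)] assoc_eq[OF v(3)]\<close>)
  have "iso C v"
  proof (rule split_short_five[OF k'(1) _ k(1)])
    show "section_of C s' b'" "section_of C s b" using s s' a by (simp_all add: section_of_def)
    show "iso C (Idn C ?L)" "iso C (Idn C ?A)" using iso_Idn oL oA by simp_all
    show "Idn C ?L \<in> Hom C (Dom C k') (Dom C k)" using k(2) k'(2) dl' oL by simp
    show "v \<odot> k' = k \<odot> Idn C ?L" "v \<odot> s' = s \<odot> Idn C ?A" using vk vs k(2) s(1) by simp_all
  qed (use v a oA in simp_all)
  then obtain w where w: "w \<in> Mor C" "Dom C w = Cod C v" "Cod C w = Dom C v" "v \<odot> w = Idn C (Cod C v)"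
    by (rule isoE)
  \<comment> \<open>Invertibility of \<open>v\<close> makes \<open>a\<close> factor through
    \<open>m\<close>; being a pullback of a regular epimorphism, \<open>a\<close> is regular epic,
    so \<open>m\<close> is invertible.\<close>
  have "m \<odot> (a' \<odot> w) = (a \<odot> v) \<odot> w" using w(1-3) v(1) a m by (simp add: v(3))
  also have "\<dots> = a" using w v(1) a by simp
  finally have ma: "m \<odot> (a' \<odot> w) = a" .
  have "regular_epi C a" by (rule regular_epi_pullback[OF X assms(6)])
  then have "regular_epi C (m \<odot> (a' \<odot> w))" using ma by simp
  then show ?thesis by (rule monic_regular_factor_iso[OF _ assms(1)]) (use w(1-3) v(1) a in simp_all)
qed

text \<open>It suffices that the comparison \<open>w\<close>, with components \<open>q\<close> and
  \<open>f\<close>, from \<open>Dom C f\<close> to the pullback of \<open>\<phi>\<close> and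
  \<open>p\<close> is regular epic, since \<open>r\<close> is a pullback of \<open>w\<close>. The
  image of \<open>w\<close> lies over the regular epimorphism \<open>q\<close>, so it is everything
  as soon as it contains the kernel of the projection \<open>a\<close>.\<close>

lemma split_epi_kernel_restriction_regular:
  assumes "section_of C s f" "section_of C \<sigma> \<phi>"
    "regular_epi C q" "q \<in> Hom C (Dom C f) (Dom C \<phi>)" "p \<in> Hom C (Cod C f) (Cod C \<phi>)"
    "\<phi> \<odot> q = p \<odot> f" "q \<odot> s = \<sigma> \<odot> p"
    "is_kernel C k f" "is_kernel C n \<phi>" "r \<in> Hom C (Dom C k) (Dom C n)" "n \<odot> r = q \<odot> k"
  shows "regular_epi C r"
proof -
  let ?A = "Dom C f" and ?B = "Cod C f" and ?Q = "Dom C \<phi>"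
  have s: "f \<in> Mor C" "s \<in> Hom C ?B ?A" "f \<odot> s = Idn C ?B" "\<phi> \<in> Mor C" "\<sigma> \<in> Hom C (Cod C \<phi>) ?Q"
    using assms(1,2) by (auto simp: section_of_def)
  note k = kernelD[OF assms(8)] and n = kernelD[OF assms(9)]
  obtain a b where P: "is_pullback C a b \<phi> p" using ex_pullback[of \<phi> p] assms(5) s by auto
  note PD = pullbackD[OF P]
  let ?P = "Dom C a"
  have ab: "a \<in> Hom C ?P ?Q" "b \<in> Hom C ?P ?B" using PD assms(5) by simp_all
  have "f \<in> Hom C ?A (Dom C p)" using s assms(5) by simp
  then obtain w where w: "w \<in> Hom C ?A ?P" "a \<odot> w = q" "b \<odot> w = f"
    using pullback_lift[OF P assms(4) _ assms(6)] by blast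
  obtain e m where e: "regular_epi C e" "monic C m" "e \<in> Hom C ?A (Dom C m)" "Cod C m = ?P" "m \<odot> e = w"
    using image_factorization[OF w(1)] .
  have m: "m \<in> Mor C" using e(2) by simp
  have "a \<in> Mor C" using ab by simp
  then obtain l where l: "is_kernel C l a" by (rule ex_kernel)
  note lD = kernelD[OF l]
  let ?L = "Dom C l"
  have lP: "l \<in> Hom C ?L ?P" "?L \<in> Obj C" using lD by simp_all
  have "p \<odot> (b \<odot> l) = zero_mor C ?L (Cod C \<phi>)"
    using lD ab assms(5) s(4) by (simp add: assoc_eq[OF PD(9)[symmetric]])
  then have qs: "q \<odot> (s \<odot> (b \<odot> l)) = zero_mor C ?L ?Q"
    using s assms(4,5) ab lP by (simp add: assoc_eq[OF assms(7)])
  \<comment> \<open>The splitting enters here. The kernel of \<open>a\<close> has components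
    \<open>0\<close> and \<open>b \<odot> l\<close>, with \<open>p \<odot> (b \<odot> l)\<close>
    zero; applying \<open>s\<close> gives a preimage under \<open>w\<close>, because
    \<open>q \<odot> s = \<sigma> \<odot> p\<close>.\<close>
  have "w \<odot> (s \<odot> (b \<odot> l)) = l"
    by (rule pullback_unique[OF P, where X = ?L])
      (use w(1) s(1,2) ab lP lD(4) qs in
        \<open>simp_all add: assoc_eq[OF w(2)] assoc_eq[OF w(3)] assoc_eq[OF s(3)]\<close>)
  then have ml: "m \<odot> (e \<odot> (s \<odot> (b \<odot> l))) = l"
    using s(2) e(3) ab lP m by (simp add: assoc_eq[OF e(5)])
  have "iso C m"
  proof (rule monic_containing_kernel_iso[OF e(2) _ _ _ _ _ l _ ml])
    show "regular_epi C (a \<odot> (m \<odot> e))" using e(5) w(2) assms(3) by simp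
  qed (use s(2) e(3,4) ab lP m in simp_all)
  then have rw: "regular_epi C w" using iso_regular_epi[OF e(1), of m] e(3,5) by simp
  have nr: "n \<in> Hom C (Dom C n) ?Q" "zero_mor C (Dom C n) ?B \<in> Hom C (Dom C n) (Dom C p)"
    "\<phi> \<odot> n = p \<odot> zero_mor C (Dom C n) ?B" using n s(1) assms(5) by simp_all
  obtain n' where n': "n' \<in> Hom C (Dom C n) ?P" "a \<odot> n' = n" "b \<odot> n' = zero_mor C (Dom C n) ?B"
    using pullback_lift[OF P nr] .
  have mn': "monic C n'"
    by (rule monic_cancel[of a]) (use n' ab kernel_monic[OF assms(9)] in simp_all)
  have wk: "w \<odot> k = n' \<odot> r"
    by (rule pullback_unique[OF P, where X = "Dom C k"])
      (use w(1) n'(1) ab k s(1) assms(10) in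
        \<open>simp_all add: assoc_eq[OF w(2)] assoc_eq[OF w(3)] assoc_eq[OF n'(2)] assoc_eq[OF n'(3)] assms(11)\<close>)
  \<comment> \<open>\<open>n'\<close> has components \<open>n\<close> and \<open>0\<close>. An
    element of \<open>Dom C f\<close> that \<open>w\<close> sends into it is therefore killed by
    \<open>f\<close> and comes from \<open>k\<close>.\<close>
  have "is_pullback C k r w n'"
  proof (rule pullbackI_monic)
    fix X c d assume c: "X \<in> Obj C" "c \<in> Hom C X (Dom C w)" "d \<in> Hom C X (Dom C n')" "w \<odot> c = n' \<odot> d"
    have cd: "c \<in> Hom C X ?A" "d \<in> Hom C X (Dom C n)" using c w(1) n'(1) by simp_all
    have "b \<odot> (w \<odot> c) = b \<odot> (n' \<odot> d)" using c(4) by simp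
    then have "f \<odot> c = zero_mor C X ?B"
      using cd w(1) n'(1) ab s(1) by (simp add: assoc_eq[OF w(3)] assoc_eq[OF n'(3)])
    then obtain u where u: "u \<in> Hom C X (Dom C k)" "k \<odot> u = c"
      using kernel_lift[OF assms(8) cd(1)] by blast
    have "n' \<odot> (r \<odot> u) = n' \<odot> d"
      using u(1) n'(1) assms(10) k w(1) by (simp add: assoc_eq[OF wk[symmetric]] u(2) c(4))
    then have "r \<odot> u = d"
      by (rule monicD[OF mn', where X = X]) (use u(1) n'(1) assms(10) cd in simp_all)
    then show "\<exists>h \<in> Hom C X (Dom C k). k \<odot> h = c \<and> r \<odot> h = d" using u by blast
  qed (use w(1) n'(1) k assms(10) wk kernel_monic[OF assms(8)] in simp_all)
  then show ?thesis using regular_epi_pullback rw by blast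
qed

end

section \<open>The arrow category\<close>

lemma arrow_cat_simps [simp]:
  "Obj (arrow_cat C) = Mor C"
  "(f, g, u, v) \<in> Mor (arrow_cat C) \<longleftrightarrow> f \<in> Mor C \<and> g \<in> Mor C \<and>
     u \<in> Hom C (Dom C f) (Dom C g) \<and> v \<in> Hom C (Cod C f) (Cod C g) \<and> v \<odot>\<^bsub>C\<^esub> f = g \<odot>\<^bsub>C\<^esub> u"
  "Dom (arrow_cat C) (f, g, u, v) = f"
  "Cod (arrow_cat C) (f, g, u, v) = g"
  "Idn (arrow_cat C) f = (f, f, Idn C (Dom C f), Idn C (Cod C f))"
  "(g', h, u', v') \<odot>\<^bsub>arrow_cat C\<^esub> (f, g, u, v) = (f, h, u' \<odot>\<^bsub>C\<^esub> u, v' \<odot>\<^bsub>C\<^esub> v)"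
  by (auto simp: arrow_cat_def simp del: in_Hom)

lemma arrow_HomE:
  assumes "x \<in> Hom (arrow_cat C) f g"
  obtains u v where "x = (f, g, u, v)" "f \<in> Mor C" "g \<in> Mor C" "u \<in> Hom C (Dom C f) (Dom C g)"
    "v \<in> Hom C (Cod C f) (Cod C g)" "v \<odot>\<^bsub>C\<^esub> f = g \<odot>\<^bsub>C\<^esub> u"
  using assms that by (cases x) simp

lemma (in category) arrow_compose:
  assumes "(f, g, u, v) \<in> Mor (arrow_cat C)" "(g, h, u', v') \<in> Mor (arrow_cat C)"
  shows "(f, h, u' \<odot> u, v' \<odot> v) \<in> Mor (arrow_cat C)"
proof -
  have a: "f \<in> Mor C" "g \<in> Mor C" "u \<in> Hom C (Dom C f) (Dom C g)" "v \<in> Hom C (Cod C f) (Cod C g)"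
    "v \<odot> f = g \<odot> u" using assms(1) by simp_all
  have b: "h \<in> Mor C" "u' \<in> Hom C (Dom C g) (Dom C h)" "v' \<in> Hom C (Cod C g) (Cod C h)"
    "v' \<odot> g = h \<odot> u'" using assms(2) by simp_all
  show ?thesis using a(1-4) b(1-3) by (simp add: a(5) assoc_eq[OF b(4)])
qed

lemma (in category) category_arrow_cat: "category (arrow_cat C)"
proof
  fix x assume "x \<in> Mor (arrow_cat C)"
  then show "Dom (arrow_cat C) x \<in> Obj (arrow_cat C)" "Cod (arrow_cat C) x \<in> Obj (arrow_cat C)"
    by (cases x, simp)+
next
  fix f assume "f \<in> Obj (arrow_cat C)"
  then show "Idn (arrow_cat C) f \<in> Hom (arrow_cat C) f f" by simp
next
  fix x y f g h assume x: "x \<in> Hom (arrow_cat C) f g" and y: "y \<in> Hom (arrow_cat C) g h"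
  obtain u v where x': "x = (f, g, u, v)" using x by (rule arrow_HomE)
  obtain u' v' where y': "y = (g, h, u', v')" using y by (rule arrow_HomE)
  have "(f, g, u, v) \<in> Mor (arrow_cat C)" "(g, h, u', v') \<in> Mor (arrow_cat C)"
    using x y unfolding x' y' in_Hom by simp_all
  then have "(f, h, u' \<odot> u, v' \<odot> v) \<in> Mor (arrow_cat C)" by (rule arrow_compose)
  then show "y \<odot>\<^bsub>arrow_cat C\<^esub> x \<in> Hom (arrow_cat C) f h"
    unfolding x' y' in_Hom arrow_cat_simps(3,4,6) by simp
next
  fix x f g assume "x \<in> Hom (arrow_cat C) f g"
  then obtain u v where "x = (f, g, u, v)" "u \<in> Hom C (Dom C f) (Dom C g)" "v \<in> Hom C (Cod C f) (Cod C g)"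
    by (rule arrow_HomE)
  then show "x \<odot>\<^bsub>arrow_cat C\<^esub> Idn (arrow_cat C) f = x" "Idn (arrow_cat C) g \<odot>\<^bsub>arrow_cat C\<^esub> x = x"
    by simp_all
next
  fix x y z f g h i
  assume x: "x \<in> Hom (arrow_cat C) f g" and y: "y \<in> Hom (arrow_cat C) g h"
    and z: "z \<in> Hom (arrow_cat C) h i"
  from x obtain u v where x': "x = (f, g, u, v)" "u \<in> Hom C (Dom C f) (Dom C g)" "v \<in> Hom C (Cod C f) (Cod C g)"
    by (rule arrow_HomE)
  from y obtain u' v' where y': "y = (g, h, u', v')" "u' \<in> Hom C (Dom C g) (Dom C h)" "v' \<in> Hom C (Cod C g) (Cod C h)"
    by (rule arrow_HomE)
  from z obtain u'' v'' where z': "z = (h, i, u'', v'')" "u'' \<in> Hom C (Dom C h) (Dom C i)" "v'' \<in> Hom C (Cod C h) (Cod C i)"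
    by (rule arrow_HomE)
  show "(z \<odot>\<^bsub>arrow_cat C\<^esub> y) \<odot>\<^bsub>arrow_cat C\<^esub> x = z \<odot>\<^bsub>arrow_cat C\<^esub> (y \<odot>\<^bsub>arrow_cat C\<^esub> x)"
    using x'(2,3) y'(2,3) z'(2,3) unfolding x'(1) y'(1) z'(1) by simp
qed

section \<open>Zero objects, kernels and cokernels of arrows, computed componentwise\<close>

context pointed_category
begin

lemma zero_object_arrow_cat:
  assumes "zero_object C Z" shows "zero_object (arrow_cat C) (Idn C Z)"
proof -
  have o: "Z \<in> Obj C" using zero_objectD(1)[OF assms] .
  note z = to_zero_object[OF assms] from_zero_object[OF assms]
  have "\<exists>!x. x \<in> Hom (arrow_cat C) f (Idn C Z)" if f: "f \<in> Mor C" for f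
  proof (rule ex1I[of _ "(f, Idn C Z, zero_mor C (Dom C f) Z, zero_mor C (Cod C f) Z)"])
    fix x assume "x \<in> Hom (arrow_cat C) f (Idn C Z)"
    then obtain u v where x: "x = (f, Idn C Z, u, v)" "u \<in> Hom C (Dom C f) (Dom C (Idn C Z))"
      "v \<in> Hom C (Cod C f) (Cod C (Idn C Z))" by (rule arrow_HomE)
    show "x = (f, Idn C Z, zero_mor C (Dom C f) Z, zero_mor C (Cod C f) Z)"
      using x(2,3) o z(1)[of u "Dom C f"] z(1)[of v "Cod C f"] unfolding x(1) by simp
  qed (use f o in simp)
  moreover have "\<exists>!x. x \<in> Hom (arrow_cat C) (Idn C Z) f" if f: "f \<in> Mor C" for f
  proof (rule ex1I[of _ "(Idn C Z, f, zero_mor C Z (Dom C f), zero_mor C Z (Cod C f))"])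
    fix x assume "x \<in> Hom (arrow_cat C) (Idn C Z) f"
    then obtain u v where x: "x = (Idn C Z, f, u, v)" "u \<in> Hom C (Dom C (Idn C Z)) (Dom C f)"
      "v \<in> Hom C (Cod C (Idn C Z)) (Cod C f)" by (rule arrow_HomE)
    show "x = (Idn C Z, f, zero_mor C Z (Dom C f), zero_mor C Z (Cod C f))"
      using x(2,3) o z(2)[of u "Dom C f"] z(2)[of v "Cod C f"] unfolding x(1) by simp
  qed (use f o in simp)
  moreover have "Idn C Z \<in> Mor C" using o by simp
  ultimately show ?thesis unfolding zero_object_def initial_def terminal_def arrow_cat_simps(1) by blast
qed

lemma pointed_arrow_cat: "pointed_category (arrow_cat C)"
  unfolding pointed_category_def pointed_category_axioms_def
  using category_arrow_cat zero_object_arrow_cat ex_zero_object by blast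

interpretation Arr: pointed_category "arrow_cat C" by (rule pointed_arrow_cat)

lemma zero_mor_arrow_cat [simp]:
  assumes "f \<in> Mor C" "g \<in> Mor C"
  shows "zero_mor (arrow_cat C) f g =
    (f, g, zero_mor C (Dom C f) (Dom C g), zero_mor C (Cod C f) (Cod C g))"
proof -
  obtain Z where Z: "zero_object C Z" using ex_zero_object by blast
  have o: "Z \<in> Obj C" using zero_objectD(1)[OF Z] .
  have "(f, Idn C Z, zero_mor C (Dom C f) Z, zero_mor C (Cod C f) Z) \<in> Hom (arrow_cat C) f (Idn C Z)"
    "(Idn C Z, g, zero_mor C Z (Dom C g), zero_mor C Z (Cod C g)) \<in> Hom (arrow_cat C) (Idn C Z) g"
    using assms o by simp_all
  from Arr.zero_through_zero_object[OF zero_object_arrow_cat[OF Z] this]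
  show ?thesis using assms o by simp
qed

text \<open>The two components of a lift are found separately; they form a commutative square
  because this can be tested after the monomorphism \<open>k'\<close>.\<close>

lemma arrow_kernelI:
  assumes "is_kernel C k f" "is_kernel C k' f'"
    and K: "(a, b, k, k') \<in> Mor (arrow_cat C)" and F: "(b, c, f, f') \<in> Mor (arrow_cat C)"
  shows "is_kernel (arrow_cat C) (a, b, k, k') (b, c, f, f')"
proof (rule Arr.kernelI)
  note k = kernelD[OF assms(1)] kernelD[OF assms(2)]
  have K': "a \<in> Mor C" "b \<in> Mor C" "k \<in> Hom C (Dom C a) (Dom C b)" "k' \<in> Hom C (Cod C a) (Cod C b)"
    "k' \<odot> a = b \<odot> k" using K by simp_all
  have F': "c \<in> Mor C" "f \<in> Hom C (Dom C b) (Dom C c)" "f' \<in> Hom C (Cod C b) (Cod C c)"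
    using F by simp_all
  show "monic (arrow_cat C) (a, b, k, k')" unfolding monic_def
  proof (intro conjI allI ballI impI K)
    fix x p q assume "p \<in> Hom (arrow_cat C) x (Dom (arrow_cat C) (a, b, k, k'))"
      "q \<in> Hom (arrow_cat C) x (Dom (arrow_cat C) (a, b, k, k'))"
      and eq: "(a, b, k, k') \<odot>\<^bsub>arrow_cat C\<^esub> p = (a, b, k, k') \<odot>\<^bsub>arrow_cat C\<^esub> q"
    then have pq: "p \<in> Hom (arrow_cat C) x a" "q \<in> Hom (arrow_cat C) x a" by simp_all
    obtain u v where p: "p = (x, a, u, v)" "u \<in> Hom C (Dom C x) (Dom C a)" "v \<in> Hom C (Cod C x) (Cod C a)"
      using pq(1) by (rule arrow_HomE)
    obtain u' v' where q: "q = (x, a, u', v')" "u' \<in> Hom C (Dom C x) (Dom C a)" "v' \<in> Hom C (Cod C x) (Cod C a)"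
      using pq(2) by (rule arrow_HomE)
    have "k \<odot> u = k \<odot> u'" "k' \<odot> v = k' \<odot> v'" using eq p(1) q(1) by simp_all
    then have "u = u'" "v = v'"
      using monicD[OF kernel_monic[OF assms(1)], of u u' "Dom C x"]
        monicD[OF kernel_monic[OF assms(2)], of v v' "Cod C x"] p(2,3) q(2,3) K' by simp_all
    then show "p = q" using p(1) q(1) by simp
  qed
  show "(b, c, f, f') \<odot>\<^bsub>arrow_cat C\<^esub> (a, b, k, k') = zero_mor (arrow_cat C)
     (Dom (arrow_cat C) (a, b, k, k')) (Cod (arrow_cat C) (b, c, f, f'))"
    using k K'(1-4) F' by simp
  fix x h assume "h \<in> Hom (arrow_cat C) x (Dom (arrow_cat C) (b, c, f, f'))"
    and z: "(b, c, f, f') \<odot>\<^bsub>arrow_cat C\<^esub> h = zero_mor (arrow_cat C) x (Cod (arrow_cat C) (b, c, f, f'))"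
  then have "h \<in> Hom (arrow_cat C) x b" by simp
  then obtain u v where h: "h = (x, b, u, v)" "x \<in> Mor C" "u \<in> Hom C (Dom C x) (Dom C b)"
    "v \<in> Hom C (Cod C x) (Cod C b)" "v \<odot> x = b \<odot> u" by (rule arrow_HomE)
  have uv: "u \<in> Hom C (Dom C x) (Dom C f)" "v \<in> Hom C (Cod C x) (Dom C f')"
    "f \<odot> u = zero_mor C (Dom C x) (Cod C f)" "f' \<odot> v = zero_mor C (Cod C x) (Cod C f')"
    using h(2-4) F' z unfolding h(1) by simp_all
  obtain u' where u': "u' \<in> Hom C (Dom C x) (Dom C k)" "k \<odot> u' = u"
    using kernel_lift[OF assms(1) uv(1,3)] .
  obtain v' where v': "v' \<in> Hom C (Cod C x) (Dom C k')" "k' \<odot> v' = v"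
    using kernel_lift[OF assms(2) uv(2,4)] .
  have 1: "k' \<odot> (v' \<odot> x) = v \<odot> x" using v'(1) h(2) K' by (simp add: assoc_eq[OF v'(2)])
  have 2: "k' \<odot> (a \<odot> u') = b \<odot> u" using u'(1) K'(1-4) by (simp add: assoc_eq[OF K'(5)] u'(2))
  have "v' \<odot> x = a \<odot> u'"
    by (rule monicD[OF kernel_monic[OF assms(2)], where X = "Dom C x"])
      (use 1 2 h(5) v'(1) u'(1) h(2) K' in simp_all)
  then show "\<exists>w \<in> Hom (arrow_cat C) x (Dom (arrow_cat C) (a, b, k, k')). (a, b, k, k') \<odot>\<^bsub>arrow_cat C\<^esub> w = h"
    using u' v' h(1,2) K' by (intro bexI[of _ "(x, a, u', v')"]) simp_all
qed (use F in simp_all)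

text \<open>Two families of test arrows isolate the components. A morphism from the identity of
  \<open>X\<close> to \<open>a\<close> amounts to a map from \<open>X\<close> to the domain of
  \<open>a\<close>, and a morphism from \<open>zero_mor C Z X\<close>, with \<open>Z\<close> a zero
  object, amounts to a map from \<open>X\<close> to its codomain.\<close>

lemma arrow_kernelD:
  assumes "is_kernel (arrow_cat C) (a, b, k, k') (b, c, f, f')"
  shows "is_kernel C k f" "is_kernel C k' f'"
proof -
  note K = Arr.kernelD[OF assms]
  have K': "a \<in> Mor C" "b \<in> Mor C" "k \<in> Hom C (Dom C a) (Dom C b)" "k' \<in> Hom C (Cod C a) (Cod C b)"
    "k' \<odot> a = b \<odot> k" using K(1) by simp_all
  have F': "c \<in> Mor C" "f \<in> Hom C (Dom C b) (Dom C c)" "f' \<in> Hom C (Cod C b) (Cod C c)"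
    "f' \<odot> b = c \<odot> f" using K(2) by simp_all
  have z: "f \<odot> k = zero_mor C (Dom C a) (Dom C c)" "f' \<odot> k' = zero_mor C (Cod C a) (Cod C c)"
    using K(4) K'(1) F'(1) by simp_all
  note m = monicD[OF Arr.kernel_monic[OF assms]]
  show "is_kernel C k f"
  proof (rule kernelI)
    show "monic C k" unfolding monic_def
    proof (intro conjI allI ballI impI)
      fix X u v assume uv: "u \<in> Hom C X (Dom C k)" "v \<in> Hom C X (Dom C k)" "k \<odot> u = k \<odot> v"
      have X: "X \<in> Obj C" using uv(1) by auto
      have e: "k' \<odot> (a \<odot> u) = k' \<odot> (a \<odot> v)"
        using uv K'(1-4) by (simp add: assoc_eq[OF K'(5)])
      have "(Idn C X, a, u, a \<odot> u) = (Idn C X, a, v, a \<odot> v)"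
        by (rule m[where X = "Idn C X"]) (use uv X K'(1-4) e in simp_all)
      then show "u = v" by simp
    qed (use K' in simp)
    fix X h assume h: "X \<in> Obj C" "h \<in> Hom C X (Dom C f)" "f \<odot> h = zero_mor C X (Cod C f)"
    have bh: "f' \<odot> (b \<odot> h) = zero_mor C X (Cod C c)"
      using h F'(1-3) K'(2) by (simp add: assoc_eq[OF F'(4)])
    have *: "(Idn C X, b, h, b \<odot> h) \<in> Hom (arrow_cat C) (Idn C X) (Dom (arrow_cat C) (b, c, f, f'))"
      "(b, c, f, f') \<odot>\<^bsub>arrow_cat C\<^esub> (Idn C X, b, h, b \<odot> h) =
        zero_mor (arrow_cat C) (Idn C X) (Cod (arrow_cat C) (b, c, f, f'))"
      using h bh F'(1-3) K'(2) by simp_all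
    obtain w where w: "w \<in> Hom (arrow_cat C) (Idn C X) (Dom (arrow_cat C) (a, b, k, k'))"
      "(a, b, k, k') \<odot>\<^bsub>arrow_cat C\<^esub> w = (Idn C X, b, h, b \<odot> h)"
      using Arr.kernel_lift[OF assms *] .
    from w(1) obtain u v where "w = (Idn C X, a, u, v)" "u \<in> Hom C (Dom C (Idn C X)) (Dom C a)"
      unfolding arrow_cat_simps by (rule arrow_HomE)
    then show "\<exists>u \<in> Hom C X (Dom C k). k \<odot> u = h"
      using w(2) h(1) K'(3) by (intro bexI[of _ u]) simp_all
  qed (use K' F' z in simp_all)
  obtain Z where Z: "zero_object C Z" using ex_zero_object by blast
  have o: "Z \<in> Obj C" using zero_objectD(1)[OF Z] .
  show "is_kernel C k' f'"
  proof (rule kernelI)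
    show "monic C k'" unfolding monic_def
    proof (intro conjI allI ballI impI)
      fix X u v assume uv: "u \<in> Hom C X (Dom C k')" "v \<in> Hom C X (Dom C k')" "k' \<odot> u = k' \<odot> v"
      have X: "X \<in> Obj C" using uv(1) by auto
      have "(zero_mor C Z X, a, zero_mor C Z (Dom C a), u) = (zero_mor C Z X, a, zero_mor C Z (Dom C a), v)"
        by (rule m[where X = "zero_mor C Z X"]) (use uv X K'(1-4) o in simp_all)
      then show "u = v" by simp
    qed (use K' in simp)
    fix X h assume h: "X \<in> Obj C" "h \<in> Hom C X (Dom C f')" "f' \<odot> h = zero_mor C X (Cod C f')"
    let ?h = "(zero_mor C Z X, b, zero_mor C Z (Dom C b), h)"
    have *: "?h \<in> Hom (arrow_cat C) (zero_mor C Z X) (Dom (arrow_cat C) (b, c, f, f'))"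
      "(b, c, f, f') \<odot>\<^bsub>arrow_cat C\<^esub> ?h =
        zero_mor (arrow_cat C) (zero_mor C Z X) (Cod (arrow_cat C) (b, c, f, f'))"
      using h F'(1-3) K'(2) o by simp_all
    obtain w where w: "w \<in> Hom (arrow_cat C) (zero_mor C Z X) (Dom (arrow_cat C) (a, b, k, k'))"
      "(a, b, k, k') \<odot>\<^bsub>arrow_cat C\<^esub> w = ?h"
      using Arr.kernel_lift[OF assms *] .
    from w(1) obtain u v where "w = (zero_mor C Z X, a, u, v)" "v \<in> Hom C (Cod C (zero_mor C Z X)) (Cod C a)"
      unfolding arrow_cat_simps by (rule arrow_HomE)
    then show "\<exists>u \<in> Hom C X (Dom C k'). k' \<odot> u = h"
      using w(2) h(1) K'(4) o by (intro bexI[of _ v]) simp_all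
  qed (use K' F' z in simp_all)
qed

text \<open>As for kernels, except that commutativity of the induced square is tested before the
  epimorphism \<open>q\<close> of the domain component.\<close>

lemma arrow_cokernelI:
  assumes "is_cokernel C q k" "is_cokernel C q' k'"
    and K: "(a, b, k, k') \<in> Mor (arrow_cat C)" and Q: "(b, c, q, q') \<in> Mor (arrow_cat C)"
  shows "is_cokernel (arrow_cat C) (b, c, q, q') (a, b, k, k')"
proof (rule Arr.cokernelI)
  note q = cokernelD[OF assms(1)] cokernelD[OF assms(2)]
  have K': "a \<in> Mor C" "b \<in> Mor C" "k \<in> Hom C (Dom C a) (Dom C b)" "k' \<in> Hom C (Cod C a) (Cod C b)"
    using K by simp_all
  have Q': "c \<in> Mor C" "q \<in> Hom C (Dom C b) (Dom C c)" "q' \<in> Hom C (Cod C b) (Cod C c)"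
    "q' \<odot> b = c \<odot> q"
    using Q by simp_all
  show "epic (arrow_cat C) (b, c, q, q')" unfolding epic_def
  proof (intro conjI allI ballI impI Q)
    fix x r s assume "r \<in> Hom (arrow_cat C) (Cod (arrow_cat C) (b, c, q, q')) x"
      "s \<in> Hom (arrow_cat C) (Cod (arrow_cat C) (b, c, q, q')) x"
      and eq: "r \<odot>\<^bsub>arrow_cat C\<^esub> (b, c, q, q') = s \<odot>\<^bsub>arrow_cat C\<^esub> (b, c, q, q')"
    then have rs: "r \<in> Hom (arrow_cat C) c x" "s \<in> Hom (arrow_cat C) c x" by simp_all
    obtain u v where r: "r = (c, x, u, v)" "u \<in> Hom C (Dom C c) (Dom C x)" "v \<in> Hom C (Cod C c) (Cod C x)"
      using rs(1) by (rule arrow_HomE)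
    obtain u' v' where s: "s = (c, x, u', v')" "u' \<in> Hom C (Dom C c) (Dom C x)" "v' \<in> Hom C (Cod C c) (Cod C x)"
      using rs(2) by (rule arrow_HomE)
    have "u \<odot> q = u' \<odot> q" "v \<odot> q' = v' \<odot> q'" using eq r(1) s(1) by simp_all
    then have "u = u'" "v = v'"
      using epicD[OF cokernel_epic[OF assms(1)], of u u' "Dom C x"]
        epicD[OF cokernel_epic[OF assms(2)], of v v' "Cod C x"] r(2,3) s(2,3) Q' by simp_all
    then show "r = s" using r(1) s(1) by simp
  qed
  show "(b, c, q, q') \<odot>\<^bsub>arrow_cat C\<^esub> (a, b, k, k') = zero_mor (arrow_cat C)
     (Dom (arrow_cat C) (a, b, k, k')) (Cod (arrow_cat C) (b, c, q, q'))"
    using q K' Q'(1-3) by simp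
  fix y h assume "h \<in> Hom (arrow_cat C) (Cod (arrow_cat C) (a, b, k, k')) y"
    and z: "h \<odot>\<^bsub>arrow_cat C\<^esub> (a, b, k, k') = zero_mor (arrow_cat C) (Dom (arrow_cat C) (a, b, k, k')) y"
  then have "h \<in> Hom (arrow_cat C) b y" by simp
  then obtain u v where h: "h = (b, y, u, v)" "y \<in> Mor C" "u \<in> Hom C (Dom C b) (Dom C y)"
    "v \<in> Hom C (Cod C b) (Cod C y)" "v \<odot> b = y \<odot> u" by (rule arrow_HomE)
  have uv: "u \<in> Hom C (Cod C k) (Dom C y)" "v \<in> Hom C (Cod C k') (Cod C y)"
    "u \<odot> k = zero_mor C (Dom C k) (Dom C y)" "v \<odot> k' = zero_mor C (Dom C k') (Cod C y)"
    using h(2-4) K' z unfolding h(1) by simp_all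
  obtain u' where u': "u' \<in> Hom C (Cod C q) (Dom C y)" "u' \<odot> q = u"
    using cokernel_lift[OF assms(1) uv(1,3)] .
  obtain v' where v': "v' \<in> Hom C (Cod C q') (Cod C y)" "v' \<odot> q' = v"
    using cokernel_lift[OF assms(2) uv(2,4)] .
  have 1: "(v' \<odot> c) \<odot> q = v \<odot> b"
    using v'(1) Q'(1-3) K'(2) by (simp add: Q'(4)[symmetric] assoc_eq[OF v'(2)])
  have 2: "(y \<odot> u') \<odot> q = y \<odot> u" using u'(1) Q'(1-3) h(2) by (simp add: u'(2))
  have "v' \<odot> c = y \<odot> u'"
    by (rule epicD[OF cokernel_epic[OF assms(1)], where Y = "Cod C y"])
      (use 1 2 h(5) v'(1) u'(1) h(2) Q'(1-3) in simp_all)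
  then show "\<exists>w \<in> Hom (arrow_cat C) (Cod (arrow_cat C) (b, c, q, q')) y. w \<odot>\<^bsub>arrow_cat C\<^esub> (b, c, q, q') = h"
    using u' v' h(1,2) Q' by (intro bexI[of _ "(c, y, u', v')"]) simp_all
qed (use K Q in simp_all)

lemma arrow_isoD:
  assumes "iso (arrow_cat C) (f, g, u, v)"
  shows "iso C u" "iso C v"
proof -
  obtain w where w: "(f, g, u, v) \<in> Mor (arrow_cat C)" "w \<in> Mor (arrow_cat C)"
    "Dom (arrow_cat C) w = g" "Cod (arrow_cat C) w = f"
    "w \<odot>\<^bsub>arrow_cat C\<^esub> (f, g, u, v) = Idn (arrow_cat C) f" "(f, g, u, v) \<odot>\<^bsub>arrow_cat C\<^esub> w = Idn (arrow_cat C) g"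
    using Arr.isoE[OF assms] by (metis arrow_cat_simps(3,4))
  have "w \<in> Hom (arrow_cat C) g f" using w(2-4) by simp
  then obtain u' v' where w': "w = (g, f, u', v')" "u' \<in> Hom C (Dom C g) (Dom C f)" "v' \<in> Hom C (Cod C g) (Cod C f)"
    by (rule arrow_HomE)
  have uv: "u \<in> Hom C (Dom C f) (Dom C g)" "v \<in> Hom C (Cod C f) (Cod C g)" using w(1) by simp_all
  have e: "u' \<odot> u = Idn C (Dom C f)" "v' \<odot> v = Idn C (Cod C f)" "u \<odot> u' = Idn C (Dom C g)" "v \<odot> v' = Idn C (Cod C g)"
    using w(5,6) unfolding w'(1) by simp_all
  show "iso C u" using isoI[OF uv(1) w'(2) e(1,3)] .
  show "iso C v" using isoI[OF uv(2) w'(3) e(2,4)] .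
qed

end

section \<open>The torsion theory of the arrow category\<close>

locale normal_torsion_category = homological_category C + torsion_category C \<T> \<F>
  for C :: "('o, 'm) cat" (structure) and \<T> \<F> +
  assumes condition_N: "condition_N C \<T> \<F>"
begin

abbreviation "Arr \<equiv> arrow_cat C"
abbreviation "\<T>\<^sub>1 \<equiv> arrow_torsion C \<T>"
abbreviation "\<F>\<^sub>1 \<equiv> arrow_torsion_free C \<F>"

interpretation Arr: pointed_category Arr by (rule pointed_arrow_cat)

text \<open>\<open>arrow_torsion_free\<close> refers to the chosen kernel. By repleteness any kernel
  serves, and the next lemma is the converse passage.\<close>

lemma ker_obj_torsion_free:
  assumes "is_kernel C k f" "Dom C k \<in> \<F>" shows "ker_obj C f \<in> \<F>"
proof -
  obtain u where "iso C u" "u \<in> Hom C (Dom C k) (Dom C (ker C f))"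
    using kernel_unique[OF ker_is_kernel[OF assms(1)] assms(1)] .
  then show ?thesis using torsion_free_iso[of u] assms(2) by (simp add: ker_obj_def)
qed

lemma kernel_torsion_free:
  assumes "is_kernel C k f" "ker_obj C f \<in> \<F>" shows "Dom C k \<in> \<F>"
proof -
  obtain u where "iso C u" "u \<in> Hom C (Dom C (ker C f)) (Dom C k)"
    using kernel_unique[OF assms(1) ker_is_kernel[OF assms(1)]] .
  then show ?thesis using torsion_free_iso[of u] assms(2) by (simp add: ker_obj_def)
qed

text \<open>The domain component is the exact sequence of \<open>j\<close> and \<open>q\<close>, the
  codomain component the trivial one ending in an identity. Any normal \<open>j\<close> killed by
  \<open>f\<close> is allowed, since the lemma has two uses: to build torsion sequences of arrows
  and to show normality in the proof of (N).\<close>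

lemma arrow_quotient:
  assumes "regular_epi C q" "is_kernel C j q" "f \<in> Mor C" "Dom C f = Dom C q"
    "f \<odot> j = zero_mor C (Dom C j) (Cod C f)" "zero_object C Z"
  obtains g where "g \<in> Hom C (Cod C q) (Cod C f)" "g \<odot> q = f"
    "short_exact Arr (zero_mor C (Dom C j) Z, f, j, zero_mor C Z (Cod C f)) (f, g, q, Idn C (Cod C f))"
proof -
  note j = kernelD[OF assms(2)]
  have o: "Z \<in> Obj C" "Dom C j \<in> Obj C" using zero_objectD(1)[OF assms(6)] j by simp_all
  note c = regular_epi_cokernel[OF assms(1,2)]
  have "f \<in> Hom C (Cod C j) (Cod C f)" using assms(3,4) j by simp
  then obtain g where g: "g \<in> Hom C (Cod C q) (Cod C f)" "g \<odot> q = f"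
    using cokernel_lift[OF c _ assms(5)] by blast
  let ?t = "(zero_mor C (Dom C j) Z, f, j, zero_mor C Z (Cod C f))" and ?e = "(f, g, q, Idn C (Cod C f))"
  have t: "?t \<in> Mor Arr" using o assms(3,4,5) j by simp
  have e: "?e \<in> Mor Arr" using g assms(3,4) j by simp
  have "is_kernel Arr ?t ?e"
    by (rule arrow_kernelI[OF assms(2) kernel_of_identity[OF assms(6)] t e]) (use assms(3) in simp)
  moreover have "is_cokernel Arr ?e ?t"
    by (rule arrow_cokernelI[OF c cokernel_from_zero[OF assms(6)] t e]) (use assms(3) in simp)
  ultimately show ?thesis using that g by (simp add: short_exact_def)
qed

text \<open>What remains is that the kernel \<open>l\<close> of \<open>g\<close> has torsion-free
  domain. As \<open>k\<close> is a kernel of \<open>g \<odot> q\<close>, it restricts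
  \<open>q\<close> to a regular epimorphism \<open>r\<close> onto the kernel of \<open>g\<close>.
  The kernel of \<open>r\<close> is \<open>t\<close>, because that of \<open>q\<close> is
  \<open>k \<odot> t\<close>; so \<open>r\<close> and \<open>e\<close> are both cokernels of
  \<open>t\<close>.\<close>

lemma arrow_torsion_sequence:
  assumes "is_kernel C k f" "torsion_sequence C \<T> \<F> (Dom C k) t e" "zero_object C Z"
    "regular_epi C q" "is_kernel C (k \<odot> t) q"
  obtains g where "g \<in> Hom C (Cod C q) (Cod C f)" "g \<odot> q = f"
    "torsion_sequence Arr \<T>\<^sub>1 \<F>\<^sub>1 f
      (zero_mor C (Dom C t) Z, f, k \<odot> t, zero_mor C Z (Cod C f)) (f, g, q, Idn C (Cod C f))"
proof -
  note k = kernelD[OF assms(1)] and t = torsion_sequenceD[OF assms(2)] and q = kernelD[OF assms(5)]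
  have dk: "Dom C (k \<odot> t) = Dom C t" "Dom C q = Dom C f" using k t q by simp_all
  have "f \<odot> (k \<odot> t) = zero_mor C (Dom C (k \<odot> t)) (Cod C f)"
    using k t by (simp add: assoc_eq[OF k(4)])
  then obtain g where g: "g \<in> Hom C (Cod C q) (Cod C f)" "g \<odot> q = f"
    "short_exact Arr (zero_mor C (Dom C t) Z, f, k \<odot> t, zero_mor C Z (Cod C f)) (f, g, q, Idn C (Cod C f))"
    using arrow_quotient[OF assms(4,5) k(2) dk(2)[symmetric] _ assms(3)] dk(1) by metis
  have gM: "g \<in> Mor C" "Dom C g = Cod C q" using g(1) by simp_all
  obtain l where l: "is_kernel C l g" using ex_kernel[OF gM(1)] .
  note lD = kernelD[OF l]
  have "is_kernel C k (g \<odot> q)" using assms(1) g(2) by simp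
  then obtain r where r: "regular_epi C r" "r \<in> Hom C (Dom C k) (Dom C l)" "l \<odot> r = q \<odot> k"
    using kernel_restriction_regular[OF assms(4) gM _ l] by blast
  have rt: "r \<odot> t = zero_mor C (Dom C t) (Dom C l)"
  proof (rule monic_zero_cancel[OF kernel_monic[OF l]])
    show "l \<odot> (r \<odot> t) = zero_mor C (Dom C t) (Cod C l)"
      using q(4) lD gM r(2) t(3,5) k q(2) dk by (simp add: assoc_eq[OF r(3)])
  qed (use r(2) t(3,5) in simp)
  have "is_kernel C t r"
  proof (rule kernelI)
    fix X h assume h: "X \<in> Obj C" "h \<in> Hom C X (Dom C r)" "r \<odot> h = zero_mor C X (Cod C r)"
    have "q \<odot> (k \<odot> h) = l \<odot> (r \<odot> h)"
      using h(2) k(1-3) q(2) dk lD(1) r(2) by (simp add: assoc_eq[OF r(3)])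
    also have "\<dots> = zero_mor C X (Cod C q)" using h(1,3) r(2) lD(1,3) gM by simp
    finally have z: "q \<odot> (k \<odot> h) = zero_mor C X (Cod C q)" .
    have "k \<odot> h \<in> Hom C X (Dom C q)" using h(2) r(2) k dk by simp
    then obtain u where u: "u \<in> Hom C X (Dom C (k \<odot> t))" "(k \<odot> t) \<odot> u = k \<odot> h"
      using kernel_lift[OF assms(5) _ z] by blast
    have "t \<odot> u = h"
      by (rule monicD[OF kernel_monic[OF assms(1)], where X = X])
        (use u h(2) r(2) k(1) t(3,5) dk in simp_all)
    then show "\<exists>u \<in> Hom C X (Dom C t). t \<odot> u = h" using u(1) dk by auto
  qed (use t r rt in simp_all)
  then have "is_cokernel C r t" using regular_epi_cokernel r(1) by blast
  then obtain i where i: "iso C i" "i \<in> Hom C (Cod C e) (Cod C r)"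
    using cokernel_unique[OF t(2)] by blast
  then have "Dom C l \<in> \<F>" using torsion_free_iso[of i] t(9) r(2) by simp
  then have "g \<in> \<F>\<^sub>1" using ker_obj_torsion_free[OF l] gM by (simp add: arrow_torsion_free_def)
  moreover have "zero_mor C (Dom C t) Z \<in> \<T>\<^sub>1"
    using assms(3) t(3,8) zero_objectD(1)[OF assms(3)] by (simp add: arrow_torsion_def)
  ultimately show ?thesis using that[OF g(1,2)] g(3) by (simp add: torsion_sequence_def)
qed

text \<open>Here (N) for the given torsion theory becomes the existence of the quotient by
  T(K[f]).\<close>

lemma ex_torsion_quotient:
  assumes "is_kernel C k f" "torsion_sequence C \<T> \<F> (Dom C k) t e"
  obtains q where "regular_epi C q" "is_kernel C (k \<odot> t) q"
  using normal_mono_cokernel[OF condition_ND[OF condition_N assms]] by blast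

lemma torsion_theory_arrow_cat: "torsion_theory Arr \<T>\<^sub>1 \<F>\<^sub>1"
  unfolding torsion_theory_def
proof (intro conjI ballI)
  show "pointed Arr" using pointed_arrow_cat by (simp add: pointed_iff)
  show "replete Arr \<T>\<^sub>1" unfolding replete_def
  proof (intro conjI allI impI)
    show "\<T>\<^sub>1 \<subseteq> Obj Arr" by (auto simp: arrow_torsion_def)
    fix x assume x: "iso Arr x \<and> Dom Arr x \<in> \<T>\<^sub>1"
    obtain f g u v where x': "x = (f, g, u, v)" by (cases x)
    have m: "(f, g, u, v) \<in> Mor Arr" using x by (simp add: x' iso_def)
    have "iso C u" "iso C v" using x arrow_isoD unfolding x' by blast+
    then have "Cod C u \<in> \<T>" "zero_object C (Cod C v)"
      using m x torsion_iso[of u] iso_zero_object[of "Cod C f" v] unfolding x' by (simp_all add: arrow_torsion_def)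
    then show "Cod Arr x \<in> \<T>\<^sub>1" using m unfolding x' by (simp add: arrow_torsion_def)
  qed
  show "replete Arr \<F>\<^sub>1" unfolding replete_def
  proof (intro conjI allI impI)
    show "\<F>\<^sub>1 \<subseteq> Obj Arr" by (auto simp: arrow_torsion_free_def)
    fix x assume x: "iso Arr x \<and> Dom Arr x \<in> \<F>\<^sub>1"
    obtain f g u v where x': "x = (f, g, u, v)" by (cases x)
    have m: "f \<in> Mor C" "g \<in> Mor C" "u \<in> Hom C (Dom C f) (Dom C g)" "v \<in> Hom C (Cod C f) (Cod C g)"
      "v \<odot> f = g \<odot> u" using x by (simp_all add: x' iso_def)
    have i: "iso C u" "iso C v" using x arrow_isoD unfolding x' by blast+
    have f: "ker_obj C f \<in> \<F>" using x unfolding x' by (simp add: arrow_torsion_free_def)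
    obtain k where k: "is_kernel C k f" using ex_kernel[OF m(1)] .
    note kD = kernelD[OF k]
    have oK: "Dom C k \<in> Obj C" using kD by simp
    \<comment> \<open>Transport along the identity of \<open>Dom C k\<close>, \<open>u\<close> and
      \<open>v\<close> leaves the kernel object of \<open>f\<close> unchanged.\<close>
    have "is_kernel C (u \<odot> k) g"
      by (rule kernel_iso_transfer[OF k iso_Idn[OF oK] i])
        (use kD m(1-4) oK in \<open>simp_all add: m(5)\<close>)
    moreover have "Dom C (u \<odot> k) \<in> \<F>" using kernel_torsion_free[OF k f] kD m(3) by simp
    ultimately have "ker_obj C g \<in> \<F>" by (rule ker_obj_torsion_free)
    then show "Cod Arr x \<in> \<F>\<^sub>1" using m(2) unfolding x' by (simp add: arrow_torsion_free_def)
  qed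
next
  fix f g x assume f: "f \<in> \<T>\<^sub>1" and g: "g \<in> \<F>\<^sub>1" and "x \<in> Hom Arr f g"
  then obtain u v where x: "x = (f, g, u, v)" "u \<in> Hom C (Dom C f) (Dom C g)" "v \<in> Hom C (Cod C f) (Cod C g)"
    "v \<odot> f = g \<odot> u" by (blast elim: arrow_HomE)
  have f': "f \<in> Mor C" "Dom C f \<in> \<T>" "zero_object C (Cod C f)" using f by (auto simp: arrow_torsion_def)
  have g': "g \<in> Mor C" "ker_obj C g \<in> \<F>" using g by (auto simp: arrow_torsion_free_def)
  have v: "v = zero_mor C (Cod C f) (Cod C g)" using from_zero_object[OF f'(3) x(3)] .
  obtain k where k: "is_kernel C k g" using ex_kernel[OF g'(1)] .
  \<comment> \<open>Since \<open>v\<close> starts at a zero object, \<open>u\<close> factors through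
    the kernel of \<open>g\<close>, and the factor goes from a torsion object to a torsion-free
    one.\<close>
  have "g \<odot> u = zero_mor C (Dom C f) (Cod C g)" using x(4)[symmetric] f'(1) g'(1) unfolding v by simp
  then obtain w where w: "w \<in> Hom C (Dom C f) (Dom C k)" "k \<odot> w = u"
    using kernel_lift[OF k x(2)] by blast
  have "w = zero_mor C (Dom C f) (Dom C k)"
    by (rule Hom_zero[OF f'(2) kernel_torsion_free[OF k g'(2)] w(1)])
  then have "u = zero_mor C (Dom C f) (Dom C g)" using w(2) kernelD[OF k] f'(1) by simp
  then have "x = zero_mor Arr f g" using x(1) v f'(1) g'(1) by simp
  then show "zero_morphism Arr x" using f'(1) g'(1) Arr.zero_mor_simps(4)[of f g] by simp
next
  fix f assume "f \<in> Obj Arr"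
  then have f: "f \<in> Mor C" by simp
  obtain Z where Z: "zero_object C Z" using ex_zero_object by blast
  obtain k where k: "is_kernel C k f" using ex_kernel[OF f] .
  have "Dom C k \<in> Obj C" using kernelD(1)[OF k] by simp
  then obtain t e where t: "torsion_sequence C \<T> \<F> (Dom C k) t e" using ex_torsion_sequence by blast
  obtain q where q: "regular_epi C q" "is_kernel C (k \<odot> t) q" using ex_torsion_quotient[OF k t] .
  show "\<exists>t e. torsion_sequence Arr \<T>\<^sub>1 \<F>\<^sub>1 f t e"
    using arrow_torsion_sequence[OF k t Z q] by metis
qed

section \<open>Condition (N) for arrows\<close>

interpretation Arr: torsion_category Arr \<T>\<^sub>1 \<F>\<^sub>1
  by (rule torsion_categoryI) (rule torsion_theory_arrow_cat)

text \<open>For a morphism \<open>(u, v) : f \<rightarrow> g\<close> with kernel \<open>h\<close>, the composite \<open>K[h] \<rightarrow> K[u] \<rightarrow> A\<close> is the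
  kernel of \<open>(f, u) : A \<rightarrow> B \<times> C\<close>, so condition (N) applies to it.\<close>

lemma kernel_of_pairing:
  assumes "f \<in> Mor C" "u \<in> Mor C" "Dom C u = Dom C f" "is_kernel C k u" "is_kernel C l (f \<odot> k)"
  shows "\<exists>h. is_kernel C (k \<odot> l) h"
proof -
  note k = kernelD[OF assms(4)] and l = kernelD[OF assms(5)]
  have lk: "Cod C l = Dom C k" "Cod C (f \<odot> k) = Cod C f" using l k assms by simp_all
  have "f \<in> Hom C (Dom C f) (Cod C f)" "u \<in> Hom C (Dom C f) (Cod C u)" using assms by simp_all
  then obtain p q h where h: "p \<in> Mor C" "q \<in> Mor C" "Cod C p = Cod C f" "Cod C q = Cod C u" "Dom C q = Dom C p"
    "h \<in> Hom C (Dom C f) (Dom C p)" "p \<odot> h = f" "q \<odot> h = u"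
    and joint: "\<And>W u v. \<lbrakk>u \<in> Hom C W (Dom C p); v \<in> Hom C W (Dom C p); p \<odot> u = p \<odot> v; q \<odot> u = q \<odot> v\<rbrakk> \<Longrightarrow> u = v"
    using ex_pairing by metis
  have kl: "k \<odot> l \<in> Hom C (Dom C l) (Dom C f)" using k l lk assms(3) by simp
  have f0: "f \<odot> (k \<odot> l) = zero_mor C (Dom C l) (Cod C f)" using l(4) k l(1) lk assms(1,3) by simp
  have u0: "u \<odot> (k \<odot> l) = zero_mor C (Dom C l) (Cod C u)"
    using k l(1) lk by (simp add: assoc_eq[OF k(4)])
  have 0: "h \<odot> (k \<odot> l) = zero_mor C (Dom C l) (Dom C p)"
    by (rule joint[of _ "Dom C l"])
      (use kl h(1-6) l(1) f0 u0 in \<open>simp_all add: assoc_eq[OF h(7)] assoc_eq[OF h(8)]\<close>)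
  have "is_kernel C (k \<odot> l) h"
  proof (rule kernelI)
    show "monic C (k \<odot> l)" using monic_comp kernel_monic assms(4,5) lk(1) by metis
    show "h \<odot> (k \<odot> l) = zero_mor C (Dom C (k \<odot> l)) (Cod C h)" using 0 kl h(6) by simp
    fix X x assume x: "X \<in> Obj C" "x \<in> Hom C X (Dom C h)" "h \<odot> x = zero_mor C X (Cod C h)"
    have xH: "x \<in> Hom C X (Dom C u)" using x(2) h(6) assms(3) by simp
    have f0: "f \<odot> x = zero_mor C X (Cod C f)"
      using assoc[of x h p] x h(1,3,6) by (simp add: h(7))
    have "u \<odot> x = zero_mor C X (Cod C u)"
      using assoc[of x h q] x h(2,4,5,6) by (simp add: h(8))
    then obtain y where y: "y \<in> Hom C X (Dom C k)" "k \<odot> y = x" using kernel_lift[OF assms(4) xH] by blast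
    have yH: "y \<in> Hom C X (Dom C (f \<odot> k))" using y(1) k assms(1,3) by simp
    have "(f \<odot> k) \<odot> y = zero_mor C X (Cod C (f \<odot> k))"
      using y(1) k assms(1,3) f0 by (simp add: y(2))
    then obtain z where z: "z \<in> Hom C X (Dom C l)" "l \<odot> z = y" using kernel_lift[OF assms(5) yH] by blast
    have "(k \<odot> l) \<odot> z = x" using z(1) l(1) lk k(1) by (simp add: z(2) y(2))
    then show "\<exists>w \<in> Hom C X (Dom C (k \<odot> l)). (k \<odot> l) \<odot> w = x"
      using z(1) kl by (intro bexI[of _ z]) simp_all
  qed (use kl h(6) in simp_all)
  then show ?thesis by blast
qed

text \<open>The kernel of the square is \<open>h\<close>, with kernel \<open>l\<close>, and its
  torsion part is a morphism from \<open>Dom C t\<close> to a zero object. Included into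
  \<open>f\<close>, it has domain component \<open>(k \<odot> l) \<odot> t\<close>. This is normal
  by (N) in the base, \<open>k \<odot> l\<close> being a kernel, and \<open>f\<close> kills it, so
  it is the kernel of a quotient of \<open>f\<close>.\<close>

lemma condition_N_arrow_cat: "condition_N Arr \<T>\<^sub>1 \<F>\<^sub>1"
proof (rule Arr.condition_NI)
  fix x assume x: "x \<in> Mor Arr"
  obtain f g u v where x': "x = (f, g, u, v)" by (cases x)
  have m: "f \<in> Mor C" "g \<in> Mor C" "u \<in> Hom C (Dom C f) (Dom C g)" "v \<in> Hom C (Cod C f) (Cod C g)"
    "v \<odot> f = g \<odot> u" using x unfolding x' by simp_all
  have uv: "u \<in> Mor C" "v \<in> Mor C" using m by simp_all
  obtain Z where Z: "zero_object C Z" using ex_zero_object by blast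
  have oZ: "Z \<in> Obj C" using zero_objectD(1)[OF Z] .
  obtain k where k: "is_kernel C k u" using ex_kernel[OF uv(1)] .
  obtain k' where k': "is_kernel C k' v" using ex_kernel[OF uv(2)] .
  note kD = kernelD[OF k] and kD' = kernelD[OF k']
  have fk: "f \<odot> k \<in> Hom C (Dom C k) (Dom C v)" "v \<odot> (f \<odot> k) = zero_mor C (Dom C k) (Cod C v)"
    using kD m(1-4) by (simp_all add: assoc_eq[OF m(5)])
  obtain h where h: "h \<in> Hom C (Dom C k) (Dom C k')" "k' \<odot> h = f \<odot> k" using kernel_lift[OF k' fk] .
  have K: "is_kernel Arr (h, f, k, k') x" unfolding x'
    by (rule arrow_kernelI[OF k k']) (use h kD kD' m in simp_all)
  have "h \<in> Mor C" using h by simp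
  then obtain l where l: "is_kernel C l h" by (rule ex_kernel)
  note lD = kernelD[OF l]
  \<comment> \<open>\<open>h\<close> and \<open>f \<odot> k\<close> differ by the monomorphism
    \<open>k'\<close>, so they have the same kernel; the second form is the one that involves only
    \<open>f\<close> and \<open>u\<close>.\<close>
  have fkl: "is_kernel C l (f \<odot> k)"
  proof (rule kernelI)
    have "(k' \<odot> h) \<odot> l = zero_mor C (Dom C l) (Cod C f)" using lD h(1) kD' m(4) by simp
    then show "(f \<odot> k) \<odot> l = zero_mor C (Dom C l) (Cod C (f \<odot> k))" using h(2) kD m by simp
    fix X y assume y: "X \<in> Obj C" "y \<in> Hom C X (Dom C (f \<odot> k))" "(f \<odot> k) \<odot> y = zero_mor C X (Cod C (f \<odot> k))"
    have yH: "y \<in> Hom C X (Dom C h)" using y(2) fk(1) h(1) by simp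
    have "k' \<odot> (h \<odot> y) = zero_mor C X (Cod C k')"
      using y yH h(1) kD' fk(1) m(4) assoc_eq[OF h(2)] by simp
    then have "h \<odot> y = zero_mor C X (Dom C k')"
      by (intro monic_zero_cancel[OF kernel_monic[OF k']]) (use yH h(1) in simp_all)
    then have "h \<odot> y = zero_mor C X (Cod C h)" using h(1) by simp
    then show "\<exists>w \<in> Hom C X (Dom C l). l \<odot> w = y" using kernel_lift[OF l yH] by blast
  qed (use lD h(1) fk(1) kernel_monic[OF l] in simp_all)
  have "Dom C u = Dom C f" using m(3) by simp
  then obtain p where p: "is_kernel C (k \<odot> l) p" using kernel_of_pairing[OF m(1) uv(1) _ k fkl] by blast
  have kl: "Dom C (k \<odot> l) = Dom C l" using kD lD h(1) by simp
  have "Dom C l \<in> Obj C" using lD by simp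
  then obtain t e where t: "torsion_sequence C \<T> \<F> (Dom C l) t e" using ex_torsion_sequence by blast
  note tD = torsion_sequenceD[OF t]
  obtain q where q: "regular_epi C q" "is_kernel C (l \<odot> t) q" using ex_torsion_quotient[OF l t] .
  obtain g' where T: "torsion_sequence Arr \<T>\<^sub>1 \<F>\<^sub>1 h
      (zero_mor C (Dom C t) Z, h, l \<odot> t, zero_mor C Z (Cod C h)) (h, g', q, Idn C (Cod C h))"
    using arrow_torsion_sequence[OF l t Z q] by blast
  let ?j = "(k \<odot> l) \<odot> t"
  obtain q' where q': "regular_epi C q'" "is_kernel C ?j q'"
    using ex_torsion_quotient[OF p] t kl by metis
  have j: "Dom C ?j = Dom C t" "Dom C q' = Dom C f"
    using kernelD(3)[OF q'(2)] kD lD tD h(1) m(3) by simp_all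
  have fj: "f \<odot> ?j = zero_mor C (Dom C ?j) (Cod C f)"
    using kernelD(4)[OF fkl] kD lD tD(3,5) tD(8) h(1) m(1,3) j
    using assoc_eq[OF kernelD(4)[OF fkl], of t] by simp
  \<comment> \<open>Only the kernel half matters here: it exhibits the composite inclusion into
    \<open>f\<close> as a normal monomorphism of arrows.\<close>
  obtain g'' where "short_exact Arr (zero_mor C (Dom C ?j) Z, f, ?j, zero_mor C Z (Cod C f))
      (f, g'', q', Idn C (Cod C f))"
    using arrow_quotient[OF q' m(1) j(2)[symmetric] fj Z] by blast
  then have "normal_mono Arr (zero_mor C (Dom C t) Z, f, ?j, zero_mor C Z (Cod C f))"
    using j(1) by (auto simp: short_exact_def normal_mono_def)
  moreover have "(h, f, k, k') \<odot>\<^bsub>Arr\<^esub> (zero_mor C (Dom C t) Z, h, l \<odot> t, zero_mor C Z (Cod C h)) =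
      (zero_mor C (Dom C t) Z, f, ?j, zero_mor C Z (Cod C f))"
    using kD kD' lD tD(3,5) h(1) m(4) oZ by simp
  ultimately have "normal_mono Arr
      ((h, f, k, k') \<odot>\<^bsub>Arr\<^esub> (zero_mor C (Dom C t) Z, h, l \<odot> t, zero_mor C Z (Cod C h)))"
    by (simp only:)
  moreover have "torsion_sequence Arr \<T>\<^sub>1 \<F>\<^sub>1 (Dom Arr (h, f, k, k'))
      (zero_mor C (Dom C t) Z, h, l \<odot> t, zero_mor C Z (Cod C h)) (h, g', q, Idn C (Cod C h))"
    using T by simp
  ultimately show "\<exists>k t e. is_kernel Arr k x \<and> torsion_sequence Arr \<T>\<^sub>1 \<F>\<^sub>1 (Dom Arr k) t e \<and>
      normal_mono Arr (k \<odot>\<^bsub>Arr\<^esub> t)"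
    using K by blast
qed

subsection \<open>Condition (P)\<close>

lemma kernel_map:
  assumes "f \<in> Hom C X Y" "g \<in> Hom C X' Y'" "u \<in> Hom C X X'" "v \<in> Hom C Y Y'" "v \<odot> f = g \<odot> u"
    "is_kernel C k f" "is_kernel C l g"
  obtains w where "w \<in> Hom C (Dom C k) (Dom C l)" "l \<odot> w = u \<odot> k"
proof -
  note k = kernelD[OF assms(6)]
  have "v \<odot> (f \<odot> k) = zero_mor C (Dom C k) Y'" using k assms(1,4) by auto
  then have "g \<odot> (u \<odot> k) = zero_mor C (Dom C k) (Cod C g)" "u \<odot> k \<in> Hom C (Dom C k) (Dom C g)"
    using k(1-3) assms(1-4) by (simp_all add: assoc_eq[OF assms(5)])
  then show ?thesis using kernel_lift[OF assms(7)] that by blast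
qed

text \<open>Functoriality of the quotient: \<open>u\<close> carries the kernel of \<open>f\<close>
  into that of \<open>g\<close>, and hence torsion part into torsion part, so
  \<open>q' \<odot> u\<close> kills the kernel of \<open>q\<close>.\<close>

lemma torsion_quotient_map:
  assumes "f \<in> Hom C X Y" "g \<in> Hom C X' Y'" "u \<in> Hom C X X'" "v \<in> Hom C Y Y'" "v \<odot> f = g \<odot> u"
    and k: "is_kernel C k f" "torsion_sequence C \<T> \<F> (Dom C k) t e"
    and l: "is_kernel C l g" "torsion_sequence C \<T> \<F> (Dom C l) t' e'"
    and q: "regular_epi C q" "is_kernel C (k \<odot> t) q" "f' \<in> Hom C (Cod C q) Y" "f' \<odot> q = f"
    and q': "regular_epi C q'" "is_kernel C (l \<odot> t') q'" "g' \<in> Hom C (Cod C q') Y'" "g' \<odot> q' = g"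
  obtains w where "w \<in> Hom C (Cod C q) (Cod C q')" "w \<odot> q = q' \<odot> u" "v \<odot> f' = g' \<odot> w"
proof -
  note kD = kernelD[OF k(1)] and tD = torsion_sequenceD[OF k(2)]
  note lD = kernelD[OF l(1)] and tD' = torsion_sequenceD[OF l(2)]
  note qD = kernelD[OF q(2)] and qD' = kernelD[OF q'(2)]
  obtain y where y: "y \<in> Hom C (Dom C k) (Dom C l)" "l \<odot> y = u \<odot> k" using kernel_map[OF assms(1-5) k(1) l(1)] .
  have "y \<odot> t \<in> Hom C (Dom C t) (Dom C l)" using y(1) tD by simp
  then obtain z where z: "z \<in> Hom C (Dom C t) (Dom C t')" "t' \<odot> z = y \<odot> t"
    using torsion_lift[OF l(2) tD(8)] by blast
  have d: "Dom C (k \<odot> t) = Dom C t" "Dom C (l \<odot> t') = Dom C t'" "Dom C q = X" "Dom C q' = X'"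
    "Cod C k = X" "Cod C l = X'"
    using kD tD lD tD' qD qD' assms(1,2) by simp_all
  have "u \<odot> (k \<odot> t) = (l \<odot> t') \<odot> z"
    using y(1) z kD lD tD(3,5) tD'(3,5) assms(3) d(5) assoc_eq[OF y(2), of t] by simp
  then have "(q' \<odot> u) \<odot> (k \<odot> t) = (q' \<odot> (l \<odot> t')) \<odot> z"
    using z(1) d assms(3) kD(1) tD(3,5) lD(1) tD'(3,5) qD'(2) by simp
  also have "\<dots> = zero_mor C (Dom C (k \<odot> t)) (Cod C q')" using qD' z(1) d by simp
  finally have "(q' \<odot> u) \<odot> (k \<odot> t) = zero_mor C (Dom C (k \<odot> t)) (Cod C q')" .
  moreover have "q' \<odot> u \<in> Hom C (Cod C (k \<odot> t)) (Cod C q')" using qD qD'(2) d assms(3) by simp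
  ultimately obtain w where w: "w \<in> Hom C (Cod C q) (Cod C q')" "w \<odot> q = q' \<odot> u"
    using cokernel_lift[OF regular_epi_cokernel[OF q(1,2)]] by blast
  have "v \<odot> f' = g' \<odot> w"
  proof (rule epicD[OF regular_epi_epic[OF q(1)], where Y = Y'])
    show "(v \<odot> f') \<odot> q = (g' \<odot> w) \<odot> q"
      using w(1) qD(2) qD'(2) q(3) q'(3) d assms(3,4)
      by (simp add: w(2) q(4) assms(5) assoc_eq[OF q'(4)])
  qed (use q(3) q'(3) w(1) assms(4) in simp_all)
  with w show ?thesis by (rule that)
qed

text \<open>Kernels commute with kernels. An element of the kernel of \<open>b\<close> killed by
  \<open>g\<close> comes from some \<open>i\<close> into \<open>X\<close>, and
  \<open>a \<odot> i\<close> is zero because \<open>k'\<close> is monic, so \<open>i\<close> comes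
  from the kernel of \<open>a\<close>.\<close>

lemma kernel_of_kernels:
  assumes "a \<in> Hom C X X'" "b \<in> Hom C Y Y'" "c \<in> Hom C W W'"
    "is_kernel C k f" "k \<in> Hom C X Y" "f \<in> Hom C Y W" "is_kernel C k' f'" "k' \<in> Hom C X' Y'"
    "k' \<odot> a = b \<odot> k"
    "is_kernel C x a" "is_kernel C y b" "is_kernel C z c"
    "l \<in> Hom C (Dom C x) (Dom C y)" "y \<odot> l = k \<odot> x"
    "g \<in> Hom C (Dom C y) (Dom C z)" "z \<odot> g = f \<odot> y"
  shows "is_kernel C l g"
proof (rule kernelI)
  note xD = kernelD[OF assms(10)] and yD = kernelD[OF assms(11)] and zD = kernelD[OF assms(12)]
  have hom: "x \<in> Hom C (Dom C x) X" "y \<in> Hom C (Dom C y) Y" "z \<in> Hom C (Dom C z) W"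
    "X \<in> Obj C" "Y \<in> Obj C" "W \<in> Obj C" "Y' \<in> Obj C"
    using xD(1,3) yD(1,3) zD(1,3) assms(1-3) by auto
  have fk: "f \<odot> k = zero_mor C X W" using kernelD(4)[OF assms(4)] assms(5,6) by simp
  have "monic C (y \<odot> l)" using monic_comp[of x k] kernel_monic[OF assms(10)] kernel_monic[OF assms(4)]
    assms(1,5) xD(3) by (simp add: assms(14))
  then show "monic C l" by (rule monic_cancel) (use assms(13) yD in simp_all)
  have "z \<odot> (g \<odot> l) = f \<odot> (y \<odot> l)"
    using assms(6,13,15) hom by (simp add: assoc_eq[OF assms(16)])
  also have "\<dots> = zero_mor C (Dom C x) (Cod C z)"
    using assms(5,6) hom by (simp add: assms(14) assoc_eq[OF fk])
  finally have "z \<odot> (g \<odot> l) = zero_mor C (Dom C x) (Cod C z)" .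
  then show "g \<odot> l = zero_mor C (Dom C l) (Cod C g)"
    using monic_zero_cancel[OF kernel_monic[OF assms(12)], of "g \<odot> l" "Dom C x"] assms(13,15) by simp
  fix V h assume h: "V \<in> Obj C" "h \<in> Hom C V (Dom C g)" "g \<odot> h = zero_mor C V (Cod C g)"
  have hy: "y \<odot> h \<in> Hom C V (Dom C f)" using h(2) assms(2,6,15) yD by simp
  have "f \<odot> (y \<odot> h) = z \<odot> (g \<odot> h)"
    using h(2) assms(2,6,15) yD zD by (simp add: assoc_eq[OF assms(16)])
  also have "\<dots> = zero_mor C V (Cod C f)"
    using h(1,3) assms(6,15) hom by simp
  finally obtain i where i: "i \<in> Hom C V (Dom C k)" "k \<odot> i = y \<odot> h"
    using kernel_lift[OF assms(4) hy] by blast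
  have iH: "i \<in> Hom C V (Dom C a)" using i(1) assms(1,5) by simp
  have "k' \<odot> (a \<odot> i) = (b \<odot> y) \<odot> h"
    using i(1) h(2) yD(1-3) assms(1,2,5,8,15) by (simp add: assoc_eq[OF assms(9)] i(2))
  also have "\<dots> = zero_mor C V (Cod C k')" unfolding yD(4) using h(1,2) assms(2,8,15) hom(7) by simp
  finally have "a \<odot> i = zero_mor C V (Cod C a)"
    using monic_zero_cancel[OF kernel_monic[OF assms(7)], of "a \<odot> i" V] iH assms(1,8) by simp
  then obtain w where w: "w \<in> Hom C V (Dom C x)" "x \<odot> w = i" using kernel_lift[OF assms(10) iH] by blast
  have "y \<odot> (l \<odot> w) = y \<odot> h"
    using w(1) assms(1,5,13) xD yD by (simp add: assoc_eq[OF assms(14)] w(2) i(2))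
  then have "l \<odot> w = h"
    by (rule monicD[OF kernel_monic[OF assms(11)], where X = V]) (use w(1) h(2) assms(13,15) in simp_all)
  then show "\<exists>w \<in> Hom C V (Dom C l). l \<odot> w = h" using w(1) assms(13) by (intro bexI[of _ w]) simp_all
qed (use assms(13,15) in simp_all)

text \<open>The units are identities on codomains, so the codomain component of the reflected
  sequence is the given kernel \<open>k'\<close> of \<open>f'\<close>. The work is to show that
  \<open>Qk\<close> is a kernel of \<open>Qf\<close> between the quotients of the domains.\<close>

lemma condition_P_arrow_cat:
  assumes P: "condition_P C \<T> \<F>"
  shows "condition_P Arr \<T>\<^sub>1 \<F>\<^sub>1"
proof (rule Arr.condition_PI)
  fix \<kappa> \<phi> \<sigma> assume "split_short_exact Arr \<kappa> \<phi> \<sigma>"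
  then have K: "is_kernel Arr \<kappa> \<phi>" and S: "section_of Arr \<sigma> \<phi>" by (simp_all add: split_short_exact_def)
  obtain b c f f' where \<phi>: "\<phi> = (b, c, f, f')" by (cases \<phi>)
  obtain a b\<^sub>0 k k' where \<kappa>0: "\<kappa> = (a, b\<^sub>0, k, k')" by (cases \<kappa>)
  obtain c\<^sub>0 b\<^sub>1 s s' where \<sigma>0: "\<sigma> = (c\<^sub>0, b\<^sub>1, s, s')" by (cases \<sigma>)
  have \<kappa>: "\<kappa> = (a, b, k, k')" using Arr.kernelD(3)[OF K] unfolding \<kappa>0 \<phi> by simp
  have \<sigma>: "\<sigma> = (c, b, s, s')" using S unfolding \<sigma>0 \<phi> by (simp add: section_of_def)
  note Kf = K[unfolded \<kappa> \<phi>]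
  have k: "is_kernel C k f" "is_kernel C k' f'" using arrow_kernelD[OF Kf] .
  have mk: "a \<in> Mor C" "b \<in> Mor C" "k \<in> Hom C (Dom C a) (Dom C b)" "k' \<in> Hom C (Cod C a) (Cod C b)"
    "k' \<odot> a = b \<odot> k" using Arr.kernelD(1)[OF Kf] by simp_all
  have mf: "c \<in> Mor C" "f \<in> Hom C (Dom C b) (Dom C c)" "f' \<in> Hom C (Cod C b) (Cod C c)"
    "f' \<odot> b = c \<odot> f" using Arr.kernelD(2)[OF Kf] by simp_all
  have ms: "s \<in> Hom C (Dom C c) (Dom C b)" "s' \<in> Hom C (Cod C c) (Cod C b)" "s' \<odot> c = b \<odot> s"
    "f \<odot> s = Idn C (Dom C c)" using S unfolding \<phi> \<sigma> by (simp_all add: section_of_def)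
  have h: "a \<in> Hom C (Dom C a) (Cod C a)" "b \<in> Hom C (Dom C b) (Cod C b)" "c \<in> Hom C (Dom C c) (Cod C c)"
    using mk mf by simp_all
  obtain Z where Z: "zero_object C Z" using ex_zero_object by blast
  obtain x where x: "is_kernel C x a" using ex_kernel[OF mk(1)] .
  obtain y where y: "is_kernel C y b" using ex_kernel[OF mk(2)] .
  obtain z where z: "is_kernel C z c" using ex_kernel[OF mf(1)] .
  note xD = kernelD[OF x] and yD = kernelD[OF y] and zD = kernelD[OF z]
  have o: "Dom C x \<in> Obj C" "Dom C y \<in> Obj C" "Dom C z \<in> Obj C" using xD yD zD by simp_all
  obtain t\<^sub>a e\<^sub>a where ta: "torsion_sequence C \<T> \<F> (Dom C x) t\<^sub>a e\<^sub>a" using ex_torsion_sequence[OF o(1)] by blast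
  obtain t\<^sub>b e\<^sub>b where tb: "torsion_sequence C \<T> \<F> (Dom C y) t\<^sub>b e\<^sub>b" using ex_torsion_sequence[OF o(2)] by blast
  obtain t\<^sub>c e\<^sub>c where tc: "torsion_sequence C \<T> \<F> (Dom C z) t\<^sub>c e\<^sub>c" using ex_torsion_sequence[OF o(3)] by blast
  note taD = torsion_sequenceD[OF ta] and tbD = torsion_sequenceD[OF tb]
  obtain q\<^sub>a where qa: "regular_epi C q\<^sub>a" "is_kernel C (x \<odot> t\<^sub>a) q\<^sub>a" using ex_torsion_quotient[OF x ta] .
  obtain q\<^sub>b where qb: "regular_epi C q\<^sub>b" "is_kernel C (y \<odot> t\<^sub>b) q\<^sub>b" using ex_torsion_quotient[OF y tb] .
  obtain q\<^sub>c where qc: "regular_epi C q\<^sub>c" "is_kernel C (z \<odot> t\<^sub>c) q\<^sub>c" using ex_torsion_quotient[OF z tc] .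
  obtain a' where a': "a' \<in> Hom C (Cod C q\<^sub>a) (Cod C a)" "a' \<odot> q\<^sub>a = a"
    and Ta: "torsion_sequence Arr \<T>\<^sub>1 \<F>\<^sub>1 a (zero_mor C (Dom C t\<^sub>a) Z, a, x \<odot> t\<^sub>a, zero_mor C Z (Cod C a))
      (a, a', q\<^sub>a, Idn C (Cod C a))" using arrow_torsion_sequence[OF x ta Z qa] .
  obtain b' where b': "b' \<in> Hom C (Cod C q\<^sub>b) (Cod C b)" "b' \<odot> q\<^sub>b = b"
    and Tb: "torsion_sequence Arr \<T>\<^sub>1 \<F>\<^sub>1 b (zero_mor C (Dom C t\<^sub>b) Z, b, y \<odot> t\<^sub>b, zero_mor C Z (Cod C b))
      (b, b', q\<^sub>b, Idn C (Cod C b))" using arrow_torsion_sequence[OF y tb Z qb] .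
  obtain c' where c': "c' \<in> Hom C (Cod C q\<^sub>c) (Cod C c)" "c' \<odot> q\<^sub>c = c"
    and Tc: "torsion_sequence Arr \<T>\<^sub>1 \<F>\<^sub>1 c (zero_mor C (Dom C t\<^sub>c) Z, c, z \<odot> t\<^sub>c, zero_mor C Z (Cod C c))
      (c, c', q\<^sub>c, Idn C (Cod C c))" using arrow_torsion_sequence[OF z tc Z qc] .
  have dq: "q\<^sub>a \<in> Hom C (Dom C a) (Cod C q\<^sub>a)" "q\<^sub>b \<in> Hom C (Dom C b) (Cod C q\<^sub>b)" "q\<^sub>c \<in> Hom C (Dom C c) (Cod C q\<^sub>c)"
    using kernelD(2,3)[OF qa(2)] kernelD(2,3)[OF qb(2)] kernelD(2,3)[OF qc(2)] xD(1,3) yD(1,3) zD(1,3)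
      taD(3,5) tbD(3,5) torsion_sequenceD(3,5)[OF tc] by simp_all
  obtain Qk where Qk: "Qk \<in> Hom C (Cod C q\<^sub>a) (Cod C q\<^sub>b)" "Qk \<odot> q\<^sub>a = q\<^sub>b \<odot> k" "k' \<odot> a' = b' \<odot> Qk"
    using torsion_quotient_map[OF h(1,2) mk(3-5) x ta y tb qa a' qb b'] .
  obtain Qf where Qf: "Qf \<in> Hom C (Cod C q\<^sub>b) (Cod C q\<^sub>c)" "Qf \<odot> q\<^sub>b = q\<^sub>c \<odot> f" "f' \<odot> b' = c' \<odot> Qf"
    using torsion_quotient_map[OF h(2,3) mf(2-4) y tb z tc qb b' qc c'] .
  obtain Qs where Qs: "Qs \<in> Hom C (Cod C q\<^sub>c) (Cod C q\<^sub>b)" "Qs \<odot> q\<^sub>c = q\<^sub>b \<odot> s"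
    using torsion_quotient_map[OF h(3,2) ms(1-3) z tc y tb qc c' qb b'] .
  have QfQs: "Qf \<odot> Qs = Idn C (Cod C q\<^sub>c)"
  proof (rule epicD[OF regular_epi_epic[OF qc(1)], where Y = "Cod C q\<^sub>c"])
    show "(Qf \<odot> Qs) \<odot> q\<^sub>c = Idn C (Cod C q\<^sub>c) \<odot> q\<^sub>c"
      using Qs(1) Qf(1) dq ms(1) mf(1,2) by (simp add: Qs(2) assoc_eq[OF Qf(2)] ms(4))
  qed (use Qs(1) Qf(1) dq in simp_all)
  have sec: "section_of C s f" "section_of C Qs Qf"
    using ms(1,4) mf(2) Qs(1) Qf(1) QfQs by (simp_all add: section_of_def)

  obtain Kk where Kk: "Kk \<in> Hom C (Dom C x) (Dom C y)" "y \<odot> Kk = k \<odot> x"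
    using kernel_map[OF h(1,2) mk(3-5) x y] .
  obtain Kf where Kf: "Kf \<in> Hom C (Dom C y) (Dom C z)" "z \<odot> Kf = f \<odot> y"
    using kernel_map[OF h(2,3) mf(2-4) y z] .
  obtain Ks where Ks: "Ks \<in> Hom C (Dom C z) (Dom C y)" "y \<odot> Ks = s \<odot> z"
    using kernel_map[OF h(3,2) ms(1-3) z y] .
  have KfKs: "Kf \<odot> Ks = Idn C (Dom C z)"
  proof (rule monicD[OF kernel_monic[OF z], where X = "Dom C z"])
    show "z \<odot> (Kf \<odot> Ks) = z \<odot> Idn C (Dom C z)"
      using Kf(1) Ks(1) yD zD ms(1) mf(2) by (simp add: assoc_eq[OF Kf(2)] Ks(2) assoc_eq[OF ms(4)])
  qed (use Kf(1) Ks(1) o in simp_all)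
  \<comment> \<open>(P) concerns the base category, so it is applied to the split sequence of the
    kernels of \<open>a\<close>, \<open>b\<close> and \<open>c\<close>.\<close>
  have "is_kernel C Kk Kf"
    using kernel_of_kernels[OF h k(1) mk(3) mf(2) k(2) mk(4,5) x y z Kk Kf] .
  then have Ksplit: "split_short_exact C Kk Kf Ks"
    using Kf(1) Ks(1) KfKs by (simp add: split_short_exact_def section_of_def)
  have "e\<^sub>b \<odot> Kk \<in> Hom C (Dom C x) (Cod C e\<^sub>b)" using Kk(1) tbD(4,6) by simp
  then obtain Fk where Fk: "Fk \<in> Hom C (Cod C e\<^sub>a) (Cod C e\<^sub>b)" "Fk \<odot> e\<^sub>a = e\<^sub>b \<odot> Kk"
    using torsion_free_extend[OF ta tbD(9)] by blast
  have ta': "torsion_sequence C \<T> \<F> (Dom C Kk) t\<^sub>a e\<^sub>a" "torsion_sequence C \<T> \<F> (Dom C Kf) t\<^sub>b e\<^sub>b"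
    using ta tb Kk(1) Kf(1) by simp_all
  have mFk: "monic C Fk" using condition_P_monic[OF P Ksplit ta' Fk] .

  text \<open>Condition (P) enters here only: the subobjects \<open>k\<close> and \<open>T(K[b])\<close> of \<open>Dom b\<close> meet in \<open>T(K[a])\<close>.\<close>
  have meet: "\<exists>w \<in> Hom C V (Dom C (x \<odot> t\<^sub>a)). (x \<odot> t\<^sub>a) \<odot> w = i"
    if i: "i \<in> Hom C V (Dom C k)" "j \<in> Hom C V (Dom C t\<^sub>b)" "k \<odot> i = (y \<odot> t\<^sub>b) \<odot> j" for V i j
  proof -
    have ki: "k \<odot> i = y \<odot> (t\<^sub>b \<odot> j)" using i(2,3) yD(1) tbD(3,5) by simp
    have V: "V \<in> Obj C" using i(1) by auto
    have iH: "i \<in> Hom C V (Dom C a)" using i(1) mk(3) by simp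
    have "k' \<odot> (a \<odot> i) = (b \<odot> y) \<odot> (t\<^sub>b \<odot> j)"
      using iH i(2) mk(1-4) yD(1-3) tbD(3,5) by (simp add: assoc_eq[OF mk(5)] ki)
    also have "\<dots> = zero_mor C V (Cod C k')" unfolding yD(4) using i(2) V tbD(3,5) mk(1,2,4) by simp
    finally have "a \<odot> i = zero_mor C V (Cod C a)"
      using monic_zero_cancel[OF kernel_monic[OF k(2)], of "a \<odot> i" V] iH mk(1,4) by simp
    then obtain i' where i': "i' \<in> Hom C V (Dom C x)" "x \<odot> i' = i" using kernel_lift[OF x iH] by blast
    have "y \<odot> (Kk \<odot> i') = y \<odot> (t\<^sub>b \<odot> j)"
      using i'(1) Kk(1) xD yD mk(3) by (simp add: assoc_eq[OF Kk(2)] i'(2) ki)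
    then have "Kk \<odot> i' = t\<^sub>b \<odot> j"
      by (rule monicD[OF kernel_monic[OF y], where X = V]) (use i'(1) Kk(1) i(2) tbD(3,5) in simp_all)
    then have "e\<^sub>b \<odot> (Kk \<odot> i') = zero_mor C V (Cod C e\<^sub>b)"
      using i(2) V tbD(3-6,12) assoc_eq[OF tbD(12), of j] by simp
    \<comment> \<open>Monicity of \<open>Fk\<close> turns vanishing in the torsion-free quotient of
      K[b] into vanishing in that of K[a], so that \<open>i'\<close> lies in T(K[a]).\<close>
    then have "Fk \<odot> (e\<^sub>a \<odot> i') = zero_mor C V (Cod C Fk)"
      using i'(1) Fk(1) Kk(1) taD(4,6) tbD(4,6) by (simp add: assoc_eq[OF Fk(2)])
    then have "e\<^sub>a \<odot> i' = zero_mor C V (Cod C e\<^sub>a)"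
      using monic_zero_cancel[OF mFk, of "e\<^sub>a \<odot> i'" V] i'(1) Fk(1) taD(4,6) by simp
    moreover have "i' \<in> Hom C V (Dom C e\<^sub>a)" using i'(1) taD(6) by simp
    ultimately obtain w where w: "w \<in> Hom C V (Dom C t\<^sub>a)" "t\<^sub>a \<odot> w = i'"
      using kernel_lift[OF taD(1)] by blast
    have "(x \<odot> t\<^sub>a) \<odot> w = i" using w(1) taD(3,5) xD(1) by (simp add: w(2) i'(2))
    then show ?thesis using w(1) taD(3,5) xD(1) by (intro bexI[of _ w]) simp_all
  qed

  have "Qf \<in> Mor C" using Qf by simp
  then obtain n where n: "is_kernel C n Qf" by (rule ex_kernel)
  note nD = kernelD[OF n] and kD = kernelD[OF k(1)]
  have "Qf \<odot> (q\<^sub>b \<odot> k) = (q\<^sub>c \<odot> f) \<odot> k" using Qf(1) dq mk(3) mf(2) by (simp add: assoc_eq[OF Qf(2)])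
  also have "\<dots> = zero_mor C (Dom C k) (Cod C Qf)" using kD Qf(1) dq mf(2) by simp
  finally have "Qf \<odot> (q\<^sub>b \<odot> k) = zero_mor C (Dom C k) (Cod C Qf)" .
  moreover have "q\<^sub>b \<odot> k \<in> Hom C (Dom C k) (Dom C Qf)" using Qf(1) dq mk(3) by simp
  ultimately obtain r where r: "r \<in> Hom C (Dom C k) (Dom C n)" "n \<odot> r = q\<^sub>b \<odot> k"
    using kernel_lift[OF n] by blast
  have rr: "regular_epi C r"
    by (rule split_epi_kernel_restriction_regular[OF sec qb(1) _ _ Qf(2) Qs(2)[symmetric] k(1) n r])
      (use dq mf(2) Qf(1) in simp_all)
  have xt: "x \<odot> t\<^sub>a \<in> Hom C (Dom C t\<^sub>a) (Dom C k)" using xD taD(3,5) mk(3) by simp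
  \<comment> \<open>An element \<open>i\<close> is killed by \<open>r\<close> exactly when
    \<open>q\<^sub>b\<close> kills \<open>k \<odot> i\<close>, that is, when
    \<open>k \<odot> i\<close> lies in T(K[b]); then \<open>meet\<close> applies.\<close>
  have "is_kernel C (x \<odot> t\<^sub>a) r"
  proof (rule kernelI)
    show "monic C (x \<odot> t\<^sub>a)" using kernel_monic[OF qa(2)] .
    have "n \<odot> (r \<odot> (x \<odot> t\<^sub>a)) = Qk \<odot> (q\<^sub>a \<odot> (x \<odot> t\<^sub>a))"
      using assoc_eq[OF r(2), of "x \<odot> t\<^sub>a"] assoc_eq[OF Qk(2), of "x \<odot> t\<^sub>a"] xt r(1) nD(1) dq Qk(1) mk(3) by simp
    also have "\<dots> = zero_mor C (Dom C t\<^sub>a) (Cod C n)"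
      using kernelD(4)[OF qa(2)] xt Qk(1) nD(1,3) Qf(1) taD(3) by simp
    finally show "r \<odot> (x \<odot> t\<^sub>a) = zero_mor C (Dom C (x \<odot> t\<^sub>a)) (Cod C r)"
      using monic_zero_cancel[OF kernel_monic[OF n], of "r \<odot> (x \<odot> t\<^sub>a)" "Dom C t\<^sub>a"] r(1) xt by simp
    fix V i assume i: "V \<in> Obj C" "i \<in> Hom C V (Dom C r)" "r \<odot> i = zero_mor C V (Cod C r)"
    have iH: "i \<in> Hom C V (Dom C k)" using i(2) r(1) by simp
    have "q\<^sub>b \<odot> (k \<odot> i) = n \<odot> (r \<odot> i)" using iH r(1) nD(1) dq mk(3) by (simp add: assoc_eq[OF r(2)])
    also have "\<dots> = zero_mor C V (Cod C q\<^sub>b)" using i(1,3) r(1) nD(1,3) Qf(1) by simp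
    finally have "q\<^sub>b \<odot> (k \<odot> i) = zero_mor C V (Cod C q\<^sub>b)" .
    moreover have "k \<odot> i \<in> Hom C V (Dom C q\<^sub>b)" using iH mk(3) dq by simp
    ultimately obtain j where j: "j \<in> Hom C V (Dom C (y \<odot> t\<^sub>b))" "(y \<odot> t\<^sub>b) \<odot> j = k \<odot> i"
      using kernel_lift[OF qb(2)] by blast
    show "\<exists>w \<in> Hom C V (Dom C (x \<odot> t\<^sub>a)). (x \<odot> t\<^sub>a) \<odot> w = i"
      by (rule meet[OF iH _ j(2)[symmetric]]) (use j(1) yD(1) tbD(3,5) in simp)
  qed (use r(1) xt in simp_all)
  then have "is_cokernel C r (x \<odot> t\<^sub>a)" using regular_epi_cokernel rr by blast
  \<comment> \<open>\<open>r\<close> and \<open>q\<^sub>a\<close> are both cokernels of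
    \<open>x \<odot> t\<^sub>a\<close>; the resulting isomorphism identifies \<open>Qk\<close> with
    the kernel \<open>n\<close> of \<open>Qf\<close>.\<close>
  then obtain \<theta> where \<theta>: "iso C \<theta>" "\<theta> \<in> Hom C (Cod C q\<^sub>a) (Cod C r)" "\<theta> \<odot> q\<^sub>a = r"
    using cokernel_unique[OF regular_epi_cokernel[OF qa]] by blast
  have "n \<odot> \<theta> = Qk"
  proof (rule epicD[OF regular_epi_epic[OF qa(1)], where Y = "Cod C q\<^sub>b"])
    show "(n \<odot> \<theta>) \<odot> q\<^sub>a = Qk \<odot> q\<^sub>a" using \<theta>(2) r(1) nD(1) dq by (simp add: \<theta>(3) r(2) Qk(2))
  qed (use \<theta>(2) r(1) nD(1,3) Qf(1) Qk(1) in simp_all)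
  then have kerQ: "is_kernel C Qk Qf" using kernel_iso[OF n \<theta>(1)] \<theta>(2) r(1) by simp

  have MQk: "(a', b', Qk, k') \<in> Mor Arr" using Qk a'(1) b'(1) mk(4) by simp
  have MQf: "(b', c', Qf, f') \<in> Mor Arr" using Qf b'(1) c'(1) mf(3) by simp
  show "\<exists>t\<^sub>1 e\<^sub>1 t\<^sub>2 e\<^sub>2 t\<^sub>3 e\<^sub>3 k' f'. torsion_sequence Arr \<T>\<^sub>1 \<F>\<^sub>1 (Dom Arr \<kappa>) t\<^sub>1 e\<^sub>1 \<and>
      torsion_sequence Arr \<T>\<^sub>1 \<F>\<^sub>1 (Dom Arr \<phi>) t\<^sub>2 e\<^sub>2 \<and> torsion_sequence Arr \<T>\<^sub>1 \<F>\<^sub>1 (Cod Arr \<phi>) t\<^sub>3 e\<^sub>3 \<and>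
      is_kernel Arr k' f' \<and> k' \<in> Hom Arr (Cod Arr e\<^sub>1) (Cod Arr e\<^sub>2) \<and> f' \<in> Hom Arr (Cod Arr e\<^sub>2) (Cod Arr e\<^sub>3) \<and>
      k' \<odot>\<^bsub>Arr\<^esub> e\<^sub>1 = e\<^sub>2 \<odot>\<^bsub>Arr\<^esub> \<kappa> \<and> f' \<odot>\<^bsub>Arr\<^esub> e\<^sub>2 = e\<^sub>3 \<odot>\<^bsub>Arr\<^esub> \<phi>"
  proof (intro exI conjI)
    show "torsion_sequence Arr \<T>\<^sub>1 \<F>\<^sub>1 (Dom Arr \<kappa>) (zero_mor C (Dom C t\<^sub>a) Z, a, x \<odot> t\<^sub>a, zero_mor C Z (Cod C a))
      (a, a', q\<^sub>a, Idn C (Cod C a))" using Ta unfolding \<kappa> by simp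
    show "torsion_sequence Arr \<T>\<^sub>1 \<F>\<^sub>1 (Dom Arr \<phi>) (zero_mor C (Dom C t\<^sub>b) Z, b, y \<odot> t\<^sub>b, zero_mor C Z (Cod C b))
      (b, b', q\<^sub>b, Idn C (Cod C b))" using Tb unfolding \<phi> by simp
    show "torsion_sequence Arr \<T>\<^sub>1 \<F>\<^sub>1 (Cod Arr \<phi>) (zero_mor C (Dom C t\<^sub>c) Z, c, z \<odot> t\<^sub>c, zero_mor C Z (Cod C c))
      (c, c', q\<^sub>c, Idn C (Cod C c))" using Tc unfolding \<phi> by simp
    show "is_kernel Arr (a', b', Qk, k') (b', c', Qf, f')" by (rule arrow_kernelI[OF kerQ k(2) MQk MQf])
    show "(a', b', Qk, k') \<in> Hom Arr (Cod Arr (a, a', q\<^sub>a, Idn C (Cod C a))) (Cod Arr (b, b', q\<^sub>b, Idn C (Cod C b)))"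
      "(b', c', Qf, f') \<in> Hom Arr (Cod Arr (b, b', q\<^sub>b, Idn C (Cod C b))) (Cod Arr (c, c', q\<^sub>c, Idn C (Cod C c)))"
      using MQk MQf unfolding in_Hom arrow_cat_simps(3,4) by blast+
    show "(a', b', Qk, k') \<odot>\<^bsub>Arr\<^esub> (a, a', q\<^sub>a, Idn C (Cod C a)) = (b, b', q\<^sub>b, Idn C (Cod C b)) \<odot>\<^bsub>Arr\<^esub> \<kappa>"
      unfolding \<kappa> using Qk(2) mk(4) by simp
    show "(b', c', Qf, f') \<odot>\<^bsub>Arr\<^esub> (b, b', q\<^sub>b, Idn C (Cod C b)) = (c, c', q\<^sub>c, Idn C (Cod C c)) \<odot>\<^bsub>Arr\<^esub> \<phi>"
      unfolding \<phi> using Qf(2) mf(3) by simp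
  qed
qed

end

theorem proposition4p2:
  fixes A :: "('o, 'm) cat" and \<T> \<F> :: "'o set"
  assumes "homological A"
    and "torsion_theory A \<T> \<F>"
    and "condition_N A \<T> \<F>"
  shows "torsion_theory (arrow_cat A) (arrow_torsion A \<T>) (arrow_torsion_free A \<F>)
       \<and> condition_N (arrow_cat A) (arrow_torsion A \<T>) (arrow_torsion_free A \<F>)
       \<and> (condition_P A \<T> \<F> \<longrightarrow>
            condition_P (arrow_cat A) (arrow_torsion A \<T>) (arrow_torsion_free A \<F>))"
proof -
  interpret normal_torsion_category A \<T> \<F>
    by (intro normal_torsion_category.intro normal_torsion_category_axioms.intro
        homological_categoryI torsion_categoryI assms)
  show ?thesis using torsion_theory_arrow_cat condition_N_arrow_cat condition_P_arrow_cat by blast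
qed

end
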